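(* Consider $\dot x=f(x;\mu)$, $(x,\mu)\in\mathbb R^{4}\times\mathbb R$, with $f$ analytic, and suppose that conditions (B1), (B2), (B3) stated in the context hold, together with the following condition. (C) The variational equation $\dot\xi=\mathrm D_xf(x^{\mathrm h}(t);0)\xi$ has another bounded solution (on $\mathbb R$), linearly independent of the bounded solution $\xi=\dot x^{\mathrm h}(t)$. Then the variational equation $\dot\xi=\mathrm D_xf(x^{\mathrm h}(t);0)\xi$ has a triangularizable differential Galois group, when regarded as a complex differential equation with meromorphic coefficients in the desingularized neighborhood $\Gamma_{\mathrm{loc}}$ (defined in the context) of the homoclinic orbit $x^{\mathrm h}(t)$ in $\mathbb C^4$.
   Context: The function $f:\mathbb R^4\times\mathbb R\to\mathbb R^4$ is analytic. The variational equation (VE) around a homoclinic orbit $x^{\mathrm h}(t)$ at $\mu=0$ is $\dot\xi=\mathrm D_xf(x^{\mathrm h}(t);0)\xi$, $\xi\in\mathbb C^4$; its domain is extended to a neighborhood of $\mathbb R$ in $\mathbb C$ (possible by analyticity). (B1) At $\mu=0$ the origin $x=0$ is a hyperbolic saddle equilibrium of $\dot x=f(x;\mu)$ and has a homoclinic orbit $x^{\mathrm h}(t)$, and $\mathrm D_xf(0;0)$ has four real eigenvalues $\tilde\lambda_1\le\tilde\lambda_2<0<\tilde\lambda_3\le\tilde\lambda_4$. (B2) There are a neighborhood $U$ of $0$ in $\mathbb C$, analytic functions $h_\pm:U\to\mathbb C^4$ with $h_\pm'(0)\ne0$, and numbers $\lambda_+\in\{\tilde\lambda_3,\tilde\lambda_4\}$,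 $\lambda_-\in\{\tilde\lambda_1,\tilde\lambda_2\}$ such that $x^{\mathrm h}(t)=h_+(e^{\lambda_-t})$ for $\mathrm{Re}\,t>0$ with $e^{\lambda_-t}\in U$, and $x^{\mathrm h}(t)=h_-(e^{\lambda_+t})$ for $\mathrm{Re}\,t<0$ with $e^{\lambda_+t}\in U$. (B3) The VE has a solution $\xi=\varphi(t)$ such that, for $|z|\ll1$, $$\varphi(\lambda_-^{-1}\log z)=a_+(z)z^{\lambda_+'/\lambda_-}+b_{1+}(z)z^{\tilde\lambda_1/\lambda_-}+b_{2+}(z)z^{\tilde\lambda_2/\lambda_-}\ \text{ or }\ \varphi(\lambda_-^{-1}\log z)=a_+(z)z^{\lambda_+'/\lambda_-}+b_{1+}(z)z+b_{2+}(z)z\log z,$$ and $$\varphi(\lambda_+^{-1}\log z)=a_-(z)z^{\lambda_-'/\lambda_+}+b_{1-}(z)z^{\tilde\lambda_3/\lambda_+}+b_{2-}(z)z^{\tilde\lambda_4/\lambda_+}\ \text{ or }\ \varphi(\lambda_+^{-1}\log z)=a_-(z)z^{\lambda_-'/\lambda_+}+b_{1-}(z)z+b_{2-}(z)z\log z,$$ where $a_\pm,b_{1\pm},b_{2\pm}$ are analytic in $U$ with $a_\pm(0)\ne0$, $\lambda_+'\in\{\tilde\lambda_3,\tilde\lambda_4\}$ and $\lambda_-'\in\{\tilde\lambda_1,\tilde\lambda_2\}$. (The second alternative in the first line, resp. in the second line, can hold only if $\tilde\lambda_1=\tilde\lambda_2$, resp. $\tilde\lambda_3=\tilde\lambda_4$.)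 Riemann surface $\Gamma_{\mathrm{loc}}$: let $U_{\mathbb R}$ be a neighborhood of $\mathbb R\cup\{\infty\}$ in the Riemann sphere and $\Gamma=\{x^{\mathrm h}(t)\mid t\in U_{\mathbb R}\}$. The curve $\Gamma_0=\{x^{\mathrm h}(t)\mid t\in\mathbb R\}\cup\{0\}$ is desingularized by replacing the double point $x=0$ with two points $0_+$ and $0_-$, represented in the temporal parameterization by $t=+\infty$ and $t=-\infty$ respectively. Let $\Sigma_\pm$ be neighborhoods of $0_\pm$ on $\Gamma$, and $\Sigma_t$ a sufficiently narrow, simply connected neighborhood of $\Gamma_0\setminus(\Sigma_+\cup\Sigma_-)$; set $\Gamma_{\mathrm{loc}}=\Sigma_-\cup\Sigma_t\cup\Sigma_+$, taken sufficiently small. Charts: $\Sigma_+$ has coordinate $z=e^{\lambda_-t}$, $\Sigma_-$ has coordinate $z=e^{\lambda_+t}$, and $\Sigma_t$ has coordinate $t$. In $\Sigma_t$ the VE keeps its form; in $\Sigma_+$ it becomes $\frac{d\xi}{dz}=\frac1{\lambda_-z}\mathrm D_xf(h_+(z);0)\xi$ and in $\Sigma_-$ it becomes $\frac{d\xi}{dz}=\frac1{\lambda_+z}\mathrm D_xf(h_-(z);0)\xi$. $\Gamma_{\mathrm{loc}}$ is taken so small that the only singularities are $z=0$ in $\Sigma_\pm$. The differential Galois group is taken over the field of meromorphic functions on $\Gamma_{\mathrm{loc}}$; it is triangularizable if it is conjugate to a group of upper triangular matrices. *)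

theory Defs
  imports "HOL-Complex_Analysis.Complex_Analysis"
begin

section \<open>Analyticity and complexification\<close>

text \<open>Local expansion in a multivariate power series; the multi-indices are functions on the
  standard basis, and \<open>has_sum\<close> is unconditional summation over all of them.\<close>

definition real_analytic_on ::
    "('a::euclidean_space \<Rightarrow> 'b::euclidean_space) \<Rightarrow> 'a set \<Rightarrow> bool" where
  "real_analytic_on f A \<longleftrightarrow>
     (\<forall>p\<in>A. \<exists>(c :: ('a \<Rightarrow> nat) \<Rightarrow> 'b) r. 0 < r \<and>
        (\<forall>x\<in>ball p r.
           ((\<lambda>\<alpha>. (\<Prod>b\<in>Basis. ((x - p) \<bullet> b) ^ \<alpha> b) *\<^sub>R c \<alpha>) has_sum f x)
             {\<alpha>. \<forall>b. b \<notin> Basis \<longrightarrow> \<alpha> b = 0}))"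

definition cvec :: "real ^ 'n \<Rightarrow> complex ^ 'n" where
  "cvec x = (\<chi> i. complex_of_real (x $ i))"

definition vec_holomorphic_on :: "(complex \<Rightarrow> complex ^ 'n) \<Rightarrow> complex set \<Rightarrow> bool" where
  "vec_holomorphic_on h U \<longleftrightarrow> (\<forall>i. (\<lambda>z. h z $ i) holomorphic_on U)"

definition vec_deriv :: "(complex \<Rightarrow> complex ^ 'n) \<Rightarrow> complex \<Rightarrow> complex ^ 'n" where
  "vec_deriv h z = (\<chi> i. deriv (\<lambda>w. h w $ i) z)"

text \<open>\<open>F\<close> is a holomorphic extension of \<open>g\<close> to the open set \<open>W\<close> in complex space. For real
  analytic \<open>g\<close> such an extension exists, and its germ along the real points is unique.\<close>

definition complexification ::
    "(real ^ 'n \<Rightarrow> real ^ 'n) \<Rightarrow> (complex ^ 'n \<Rightarrow> complex ^ 'n) \<Rightarrow> (complex ^ 'n) set \<Rightarrow> bool" where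
  "complexification g F W \<longleftrightarrow>
     open W \<and> range cvec \<subseteq> W \<and>
     (\<forall>x\<in>W. \<exists>J :: complex ^ 'n ^ 'n. (F has_derivative (\<lambda>h. J *v h)) (at x)) \<and>
     (\<forall>x. F (cvec x) = cvec (g x))"

definition complexified_orbit ::
    "(real \<Rightarrow> real ^ 'n) \<Rightarrow> (complex \<Rightarrow> complex ^ 'n) \<Rightarrow> complex set \<Rightarrow> bool" where
  "complexified_orbit x X \<Omega> \<longleftrightarrow>
     open \<Omega> \<and> range complex_of_real \<subseteq> \<Omega> \<and> vec_holomorphic_on X \<Omega> \<and>
     (\<forall>t. X (complex_of_real t) = cvec (x t))"


section \<open>Homoclinic orbits and the variational equation\<close>

definition homoclinic_orbit_to_0 :: "(real ^ 'n \<Rightarrow> real ^ 'n) \<Rightarrow> (real \<Rightarrow> real ^ 'n) \<Rightarrow> bool" where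
  "homoclinic_orbit_to_0 g x \<longleftrightarrow>
     (\<forall>t. (x has_vector_derivative g (x t)) (at t)) \<and>
     (x \<longlongrightarrow> 0) at_top \<and> (x \<longlongrightarrow> 0) at_bot \<and> (\<exists>t. x t \<noteq> 0)"

definition ve_solution_real ::
    "(real ^ 'n \<Rightarrow> real ^ 'n) \<Rightarrow> (real \<Rightarrow> real ^ 'n) \<Rightarrow> (real \<Rightarrow> complex ^ 'n) \<Rightarrow> bool" where
  "ve_solution_real g x \<xi> \<longleftrightarrow>
     (\<forall>t. (\<xi> has_vector_derivative
             (map_matrix complex_of_real (jacobian g (at (x t))) *v \<xi> t)) (at t))"

definition ve_solution_on ::
    "(complex ^ 'n \<Rightarrow> complex ^ 'n) \<Rightarrow> (complex \<Rightarrow> complex ^ 'n) \<Rightarrow> (complex \<Rightarrow> complex ^ 'n)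
       \<Rightarrow> complex set \<Rightarrow> bool" where
  "ve_solution_on F X \<xi> \<Omega> \<longleftrightarrow>
     (\<forall>t\<in>\<Omega>. \<forall>i. ((\<lambda>s. \<xi> s $ i) has_field_derivative ((jacobian F (at (X t)) *v \<xi> t) $ i)) (at t))"

text \<open>The form, near one end of the orbit, of the solution \<open>\<phi>\<close> in the local coordinate
  \<open>z = exp (l * t)\<close>: \<open>l\<close> is the decay rate at that end, \<open>k\<close> the exponent of the growing part and
  \<open>m1\<close>, \<open>m2\<close> are the two exponents of the decaying part. The logarithm and the powers are principal
  branches; the same branch is used on both sides of the equation.\<close>

definition end_expansion ::
    "complex set \<Rightarrow> real \<Rightarrow> real \<Rightarrow> real \<Rightarrow> real \<Rightarrow> (complex \<Rightarrow> complex ^ 'n) \<Rightarrow> bool" where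
  "end_expansion U l k m1 m2 \<phi> \<longleftrightarrow>
     (\<exists>a b1 b2. vec_holomorphic_on a U \<and> vec_holomorphic_on b1 U \<and> vec_holomorphic_on b2 U \<and>
        a 0 \<noteq> 0 \<and>
        ((\<forall>\<^sub>F z in at 0.
            \<phi> (Ln z / of_real l) =
              (z powr of_real (k / l)) *s a z
              + (z powr of_real (m1 / l)) *s b1 z
              + (z powr of_real (m2 / l)) *s b2 z)
         \<or> (m1 = m2 \<and>
            (\<forall>\<^sub>F z in at 0.
               \<phi> (Ln z / of_real l) =
                 (z powr of_real (k / l)) *s a z + z *s b1 z + (z * Ln z) *s b2 z))))"


section \<open>Differential Galois groups\<close>

text \<open>All fields are subfields of one ambient field, given by the type \<open>'l\<close>; the derivation
  need only be one on the subfield under consideration.\<close>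

definition is_subfield :: "'l::field set \<Rightarrow> bool" where
  "is_subfield K \<longleftrightarrow> 0 \<in> K \<and> 1 \<in> K \<and>
     (\<forall>x\<in>K. \<forall>y\<in>K. x + y \<in> K \<and> x * y \<in> K) \<and> (\<forall>x\<in>K. - x \<in> K \<and> inverse x \<in> K)"

definition differential_field :: "('l::field \<Rightarrow> 'l) \<Rightarrow> 'l set \<Rightarrow> bool" where
  "differential_field \<delta> K \<longleftrightarrow> is_subfield K \<and>
     (\<forall>x\<in>K. \<delta> x \<in> K) \<and>
     (\<forall>x\<in>K. \<forall>y\<in>K. \<delta> (x + y) = \<delta> x + \<delta> y \<and> \<delta> (x * y) = \<delta> x * y + x * \<delta> y)"

definition constants :: "('l::field \<Rightarrow> 'l) \<Rightarrow> 'l set \<Rightarrow> 'l set" where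
  "constants \<delta> K = {x \<in> K. \<delta> x = 0}"

definition matrix_entries :: "'l ^ 'n ^ 'm \<Rightarrow> 'l set" where
  "matrix_entries M = {M $ i $ j |i j. True}"

text \<open>\<open>L\<close> is a Picard-Vessiot extension of \<open>K\<close> for the system \<open>\<delta> \<xi> = A \<xi>\<close>, with fundamental
  matrix \<open>Y\<close>.\<close>

definition picard_vessiot ::
    "('l::field \<Rightarrow> 'l) \<Rightarrow> 'l set \<Rightarrow> 'l ^ 'n ^ 'n \<Rightarrow> 'l set \<Rightarrow> 'l ^ 'n ^ 'n \<Rightarrow> bool" where
  "picard_vessiot \<delta> K A L Y \<longleftrightarrow>
     differential_field \<delta> K \<and> matrix_entries A \<subseteq> K \<and>
     differential_field \<delta> L \<and> K \<subseteq> L \<and>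
     map_matrix \<delta> Y = A ** Y \<and> invertible Y \<and>
     L = \<Inter>{M. is_subfield M \<and> K \<union> matrix_entries Y \<subseteq> M} \<and>
     constants \<delta> L = constants \<delta> K"

definition diff_galois_group :: "('l::field \<Rightarrow> 'l) \<Rightarrow> 'l set \<Rightarrow> 'l set \<Rightarrow> ('l \<Rightarrow> 'l) set" where
  "diff_galois_group \<delta> K L =
     {\<sigma> \<in> extensional L. bij_betw \<sigma> L L \<and>
        (\<forall>x\<in>L. \<forall>y\<in>L. \<sigma> (x + y) = \<sigma> x + \<sigma> y \<and> \<sigma> (x * y) = \<sigma> x * \<sigma> y) \<and>
        (\<forall>x\<in>L. \<sigma> (\<delta> x) = \<delta> (\<sigma> x)) \<and> (\<forall>x\<in>K. \<sigma> x = x)}"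

text \<open>The matrix representation with respect to the fundamental matrix \<open>Y\<close>: the automorphism
  \<open>\<sigma>\<close> acts by \<open>\<sigma> Y = Y M\<close>.\<close>

definition galois_matrices ::
    "('l::field \<Rightarrow> 'l) \<Rightarrow> 'l set \<Rightarrow> 'l set \<Rightarrow> 'l ^ 'n ^ 'n \<Rightarrow> ('l ^ 'n ^ 'n) set" where
  "galois_matrices \<delta> K L Y = {M. \<exists>\<sigma>\<in>diff_galois_group \<delta> K L. map_matrix \<sigma> Y = Y ** M}"

definition upper_triangular :: "'l::zero ^ 'n::{finite,linorder} ^ 'n::{finite,linorder} \<Rightarrow> bool" where
  "upper_triangular M \<longleftrightarrow> (\<forall>i j. j < i \<longrightarrow> M $ i $ j = 0)"

definition triangularizable :: "'l::field set \<Rightarrow> ('l ^ 'n::{finite,linorder} ^ 'n::{finite,linorder}) set \<Rightarrow> bool" where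
  "triangularizable C G \<longleftrightarrow>
     (\<exists>P :: 'l ^ 'n::{finite,linorder} ^ 'n::{finite,linorder}. matrix_entries P \<subseteq> C \<and> matrix_entries (matrix_inv P) \<subseteq> C \<and> invertible P \<and>
          (\<forall>M\<in>G. upper_triangular (matrix_inv P ** M ** P)))"


section \<open>The desingularized neighborhood of the orbit\<close>

text \<open>The Riemann surface is given by its charts: \<open>Mid\<close> has the coordinate \<open>t\<close>, \<open>Pos\<close>
  has the coordinate \<open>z = exp (lm * t)\<close> near \<open>t = +\<infinity>\<close>, and \<open>Neg\<close> has the coordinate
  \<open>z = exp (lp * t)\<close> near \<open>t = -\<infinity>\<close>. The added points are \<open>z = 0\<close> in \<open>Pos\<close> and in \<open>Neg\<close>.
  The two overlaps are listed by their \<open>t\<close>-coordinates. Functions on the surface are families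
  of functions of the chart coordinates that agree on the overlaps.\<close>

datatype chart = Neg | Mid | Pos

definition overlap_pos :: "real \<Rightarrow> (chart \<Rightarrow> complex set) \<Rightarrow> complex set" where
  "overlap_pos lm \<Sigma> = {t \<in> \<Sigma> Mid. 0 < Re t \<and> exp (of_real lm * t) \<in> \<Sigma> Pos}"

definition overlap_neg :: "real \<Rightarrow> (chart \<Rightarrow> complex set) \<Rightarrow> complex set" where
  "overlap_neg lp \<Sigma> = {t \<in> \<Sigma> Mid. Re t < 0 \<and> exp (of_real lp * t) \<in> \<Sigma> Neg}"

text \<open>\<open>\<epsilon>\<close> bounds the size of the end neighborhoods and the width of the middle part; the
  middle part has to cover everything on the orbit that is not in an end neighborhood.\<close>

definition gamma_loc :: "real \<Rightarrow> real \<Rightarrow> real \<Rightarrow> (chart \<Rightarrow> complex set) \<Rightarrow> bool" where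
  "gamma_loc lm lp \<epsilon> \<Sigma> \<longleftrightarrow>
     (\<forall>c\<in>{Neg, Pos}. open (\<Sigma> c) \<and> connected (\<Sigma> c) \<and> 0 \<in> \<Sigma> c \<and> \<Sigma> c \<subseteq> ball 0 \<epsilon>) \<and>
     open (\<Sigma> Mid) \<and> simply_connected (\<Sigma> Mid) \<and> \<Sigma> Mid \<subseteq> {t. \<bar>Im t\<bar> < \<epsilon>} \<and>
     (\<forall>t::real. \<not> (0 < t \<and> of_real (exp (lm * t)) \<in> \<Sigma> Pos) \<and>
                \<not> (t < 0 \<and> of_real (exp (lp * t)) \<in> \<Sigma> Neg) \<longrightarrow> of_real t \<in> \<Sigma> Mid)"

text \<open>Meromorphic functions are represented by functions whose values on a sparse set are
  irrelevant, so agreement on the overlaps, and equality, are required only off a sparse set.\<close>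

definition mero_functions ::
    "real \<Rightarrow> real \<Rightarrow> (chart \<Rightarrow> complex set) \<Rightarrow> (chart \<Rightarrow> complex \<Rightarrow> complex) set" where
  "mero_functions lm lp \<Sigma> =
     {g. (\<forall>c. g c meromorphic_on \<Sigma> c) \<and>
         (\<forall>\<^sub>\<approx>t\<in>overlap_pos lm \<Sigma>. g Mid t = g Pos (exp (of_real lm * t))) \<and>
         (\<forall>\<^sub>\<approx>t\<in>overlap_neg lp \<Sigma>. g Mid t = g Neg (exp (of_real lp * t)))}"

definition mero_eq ::
    "(chart \<Rightarrow> complex set) \<Rightarrow> (chart \<Rightarrow> complex \<Rightarrow> complex) \<Rightarrow> (chart \<Rightarrow> complex \<Rightarrow> complex) \<Rightarrow> bool" where
  "mero_eq \<Sigma> g h \<longleftrightarrow> (\<forall>c. \<forall>\<^sub>\<approx>z\<in>\<Sigma> c. g c z = h c z)"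

text \<open>The derivation \<open>d/dt\<close>; in the charts at the ends it is \<open>lm * z * d/dz\<close> and
  \<open>lp * z * d/dz\<close>.\<close>

definition mero_deriv ::
    "real \<Rightarrow> real \<Rightarrow> (chart \<Rightarrow> complex \<Rightarrow> complex) \<Rightarrow> chart \<Rightarrow> complex \<Rightarrow> complex" where
  "mero_deriv lm lp g c z =
     (case c of Neg \<Rightarrow> of_real lp * z | Mid \<Rightarrow> 1 | Pos \<Rightarrow> of_real lm * z) * deriv (g c) z"

text \<open>\<open>\<iota>\<close> identifies the differential field of meromorphic functions on the surface with a
  subfield of the ambient field \<open>'l\<close>, the derivation \<open>d/dt\<close> corresponding to \<open>\<delta>\<close>.\<close>

definition mero_embedding ::
    "real \<Rightarrow> real \<Rightarrow> (chart \<Rightarrow> complex set) \<Rightarrow> ('l::field \<Rightarrow> 'l)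
       \<Rightarrow> ((chart \<Rightarrow> complex \<Rightarrow> complex) \<Rightarrow> 'l) \<Rightarrow> bool" where
  "mero_embedding lm lp \<Sigma> \<delta> \<iota> \<longleftrightarrow>
     (\<forall>g\<in>mero_functions lm lp \<Sigma>. \<forall>h\<in>mero_functions lm lp \<Sigma>.
        (\<iota> g = \<iota> h \<longleftrightarrow> mero_eq \<Sigma> g h) \<and>
        \<iota> (\<lambda>c z. g c z + h c z) = \<iota> g + \<iota> h \<and>
        \<iota> (\<lambda>c z. g c z * h c z) = \<iota> g * \<iota> h) \<and>
     \<iota> (\<lambda>c z. 1) = 1 \<and>
     (\<forall>g\<in>mero_functions lm lp \<Sigma>. \<iota> (mero_deriv lm lp g) = \<delta> (\<iota> g))"

text \<open>The parameterization of the surface in each chart, and the coefficient matrix of the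
  variational equation. With respect to \<open>d/dt\<close> the system is \<open>\<delta> \<xi> = DF \<xi>\<close> in all charts; in
  \<open>Pos\<close> and \<open>Neg\<close>, where \<open>d/dt\<close> is \<open>l * z * d/dz\<close>, this is \<open>d\<xi>/dz = 1 / (l * z) * DF \<xi>\<close>.\<close>

definition gamma_param ::
    "(complex \<Rightarrow> complex ^ 'n) \<Rightarrow> (complex \<Rightarrow> complex ^ 'n) \<Rightarrow> (complex \<Rightarrow> complex ^ 'n)
       \<Rightarrow> chart \<Rightarrow> complex \<Rightarrow> complex ^ 'n" where
  "gamma_param hm X hp c = (case c of Neg \<Rightarrow> hm | Mid \<Rightarrow> X | Pos \<Rightarrow> hp)"

definition ve_matrix ::
    "((chart \<Rightarrow> complex \<Rightarrow> complex) \<Rightarrow> 'l) \<Rightarrow> (complex ^ 'n \<Rightarrow> complex ^ 'n)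
       \<Rightarrow> (chart \<Rightarrow> complex \<Rightarrow> complex ^ 'n) \<Rightarrow> 'l ^ 'n ^ 'n" where
  "ve_matrix \<iota> F p = (\<chi> i j. \<iota> (\<lambda>c z. jacobian F (at (p c z)) $ i $ j))"

text \<open>A differential Galois group is that of a Picard-Vessiot extension, which is unique up to
  isomorphism; the property is required of every such extension, in every ambient field of
  type \<open>'l\<close>, and with respect to every fundamental matrix. Such an extension exists at least for
  \<open>'l = complex fls\<close>, by Laurent expansion at a point of the middle part.\<close>

definition galois_triangularizable_over_mero ::
    "'l::field itself \<Rightarrow> real \<Rightarrow> real \<Rightarrow> (chart \<Rightarrow> complex set) \<Rightarrow> (complex ^ 'n::{finite,linorder} \<Rightarrow> complex ^ 'n::{finite,linorder})
       \<Rightarrow> (chart \<Rightarrow> complex \<Rightarrow> complex ^ 'n::{finite,linorder}) \<Rightarrow> bool" where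
  "galois_triangularizable_over_mero _ lm lp \<Sigma> F p \<longleftrightarrow>
     (\<forall>(\<delta> :: 'l \<Rightarrow> 'l) \<iota> K L Y.
        mero_embedding lm lp \<Sigma> \<delta> \<iota> \<longrightarrow>
        K = \<iota> ` mero_functions lm lp \<Sigma> \<longrightarrow>
        picard_vessiot \<delta> K (ve_matrix \<iota> F p) L Y \<longrightarrow>
        triangularizable (constants \<delta> K) (galois_matrices \<delta> K L Y))"

end

theory Submission
  imports Defs "HOL-Computational_Algebra.Fundamental_Theorem_Algebra"
begin

text \<open>The Galois group is triangularizable because the solution space of the variational
  equation carries a complete flag that is defined over the field of meromorphic functions.
  Let \<open>\<xi>0\<close> be the derivative of the complexified orbit, \<open>\<xi>1\<close> the holomorphic continuation of the
  second bounded solution, and \<open>\<phi>\<close> the solution with the prescribed expansions. The flag is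
  \<open>span {\<xi>0} \<subset> span {\<xi>0, \<xi>1} \<subset> span {\<xi>0, \<xi>1, \<phi>} \<subset> all solutions\<close>.

  The middle part of the surface is simply connected, so solutions are multivalued only through a
  turn around \<open>z = 0\<close> at an end. In the coordinate \<open>t\<close>, with \<open>z = exp (l * t)\<close>, such a turn is the
  translation by the period \<open>T = 2 * pi * i / l\<close>. The coefficients have the period \<open>T\<close> near the end,
  so the translation maps solutions to solutions, and it preserves the flag at both ends. The
  orbit is a function of \<open>z\<close>, hence \<open>\<xi>0\<close> is invariant. The translate of a bounded solution is bounded
  on the half line running into the end, by a Gronwall estimate; and since the equilibrium is
  hyperbolic with two eigenvalues of each sign, a quadratic form that grows exponentially shows
  that there the bounded solutions form a space of dimension at most two
  (\<open>dependent_bounded_solutions\<close>). As \<open>\<xi>0\<close> and \<open>\<xi>1\<close> are independent and bounded on the whole real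
  line, they are a basis of it at both ends simultaneously. By the expansion, the translate of \<open>\<phi>\<close> differs from a multiple of \<open>\<phi>\<close> by a
  bounded solution, while \<open>\<phi>\<close> itself is unbounded. So the monodromy matrices at both ends are
  triangular (\<open>triangular_monodromy\<close>).

  For such a flag, a minor built from the first \<open>k\<close> solutions is multiplied by a constant under each
  monodromy, and the quotient of two such minors is single-valued. Solutions grow at most
  exponentially in \<open>t\<close>, that is, at most like a power of \<open>1 / z\<close>, so the quotient is meromorphic at the
  added point too (\<open>semi_invariant_meromorphic\<close>). These quotients are the entries of a gauge
  transformation over the base field that makes the system triangular
  (\<open>triangularizable_if_triangular_monodromy\<close>). In a triangular system, two entries of a bottom
  row solve the same scalar equation and have a constant quotient, so column operations by constants
  make a fundamental matrix in the Picard-Vessiot field triangular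
  (\<open>constant_column_reduction\<close>). Automorphisms fix the gauge transformation and these constants,
  so in the new basis each of them is a quotient of two triangular matrices.\<close>

(* the dollar sign is reserved for the components of vectors and matrices *)
no_notation fps_nth (infixl "$" 75)

section \<open>Triangular systems over a differential field\<close>

lemma matrix_entries_subset_iff: "matrix_entries M \<subseteq> K \<longleftrightarrow> (\<forall>i j. M $ i $ j \<in> K)"
  by (auto simp: matrix_entries_def)

lemma subfield_uminus: "is_subfield K \<Longrightarrow> x \<in> K \<Longrightarrow> - x \<in> K"
  and subfield_add: "is_subfield K \<Longrightarrow> x \<in> K \<Longrightarrow> y \<in> K \<Longrightarrow> x + y \<in> K"
  and subfield_mult: "is_subfield K \<Longrightarrow> x \<in> K \<Longrightarrow> y \<in> K \<Longrightarrow> x * y \<in> K"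
  and subfield_0: "is_subfield K \<Longrightarrow> 0 \<in> K"
  and subfield_1: "is_subfield K \<Longrightarrow> 1 \<in> K"
  and subfield_inverse: "is_subfield K \<Longrightarrow> x \<in> K \<Longrightarrow> inverse x \<in> K"
  by (auto simp: is_subfield_def)

lemma subfield_divide: "is_subfield K \<Longrightarrow> x \<in> K \<Longrightarrow> y \<in> K \<Longrightarrow> x / y \<in> K"
  by (simp add: divide_inverse subfield_mult subfield_inverse)

lemma subfield_sum: "is_subfield K \<Longrightarrow> (\<And>i. i \<in> I \<Longrightarrow> f i \<in> K) \<Longrightarrow> sum f I \<in> K"
  by (induction I rule: infinite_finite_induct) (auto simp: subfield_add subfield_0)

lemma subfield_prod: "is_subfield K \<Longrightarrow> (\<And>i. i \<in> I \<Longrightarrow> f i \<in> K) \<Longrightarrow> prod f I \<in> K"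
  by (induction I rule: infinite_finite_induct) (auto simp: subfield_mult subfield_1)

lemma subfield_matrix_mult:
  "is_subfield K \<Longrightarrow> matrix_entries A \<subseteq> K \<Longrightarrow> matrix_entries B \<subseteq> K \<Longrightarrow> matrix_entries (A ** B) \<subseteq> K"
  unfolding matrix_entries_subset_iff
  by (auto simp: matrix_matrix_mult_def intro!: subfield_sum subfield_mult)

lemma subfield_det:
  assumes "is_subfield K" "\<And>i j. A $ i $ j \<in> K"
  shows "det A \<in> K"
proof -
  have "of_int (sign p) \<in> K" for p :: "'b \<Rightarrow> 'b"
    using assms(1) by (cases "sign p = 1") (auto simp: sign_def subfield_1 subfield_uminus)
  then show ?thesis
    unfolding det_def using assms by (auto intro!: subfield_sum subfield_mult subfield_prod)
qed

lemma invertible_matrix_inv: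
  fixes A :: "'a::semiring_1 ^ 'n ^ 'm"
  assumes "invertible A"
  shows "A ** matrix_inv A = mat 1" "matrix_inv A ** A = mat 1"
  using assms someI_ex[of "\<lambda>A'. A ** A' = mat 1 \<and> A' ** A = mat 1"]
  unfolding invertible_def matrix_inv_def by auto

text \<open>Cramer's rule keeps the inverse inside the field of the entries.\<close>

lemma subfield_matrix_inv:
  fixes A :: "'l::field ^ 'n ^ 'n"
  assumes K: "is_subfield K" and A: "matrix_entries A \<subseteq> K" and inv: "invertible A"
  shows "matrix_entries (matrix_inv A) \<subseteq> K"
  unfolding matrix_entries_subset_iff
proof (intro allI)
  fix k l
  have det: "det A \<noteq> 0" using inv by (simp add: invertible_det_nz)
  define x where "x = (\<chi> k. matrix_inv A $ k $ l)"
  have "A *v x = axis l 1"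
    using invertible_matrix_inv(1)[OF inv]
    by (auto simp: x_def vec_eq_iff matrix_vector_mult_def matrix_matrix_mult_def mat_def axis_def)
  then have x_eq: "x = (\<chi> k. det (\<chi> i j. if j = k then axis l 1 $ i else A $ i $ j) / det A)"
    using cramer[OF det, of x "axis l 1"] by blast
  have "x $ k = det (\<chi> i j. if j = k then axis l 1 $ i else A $ i $ j) / det A"
    by (subst x_eq) simp
  moreover have "det (\<chi> i j. if j = k then axis l 1 $ i else A $ i $ j) \<in> K"
    using A K by (intro subfield_det) (auto simp: matrix_entries_subset_iff axis_def subfield_0 subfield_1)
  moreover have "det A \<in> K"
    using A K by (intro subfield_det) (auto simp: matrix_entries_subset_iff)
  ultimately show "matrix_inv A $ k $ l \<in> K"
    using K by (simp add: x_def subfield_divide)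
qed

context
  fixes \<delta> :: "'l::field \<Rightarrow> 'l" and L :: "'l set"
  assumes L: "differential_field \<delta> L"
begin

lemma derivation_subfield: "is_subfield L"
  using L by (simp add: differential_field_def)

lemma derivation_add: "x \<in> L \<Longrightarrow> y \<in> L \<Longrightarrow> \<delta> (x + y) = \<delta> x + \<delta> y"
  and derivation_mult: "x \<in> L \<Longrightarrow> y \<in> L \<Longrightarrow> \<delta> (x * y) = \<delta> x * y + x * \<delta> y"
  using L by (auto simp: differential_field_def)

lemma derivation_0: "\<delta> 0 = 0"
  using derivation_add[of 0 0] subfield_0[OF derivation_subfield]
  by (metis add.right_neutral add_left_cancel)

lemma derivation_1: "\<delta> 1 = 0"
  using derivation_mult[of 1 1] subfield_1[OF derivation_subfield]
  by (metis add.right_neutral add_left_cancel mult.left_neutral mult.right_neutral)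

lemma derivation_sum: "(\<And>i. i \<in> I \<Longrightarrow> f i \<in> L) \<Longrightarrow> \<delta> (sum f I) = (\<Sum>i\<in>I. \<delta> (f i))"
  by (induction I rule: infinite_finite_induct)
     (auto simp: derivation_0 derivation_add subfield_sum[OF derivation_subfield])

lemma derivation_quotient_eq_0:
  assumes "x \<in> L" "y \<in> L" "\<delta> x = b * x" "\<delta> y = b * y" "y \<noteq> 0"
  shows "\<delta> (x / y) = 0"
proof -
  have "\<delta> (x / y * y) = \<delta> (x / y) * y + x / y * \<delta> y"
    using assms derivation_subfield by (intro derivation_mult subfield_divide)
  then show ?thesis using assms by simp
qed

lemma derivation_matrix_mult:
  fixes A :: "'l ^ 'n ^ 'm" and B :: "'l ^ 'k ^ 'n"
  assumes "matrix_entries A \<subseteq> L" "matrix_entries B \<subseteq> L"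
  shows "map_matrix \<delta> (A ** B) = map_matrix \<delta> A ** B + A ** map_matrix \<delta> B"
  using assms unfolding matrix_entries_subset_iff
  by (simp add: vec_eq_iff matrix_matrix_mult_def map_matrix_def derivation_sum derivation_mult
        subfield_mult[OF derivation_subfield] sum.distrib)

lemma subfield_constants: "is_subfield (constants \<delta> L)"
proof -
  have "\<delta> (- x) = 0" if "x \<in> L" "\<delta> x = 0" for x
    using derivation_add[of x "-x"] that derivation_0 subfield_uminus[OF derivation_subfield] by simp
  moreover have "\<delta> (inverse x) = 0" if "x \<in> L" "\<delta> x = 0" for x
    using derivation_quotient_eq_0[of 1 x 0] that derivation_0 derivation_1
      subfield_1[OF derivation_subfield] by (cases "x = 0") (auto simp: divide_inverse)
  ultimately show ?thesis
    using derivation_subfield derivation_0 derivation_1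
    unfolding is_subfield_def constants_def by (auto simp: derivation_add derivation_mult)
qed

end

text \<open>A permutation cannot map the rows from \<open>k\<close> on into the columns after \<open>k\<close>, since these are fewer; so
  every product in the Leibniz formula contains an entry of the zero block.\<close>

lemma det_eq_0_zero_block:
  fixes A :: "'a::comm_ring_1 ^ 'n::{finite,linorder} ^ 'n::{finite,linorder}"
  assumes zero: "\<And>i j. k \<le> i \<Longrightarrow> j \<le> k \<Longrightarrow> A $ i $ j = 0"
  shows "det A = 0"
  unfolding det_def
proof (rule sum.neutral, rule ballI)
  fix p assume "p \<in> {p. p permutes (UNIV :: 'n set)}"
  then have p: "inj p" by (simp add: permutes_inj)
  have "\<exists>i\<ge>k. p i \<le> k"
  proof (rule ccontr)
    assume "\<not> (\<exists>i\<ge>k. p i \<le> k)"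
    then have "p ` {k..} \<subseteq> {k<..}" by force
    moreover have "card (p ` {k..}) = card {k..}"
      using p by (intro card_image) (auto intro: inj_on_subset)
    ultimately have "card {k..} \<le> card {k<..}"
      using card_mono[of "{k<..}" "p ` {k..}"] by simp
    moreover have "{k..} = insert k {k<..}" by auto
    ultimately show False by simp
  qed
  then obtain i where "A $ i $ p i = 0" using zero by blast
  then have "(\<Prod>i\<in>UNIV. A $ i $ p i) = 0" by (intro prod_zero) auto
  then show "of_int (sign p) * (\<Prod>i\<in>UNIV. A $ i $ p i) = 0" by simp
qed

lemma sum_delta_row:
  fixes f :: "'n::finite \<Rightarrow> 'a::comm_ring_1"
  shows "(\<Sum>l\<in>UNIV. f l * (if l = a then 1 else 0)) = f a"
  by (simp add: if_distrib cong: if_cong)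

text \<open>The rows are cleared from the bottom upwards. Once the rows below row \<open>k\<close> are triangular, the
  entries of row \<open>k\<close> up to the diagonal all solve the scalar equation \<open>y' = B $ k $ k * y\<close>, so their
  quotients are constants, and one of them is nonzero by invertibility. That one is exchanged into
  the diagonal position and used to clear the others.\<close>

lemma constant_column_reduction:
  fixes Z B :: "'l::field ^ 'n::{finite,wellorder} ^ 'n::{finite,wellorder}"
  assumes L: "differential_field \<delta> L" and Z: "matrix_entries Z \<subseteq> L"
    and eq: "map_matrix \<delta> Z = B ** Z" and B: "upper_triangular B" and inv: "invertible Z"
  obtains P where "matrix_entries P \<subseteq> constants \<delta> L" "invertible P" "upper_triangular (Z ** P)"
proof -
  note Lf = derivation_subfield[OF L] and Cf = subfield_constants[OF L]
  have "\<forall>U. (\<forall>i j. i \<in> U \<longrightarrow> i \<le> j \<longrightarrow> j \<in> U) \<longrightarrow>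
     (\<exists>P. matrix_entries P \<subseteq> constants \<delta> L \<and> invertible P \<and>
       (\<forall>i\<in>U. \<forall>j<i. (Z ** P) $ i $ j = 0))" (is "\<forall>U. ?up U \<longrightarrow> ?red U")
  proof (intro allI)
    fix U :: "'n set"
    have "finite U" by simp
    then show "?up U \<longrightarrow> ?red U"
    \<comment> \<open>the sets \<open>U\<close> that occur are upper intervals, enlarged by adding a new least element \<open>k\<close>\<close>
    proof (induction U rule: finite_linorder_min_induct)
      case empty
      have "matrix_entries (mat 1 :: (('l, 'n) vec, 'n) vec) \<subseteq> constants \<delta> L"
        using subfield_0[OF Cf] subfield_1[OF Cf] by (simp add: matrix_entries_subset_iff mat_def)
      moreover have "invertible (mat 1 :: (('l, 'n) vec, 'n) vec)" by (simp add: invertible_det_nz)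
      ultimately show ?case by auto
    next
      case (insert k U)
      show ?case
      proof
        assume up: "?up (insert k U)"
        have Ueq: "U = {k<..}"
        proof (intro set_eqI iffI)
          fix x assume "x \<in> {k<..}"
          then show "x \<in> U" using up[rule_format, of k x, OF _ less_imp_le] by auto
        qed (use insert.hyps(2) in auto)
        then have "?up U" by auto
        then obtain P where P: "matrix_entries P \<subseteq> constants \<delta> L" "invertible P"
          and red: "\<And>i j. k < i \<Longrightarrow> j < i \<Longrightarrow> (Z ** P) $ i $ j = 0"
          using insert.IH Ueq by auto
        define W where "W = Z ** P"
        have PL: "matrix_entries P \<subseteq> L" using P(1) by (auto simp: constants_def)
        have WL: "W $ i $ j \<in> L" for i j
          using subfield_matrix_mult[OF Lf Z PL] by (simp add: W_def matrix_entries_subset_iff)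
        have "map_matrix \<delta> P = 0"
          using P(1) by (auto simp: map_matrix_def vec_eq_iff matrix_entries_subset_iff constants_def)
        then have dW: "map_matrix \<delta> W = B ** W"
          unfolding W_def derivation_matrix_mult[OF L Z PL] eq by (simp add: matrix_mul_assoc)
        have Winv: "invertible W" unfolding W_def using inv P(2) by (rule invertible_mult)
        have dWk: "\<delta> (W $ k $ j) = B $ k $ k * W $ k $ j" if "j \<le> k" for j
        proof -
          have "\<delta> (W $ k $ j) = map_matrix \<delta> W $ k $ j" by simp
          also have "\<dots> = (B ** W) $ k $ j" by (simp only: dW)
          also have "\<dots> = (\<Sum>l\<in>UNIV. B $ k $ l * W $ l $ j)"
            by (simp add: matrix_matrix_mult_def)
          also have "\<dots> = (\<Sum>l\<in>UNIV. if l = k then B $ k $ k * W $ k $ j else 0)"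
          proof (rule sum.cong[OF refl])
            fix l
            consider "l < k" | "l = k" | "k < l" by force
            then show "B $ k $ l * W $ l $ j = (if l = k then B $ k $ k * W $ k $ j else 0)"
              using B red[of l j] that by cases (auto simp: upper_triangular_def W_def)
          qed
          finally show ?thesis by simp
        qed
        have "\<exists>j0\<le>k. W $ k $ j0 \<noteq> 0"
        proof (rule ccontr)
          assume no: "\<not> (\<exists>j0\<le>k. W $ k $ j0 \<noteq> 0)"
          have "det W = 0"
          proof (rule det_eq_0_zero_block[of k])
            fix i j assume "k \<le> i" "j \<le> k"
            then show "W $ i $ j = 0" using no red[of i j] by (cases "i = k") (auto simp: W_def)
          qed
          then show False using Winv by (simp add: invertible_det_nz)
        qed
        then obtain j0 where j0: "j0 \<le> k" "W $ k $ j0 \<noteq> 0" by blast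
        \<comment> \<open>\<open>S\<close> exchanges the columns \<open>k\<close> and \<open>j0\<close>, and \<open>N\<close> then subtracts the multiples \<open>c j\<close> of column \<open>k\<close>
          from the columns to its left\<close>
        define s where "s = Transposition.transpose k j0"
        have s_le: "s j \<le> k" if "j \<le> k" for j
          using that j0(1) by (auto simp: s_def Transposition.transpose_def)
        have s_gt: "s j = j" if "k < j" for j
          using that j0(1) by (auto simp: s_def Transposition.transpose_def)
        have s_s: "s (s j) = j" for j by (simp add: s_def)
        define S :: "(('l, 'n) vec, 'n) vec" where "S = (\<chi> i j. if i = s j then 1 else 0)"
        define c where "c j = (if j < k then W $ k $ s j / W $ k $ j0 else 0)" for j
        define N :: "(('l, 'n) vec, 'n) vec" where
          "N = (\<chi> i j. (if i = j then 1 else 0) - (if i = k then c j else 0))"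
        have cC: "c j \<in> constants \<delta> L" for j
          using derivation_quotient_eq_0[OF L WL WL dWk dWk j0(2)] j0(1) s_le[of j] WL Lf
          by (auto simp: c_def constants_def subfield_divide subfield_0 derivation_0[OF L])
        have "matrix_entries S \<subseteq> constants \<delta> L"
          using subfield_0[OF Cf] subfield_1[OF Cf] by (simp add: matrix_entries_subset_iff S_def)
        moreover have "matrix_entries N \<subseteq> constants \<delta> L"
        proof -
          have "- c j \<in> constants \<delta> L" "1 - c j \<in> constants \<delta> L" for j
            using cC[of j] subfield_add[OF Cf subfield_1[OF Cf], of "- c j"] subfield_uminus[OF Cf, of "c j"]
            by auto
          then show ?thesis
            using subfield_0[OF Cf] subfield_1[OF Cf] by (simp add: matrix_entries_subset_iff N_def)
        qed
        ultimately have 1: "matrix_entries (P ** S ** N) \<subseteq> constants \<delta> L"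
          using P(1) Cf by (intro subfield_matrix_mult)
        have "S ** S = mat 1"
          by (auto simp: S_def vec_eq_iff matrix_matrix_mult_def mat_def sum_delta_row s_s)
        then have "invertible S" by (auto simp: invertible_right_inverse)
        moreover have "det N = (\<Prod>i\<in>UNIV. N $ i $ i)"
          by (rule det_lowerdiagonal) (auto simp: N_def c_def)
        then have "invertible N" by (simp add: N_def c_def invertible_det_nz)
        ultimately have 2: "invertible (P ** S ** N)"
          using P(2) by (intro invertible_mult)
        have col: "(Z ** (P ** S ** N)) $ i $ j = W $ i $ s j - c j * W $ i $ j0" for i j
        proof -
          have WS: "(W ** S) $ i $ l = W $ i $ s l" for l
            by (simp add: S_def matrix_matrix_mult_def sum_delta_row)
          have "Z ** (P ** S ** N) = W ** S ** N" by (simp add: W_def matrix_mul_assoc)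
          then have "(Z ** (P ** S ** N)) $ i $ j = (\<Sum>l\<in>UNIV. W $ i $ s l * N $ l $ j)"
            by (simp add: matrix_matrix_mult_def[of "W ** S"] WS)
          also have "\<dots> = (\<Sum>l\<in>UNIV. W $ i $ s l * (if l = j then 1 else 0))
                         - (\<Sum>l\<in>UNIV. (W $ i $ s l * c j) * (if l = k then 1 else 0))"
            unfolding sum_subtractf[symmetric] by (rule sum.cong) (auto simp: N_def algebra_simps)
          also have "\<dots> = W $ i $ s j - W $ i $ s k * c j"
            unfolding sum_delta_row ..
          finally show ?thesis by (simp add: s_def)
        qed
        have "(Z ** (P ** S ** N)) $ i $ j = 0" if "i \<in> insert k U" "j < i" for i j
        proof (cases "i = k")
          case True
          then show ?thesis using that j0 by (simp add: col c_def)
        next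
          case False
          then have "k < i" using that Ueq by auto
          then have "W $ i $ s j = 0 \<and> (W $ i $ j0 = 0)"
            using that red[of i "s j"] red[of i j0] s_le[of j] s_gt[of j] j0(1)
            by (cases "j \<le> k") (auto simp: W_def)
          then show ?thesis by (simp add: col)
        qed
        then show "?red (insert k U)" using 1 2 by blast
      qed
    qed
  qed
  from this[rule_format, of UNIV] show ?thesis
    using that by (auto simp: upper_triangular_def)
qed

text \<open>Division by a triangular matrix, without its inverse: the rows of \<open>S\<close> are determined by back
  substitution from the last one upwards.\<close>

lemma upper_triangular_left_factor:
  fixes T S :: "'l::field ^ 'n::{finite,wellorder} ^ 'n::{finite,wellorder}"
  assumes T: "upper_triangular T" "invertible T" and TS: "upper_triangular (T ** S)"
  shows "upper_triangular S"
proof -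
  have "det T = (\<Prod>i\<in>UNIV. T $ i $ i)"
    using T(1) by (intro det_upperdiagonal) (auto simp: upper_triangular_def)
  then have diag: "T $ i $ i \<noteq> 0" for i
    using T(2) by (auto simp: invertible_det_nz)
  have "S $ i $ j = 0" if "j < i" for i j
    using that
  proof (induction "card {i<..}" arbitrary: i rule: less_induct)
    case less
    have IH: "S $ l $ j = 0" if "i < l" for l
      using less.prems that by (intro less.hyps psubset_card_mono) auto
    have "0 = (T ** S) $ i $ j" using TS less.prems by (simp add: upper_triangular_def)
    also have "\<dots> = (\<Sum>l\<in>UNIV. T $ i $ l * S $ l $ j)" by (simp add: matrix_matrix_mult_def)
    also have "\<dots> = (\<Sum>l\<in>UNIV. if l = i then T $ i $ i * S $ i $ j else 0)"
    proof (rule sum.cong[OF refl])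
      fix l
      consider "l < i" | "l = i" | "i < l" by force
      then show "T $ i $ l * S $ l $ j = (if l = i then T $ i $ i * S $ i $ j else 0)"
        using T(1) IH by cases (auto simp: upper_triangular_def)
    qed
    finally show ?case using diag[of i] by simp
  qed
  then show ?thesis by (auto simp: upper_triangular_def)
qed

lemma matrix_mult_add_rdistrib: "(A + B) ** C = A ** C + B ** (C :: 'a::semiring_1 ^ 'n ^ 'm)"
  by (simp add: vec_eq_iff matrix_matrix_mult_def sum.distrib distrib_right)

text \<open>The gauge transformation \<open>Z = R ** Y\<close> has the triangular system \<open>B\<close>, and \<open>Z ** P\<close> is triangular for
  a constant matrix \<open>P\<close>. An automorphism fixes \<open>R\<close> and \<open>P\<close>, so it maps \<open>Z ** P\<close>, whose zero entries
  stay zero, to \<open>Z ** P\<close> times the conjugate by \<open>P\<close> of its matrix.\<close>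

theorem triangularizable_if_gauge_triangular:
  fixes Y A R B :: "'l::field ^ 'n::{finite,wellorder} ^ 'n::{finite,wellorder}"
  assumes pv: "picard_vessiot \<delta> K A L Y"
    and R: "matrix_entries R \<subseteq> K" "invertible R"
    and gauge: "map_matrix \<delta> R + R ** A = B ** R" and B: "upper_triangular B"
  shows "triangularizable (constants \<delta> K) (galois_matrices \<delta> K L Y)"
proof -
  have K: "differential_field \<delta> K" and L: "differential_field \<delta> L" and KL: "K \<subseteq> L"
    and dY: "map_matrix \<delta> Y = A ** Y" and Yinv: "invertible Y"
    and Leq: "L = \<Inter>{M. is_subfield M \<and> K \<union> matrix_entries Y \<subseteq> M}"
    and const: "constants \<delta> L = constants \<delta> K"
    using pv by (auto simp: picard_vessiot_def)
  note Lf = derivation_subfield[OF L]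
  have YL: "matrix_entries Y \<subseteq> L" by (subst Leq) auto
  have RL: "matrix_entries R \<subseteq> L" using R KL by auto
  define Z where "Z = R ** Y"
  have ZL: "matrix_entries Z \<subseteq> L"
    unfolding Z_def by (rule subfield_matrix_mult[OF Lf RL YL])
  have "map_matrix \<delta> Z = (map_matrix \<delta> R + R ** A) ** Y"
    unfolding Z_def derivation_matrix_mult[OF L RL YL] dY
    by (simp add: matrix_mul_assoc matrix_mult_add_rdistrib)
  then have dZ: "map_matrix \<delta> Z = B ** Z" by (simp add: gauge Z_def matrix_mul_assoc)
  have Zinv: "invertible Z" unfolding Z_def using R(2) Yinv by (rule invertible_mult)
  obtain P where P: "matrix_entries P \<subseteq> constants \<delta> L" "invertible P" "upper_triangular (Z ** P)"
    using constant_column_reduction[OF L ZL dZ B Zinv] .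
  have PK: "matrix_entries P \<subseteq> constants \<delta> K" using P(1) const by simp
  have "upper_triangular (matrix_inv P ** M ** P)" if M: "M \<in> galois_matrices \<delta> K L Y" for M
  proof -
    obtain \<sigma> where \<sigma>: "\<sigma> \<in> diff_galois_group \<delta> K L" "map_matrix \<sigma> Y = Y ** M"
      using M by (auto simp: galois_matrices_def)
    have add: "\<sigma> (x + y) = \<sigma> x + \<sigma> y" and mult: "\<sigma> (x * y) = \<sigma> x * \<sigma> y"
      if "x \<in> L" "y \<in> L" for x y
      using \<sigma>(1) that by (auto simp: diff_galois_group_def)
    have fixK: "\<sigma> x = x" if "x \<in> K" for x
      using \<sigma>(1) that by (auto simp: diff_galois_group_def)
    have sig0: "\<sigma> 0 = 0" using fixK K by (simp add: differential_field_def is_subfield_def)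
    have sum: "\<sigma> (sum f I) = (\<Sum>i\<in>I. \<sigma> (f i))" if "\<And>i. f i \<in> L" for f and I :: "'n set"
      using that by (induction I rule: infinite_finite_induct) (auto simp: sig0 add subfield_sum[OF Lf])
    have mm: "map_matrix \<sigma> (C ** D) = map_matrix \<sigma> C ** map_matrix \<sigma> D"
      if "matrix_entries C \<subseteq> L" "matrix_entries D \<subseteq> L" for C D :: "(('l, 'n) vec, 'n) vec"
      using that unfolding matrix_entries_subset_iff
      by (simp add: vec_eq_iff map_matrix_def matrix_matrix_mult_def sum mult subfield_mult[OF Lf])
    have fixM: "map_matrix \<sigma> C = C" if "matrix_entries C \<subseteq> K" for C :: "(('l, 'n) vec, 'n) vec"
      using that by (auto simp: vec_eq_iff map_matrix_def matrix_entries_subset_iff fixK)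
    have PK': "matrix_entries P \<subseteq> K" using PK by (auto simp: constants_def)
    have PL: "matrix_entries P \<subseteq> L" using PK' KL by auto
    have "map_matrix \<sigma> (Z ** P) = Z ** M ** P"
      unfolding mm[OF ZL PL] fixM[OF PK'] unfolding Z_def mm[OF RL YL] fixM[OF R(1)] \<sigma>(2)
      by (simp add: matrix_mul_assoc)
    also have "\<dots> = (Z ** P) ** (matrix_inv P ** M ** P)"
      using invertible_matrix_inv(1)[OF P(2)]
      by (metis matrix_mul_assoc matrix_mul_rid)
    finally have eq: "map_matrix \<sigma> (Z ** P) = (Z ** P) ** (matrix_inv P ** M ** P)" .
    show ?thesis
    proof (rule upper_triangular_left_factor[OF P(3)])
      show "invertible (Z ** P)" using Zinv P(2) by (rule invertible_mult)
      show "upper_triangular (Z ** P ** (matrix_inv P ** M ** P))"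
        using P(3) unfolding eq[symmetric] by (simp add: upper_triangular_def map_matrix_def sig0)
    qed
  qed
  moreover have "matrix_entries (matrix_inv P) \<subseteq> constants \<delta> K"
    using subfield_matrix_inv[OF subfield_constants[OF K] PK P(2)] .
  ultimately show ?thesis
    unfolding triangularizable_def using PK P(2) by blast
qed

section \<open>Linear differential equations in the complex domain\<close>

lemma norm_le_sum_components: "norm x \<le> (\<Sum>i\<in>UNIV. norm (x $ i))"
  for x :: "'a::real_normed_vector ^ 'n"
  unfolding norm_vec_def by (intro L2_set_le_sum) simp

lemma norm_smult_vec: "norm (c *s v) = norm c * norm v" for v :: "complex ^ 'n"
  by (simp add: norm_vec_def norm_mult L2_set_right_distrib)

lemma norm_matrix_vector_mult_le:
  fixes A :: "complex ^ 'n ^ 'm"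
  shows "norm (A *v x) \<le> (\<Sum>i\<in>UNIV. \<Sum>j\<in>UNIV. norm (A $ i $ j)) * norm x"
proof -
  have "norm ((A *v x) $ i) \<le> (\<Sum>j\<in>UNIV. norm (A $ i $ j)) * norm x" for i
    unfolding matrix_vector_mult_def sum_distrib_right vec_lambda_beta
    by (intro sum_norm_le) (auto simp: norm_mult intro!: mult_left_mono Finite_Cartesian_Product.norm_nth_le)
  then have "(\<Sum>i\<in>UNIV. norm ((A *v x) $ i)) \<le> (\<Sum>i\<in>UNIV. (\<Sum>j\<in>UNIV. norm (A $ i $ j)) * norm x)"
    by (rule sum_mono)
  then show ?thesis
    using norm_le_sum_components[of "A *v x"] by (simp add: sum_distrib_right)
qed

lemma bounded_linear_axis: "bounded_linear (axis i :: 'a::real_normed_vector \<Rightarrow> 'a ^ 'n)"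
proof (rule bounded_linear_intro[where K = 1])
  show "norm (axis i x :: 'a ^ 'n) \<le> norm x * 1" for x :: 'a
    using norm_le_sum_components[of "axis i x :: 'a ^ 'n"]
    by (simp add: axis_def if_distrib cong: if_cong)
qed (auto simp: axis_def vec_eq_iff)

lemma has_derivative_vecI:
  fixes f :: "'a::real_normed_vector \<Rightarrow> 'b::real_normed_vector ^ 'n"
  assumes "\<And>i. ((\<lambda>x. f x $ i) has_derivative (\<lambda>h. f' h $ i)) F"
  shows "(f has_derivative f') F"
proof -
  have expand: "(\<Sum>i\<in>UNIV. axis i (x $ i)) = x" for x :: "'b ^ 'n"
    by (simp add: vec_eq_iff axis_def if_distrib cong: if_cong)
  have "((\<lambda>x. \<Sum>i\<in>UNIV. axis i (f x $ i)) has_derivative (\<lambda>h. \<Sum>i\<in>UNIV. axis i (f' h $ i))) F"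
    by (intro has_derivative_sum bounded_linear.has_derivative[OF bounded_linear_axis] assms)
  then show ?thesis unfolding expand .
qed

lemma has_vector_derivative_vec_iff:
  fixes u :: "real \<Rightarrow> 'a::real_normed_vector ^ 'n"
  shows "(u has_vector_derivative u') F \<longleftrightarrow> (\<forall>i. ((\<lambda>s. u s $ i) has_vector_derivative u' $ i) F)"
proof
  assume "(u has_vector_derivative u') F"
  then show "\<forall>i. ((\<lambda>s. u s $ i) has_vector_derivative u' $ i) F"
    using bounded_linear.has_vector_derivative[OF bounded_linear_vec_nth] by blast
next
  assume "\<forall>i. ((\<lambda>s. u s $ i) has_vector_derivative u' $ i) F"
  then show "(u has_vector_derivative u') F"
    unfolding has_vector_derivative_def by (intro has_derivative_vecI) simp
qed

text \<open>The function \<open>exp (- 2 * M * s) * norm (u s) ^ 2\<close> is nonincreasing.\<close>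

lemma gronwall_norm:
  fixes u :: "real \<Rightarrow> 'a::real_inner"
  assumes u: "\<And>s. 0 \<le> s \<Longrightarrow> s \<le> 1 \<Longrightarrow> (u has_vector_derivative u' s) (at s)"
    and le: "\<And>s. 0 \<le> s \<Longrightarrow> s \<le> 1 \<Longrightarrow> norm (u' s) \<le> M * norm (u s)"
  shows "norm (u 1) \<le> exp M * norm (u 0)"
proof -
  define g where "g s = exp (- 2 * M * s) * (u s \<bullet> u s)" for s
  have "\<exists>y. DERIV g s :> y \<and> y \<le> 0" if s: "0 \<le> s" "s \<le> 1" for s
  proof -
    have "((\<lambda>s. u s \<bullet> u s) has_vector_derivative (u s \<bullet> u' s + u' s \<bullet> u s)) (at s)"
      by (rule bounded_bilinear.has_vector_derivative[OF bounded_bilinear_inner u[OF s] u[OF s]])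
    then have "((\<lambda>s. u s \<bullet> u s) has_real_derivative 2 * (u s \<bullet> u' s)) (at s)"
      by (simp add: has_real_derivative_iff_has_vector_derivative inner_commute)
    then have d: "(g has_real_derivative
        exp (- 2 * M * s) * (2 * (u s \<bullet> u' s)) + exp (- 2 * M * s) * (- 2 * M) * (u s \<bullet> u s)) (at s)"
      unfolding g_def by (auto intro!: derivative_eq_intros)
    have "u s \<bullet> u' s \<le> norm (u s) * norm (u' s)" by (rule norm_cauchy_schwarz)
    also have "\<dots> \<le> norm (u s) * (M * norm (u s))" by (intro mult_left_mono le s) auto
    also have "\<dots> = M * (u s \<bullet> u s)" by (simp add: dot_square_norm power2_eq_square)
    finally have "exp (- 2 * M * s) * (2 * (u s \<bullet> u' s - M * (u s \<bullet> u s))) \<le> 0"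
      by (simp add: mult_le_0_iff)
    then show ?thesis using d by (intro exI[of _ "exp (- 2 * M * s) * (2 * (u s \<bullet> u' s - M * (u s \<bullet> u s)))"])
        (auto simp: algebra_simps)
  qed
  then have "g 1 \<le> g 0" by (intro DERIV_nonpos_imp_nonincreasing[of 0 1 g]) auto
  then have "exp (- 2 * M) * (norm (u 1))\<^sup>2 \<le> (norm (u 0))\<^sup>2"
    by (simp add: g_def dot_square_norm)
  then have "exp (2 * M) * (exp (- 2 * M) * (norm (u 1))\<^sup>2) \<le> exp (2 * M) * (norm (u 0))\<^sup>2"
    by (intro mult_left_mono) auto
  then have "(norm (u 1))\<^sup>2 \<le> (exp M * norm (u 0))\<^sup>2"
    by (simp add: power_mult_distrib mult_exp_exp exp_double[symmetric] flip: mult.assoc)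
  then show ?thesis by (rule power2_le_imp_le) simp
qed

definition linear_ode_solution ::
    "(complex \<Rightarrow> complex ^ 'n ^ 'n) \<Rightarrow> (complex \<Rightarrow> complex ^ 'n) \<Rightarrow> complex set \<Rightarrow> bool" where
  "linear_ode_solution A \<xi> D \<longleftrightarrow>
     (\<forall>t\<in>D. \<forall>i. ((\<lambda>s. \<xi> s $ i) has_field_derivative (A t *v \<xi> t) $ i) (at t))"

lemma linear_ode_solution_subset:
  "linear_ode_solution A \<xi> D \<Longrightarrow> E \<subseteq> D \<Longrightarrow> linear_ode_solution A \<xi> E"
  by (auto simp: linear_ode_solution_def)

lemma linear_ode_solution_holomorphic:
  "linear_ode_solution A \<xi> D \<Longrightarrow> (\<lambda>s. \<xi> s $ i) holomorphic_on D"
  by (auto simp: linear_ode_solution_def holomorphic_on_def field_differentiable_def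
      intro: has_field_derivative_at_within)

lemma linear_ode_solution_sum:
  assumes "\<And>j. j \<in> I \<Longrightarrow> linear_ode_solution A (\<xi> j) D"
  shows "linear_ode_solution A (\<lambda>t. \<Sum>j\<in>I. c j *s \<xi> j t) D"
  unfolding linear_ode_solution_def
proof (intro ballI allI)
  fix t i assume t: "t \<in> D"
  have "((\<lambda>s. \<Sum>j\<in>I. c j * \<xi> j s $ i) has_field_derivative (\<Sum>j\<in>I. c j * (A t *v \<xi> j t) $ i)) (at t)"
    using assms t by (intro DERIV_sum DERIV_cmult) (auto simp: linear_ode_solution_def)
  moreover have "A t *v (\<Sum>j\<in>I. c j *s \<xi> j t) = (\<Sum>j\<in>I. c j *s (A t *v \<xi> j t))"
    by (simp add: matrix_vector_mult_def vec_eq_iff sum_distrib_left sum.swap[of _ I] mult_ac)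
  ultimately show "((\<lambda>s. (\<Sum>j\<in>I. c j *s \<xi> j s) $ i) has_field_derivative
      (A t *v (\<Sum>j\<in>I. c j *s \<xi> j t)) $ i) (at t)"
    by simp
qed

lemma linear_ode_solution_diff:
  assumes "linear_ode_solution A \<xi> D" "linear_ode_solution A \<eta> D"
  shows "linear_ode_solution A (\<lambda>t. \<xi> t - \<eta> t) D"
  using assms unfolding linear_ode_solution_def
  by (auto intro!: derivative_eq_intros simp: matrix_vector_mult_diff_distrib)

lemma linear_ode_solution_shift:
  assumes "linear_ode_solution A \<xi> D"
    and "\<And>t. t \<in> E \<Longrightarrow> t + p \<in> D \<and> A (t + p) = A t"
  shows "linear_ode_solution A (\<lambda>t. \<xi> (t + p)) E"
  unfolding linear_ode_solution_def
proof (intro ballI allI)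
  fix t i assume "t \<in> E"
  then have "((\<lambda>s. \<xi> s $ i) has_field_derivative (A t *v \<xi> (t + p)) $ i) (at (t + p))"
    using assms by (fastforce simp: linear_ode_solution_def)
  then show "((\<lambda>s. \<xi> (s + p) $ i) has_field_derivative (A t *v \<xi> (t + p)) $ i) (at t)"
    by (simp add: DERIV_shift)
qed

text \<open>Along a straight line a solution solves a system in a real variable; this is how the real estimates apply to
  solutions in the complex domain.\<close>

lemma linear_ode_solution_vector_derivative:
  assumes sol: "linear_ode_solution A \<xi> D" and D: "p + of_real s * v \<in> D"
  shows "((\<lambda>s. \<xi> (p + of_real s * v)) has_vector_derivative
           v *s (A (p + of_real s * v) *v \<xi> (p + of_real s * v))) (at s)"
  unfolding has_vector_derivative_vec_iff
proof
  fix i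
  have "((\<lambda>s. p + of_real s * v) has_vector_derivative v) (at s)"
    by (auto intro!: derivative_eq_intros)
  then show "((\<lambda>s. \<xi> (p + of_real s * v) $ i) has_vector_derivative
     (v *s (A (p + of_real s * v) *v \<xi> (p + of_real s * v))) $ i) (at s)"
    using field_vector_diff_chain_at[of "\<lambda>s. p + of_real s * v" v s "\<lambda>t. \<xi> t $ i"] sol D
    by (simp add: linear_ode_solution_def o_def)
qed

lemma linear_ode_growth:
  assumes sol: "linear_ode_solution A \<xi> D" and D: "closed_segment p q \<subseteq> D"
    and le: "\<And>t x. t \<in> closed_segment p q \<Longrightarrow> norm (A t *v x) \<le> M * norm x"
  shows "norm (\<xi> q) \<le> exp (M * norm (q - p)) * norm (\<xi> p)"
proof -
  have seg: "p + of_real s * (q - p) \<in> closed_segment p q" if "0 \<le> s" "s \<le> 1" for s :: real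
    using that by (auto simp: in_segment scaleR_conv_of_real algebra_simps intro!: exI[of _ s])
  have "norm (\<xi> (p + of_real 1 * (q - p)))
      \<le> exp (M * norm (q - p)) * norm (\<xi> (p + of_real 0 * (q - p)))"
  proof (rule gronwall_norm)
    fix s :: real assume s: "0 \<le> s" "s \<le> 1"
    show "((\<lambda>s. \<xi> (p + of_real s * (q - p))) has_vector_derivative
           (q - p) *s (A (p + of_real s * (q - p)) *v \<xi> (p + of_real s * (q - p)))) (at s)"
      using seg[OF s] D by (intro linear_ode_solution_vector_derivative[OF sol]) auto
    show "norm ((q - p) *s (A (p + of_real s * (q - p)) *v \<xi> (p + of_real s * (q - p))))
        \<le> M * norm (q - p) * norm (\<xi> (p + of_real s * (q - p)))"
      unfolding norm_smult_vec
      using mult_left_mono[OF le[OF seg[OF s], of "\<xi> (p + of_real s * (q - p))"] norm_ge_zero[of "q - p"]]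
      by (simp add: mult_ac)
  qed
  then show ?thesis by simp
qed

lemma linear_ode_unique:
  assumes "linear_ode_solution A \<xi> D" "linear_ode_solution A \<eta> D" and D: "closed_segment p q \<subseteq> D"
    and "\<And>t x. t \<in> closed_segment p q \<Longrightarrow> norm (A t *v x) \<le> M * norm x"
    and "\<xi> p = \<eta> p"
  shows "\<xi> q = \<eta> q"
  using linear_ode_growth[OF linear_ode_solution_diff[OF assms(1,2)] D assms(4)] assms(5) by simp

text \<open>Integrating a bound of order \<open>n\<close> along the segment from \<open>0\<close> gains the factor \<open>norm t / Suc n\<close>, which
  produces the factorials in the convergence proof of Picard's iteration.\<close>

lemma norm_primitive_le:
  fixes f f' :: "complex \<Rightarrow> complex"
  assumes f: "\<And>s. 0 \<le> s \<Longrightarrow> s \<le> 1 \<Longrightarrow> (f has_field_derivative f' (of_real s * t)) (at (of_real s * t))"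
    and le: "\<And>s. 0 \<le> s \<Longrightarrow> s \<le> 1 \<Longrightarrow> norm (f' (of_real s * t)) \<le> K * norm (of_real s * t) ^ n"
    and f0: "f 0 = 0"
  shows "norm (f t) \<le> K * norm t ^ Suc n / Suc n"
proof -
  have v: "((\<lambda>s. f (of_real s * t)) has_vector_derivative t * f' (of_real s * t)) (at s)"
    if "0 \<le> s" "s \<le> 1" for s :: real
  proof -
    have "((\<lambda>s. of_real s * t) has_vector_derivative t) (at s)"
      by (auto intro!: derivative_eq_intros)
    then show ?thesis using field_vector_diff_chain_at[of "\<lambda>s. of_real s * t" t s f, OF _ f[OF that]] by (simp add: o_def)
  qed
  have "norm ((\<lambda>s. f (of_real s * t)) 1 - (\<lambda>s. f (of_real s * t)) 0)
     \<le> (\<lambda>s. K * norm t ^ Suc n / Suc n * s ^ Suc n) 1 - (\<lambda>s. K * norm t ^ Suc n / Suc n * s ^ Suc n) 0"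
  proof (rule differentiable_bound_general[where f' = "\<lambda>s. t * f' (of_real s * t)"
        and \<phi>' = "\<lambda>s. K * norm t ^ Suc n * s ^ n"])
    show "continuous_on {0..1} (\<lambda>s. f (of_real s * t))"
      by (intro continuous_at_imp_continuous_on ballI)
         (use v in \<open>auto intro: has_vector_derivative_continuous\<close>)
    show "((\<lambda>s. K * norm t ^ Suc n / Suc n * s ^ Suc n) has_vector_derivative
        K * norm t ^ Suc n * s ^ n) (at s)" for s
      unfolding has_real_derivative_iff_has_vector_derivative[symmetric]
      by (rule derivative_eq_intros refl | simp add: field_simps del: of_nat_Suc)+
    fix s :: real assume s: "0 < s" "s < 1"
    show "norm (t * f' (of_real s * t)) \<le> K * norm t ^ Suc n * s ^ n"
      using mult_left_mono[OF le[of s] norm_ge_zero[of t]] s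
      by (simp add: norm_mult power_mult_distrib mult_ac)
  qed (auto intro!: continuous_intros v)
  then show ?thesis using f0 by simp
qed

text \<open>Picard's iteration, with primitives of holomorphic functions on the star-shaped domain as the
  integral. The differences of the iterates are dominated by the exponential series, uniformly on
  bounded parts of the domain, so the solution exists on the whole domain.\<close>

lemma linear_ode_existence:
  fixes A :: "complex \<Rightarrow> complex ^ 'n ^ 'n"
  assumes D: "open D" "0 \<in> D" "\<And>t. t \<in> D \<Longrightarrow> closed_segment 0 t \<subseteq> D"
    and A: "\<And>i j. (\<lambda>t. A t $ i $ j) holomorphic_on D"
    and bound: "\<And>t i j. t \<in> D \<Longrightarrow> norm (A t $ i $ j) \<le> m"
  obtains \<xi> where "linear_ode_solution A \<xi> D" "\<xi> 0 = x0"
proof -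
  have star: "starlike D" using D(2,3) by (auto simp: starlike_def)
  \<comment> \<open>an arbitrary primitive; subtracting its value at \<open>0\<close> makes it the integral from \<open>0\<close>\<close>
  define P where "P f = (SOME g. \<forall>x\<in>D. (g has_field_derivative f x) (at x))" for f :: "complex \<Rightarrow> complex"
  have P: "(P f has_field_derivative f x) (at x)" if "f holomorphic_on D" "x \<in> D" for f x
  proof -
    have "\<exists>g. \<forall>x\<in>D. (g has_field_derivative f x) (at x)"
      using that D(1) star
      by (intro holomorphic_starlike_primitive[where k = "{}"])
         (auto intro: holomorphic_on_imp_continuous_on holomorphic_on_imp_differentiable_at)
    then have "\<forall>x\<in>D. (P f has_field_derivative f x) (at x)" unfolding P_def by (rule someI_ex)
    then show ?thesis using that by blast
  qed
  define y where "y = rec_nat (\<lambda>t. x0)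
     (\<lambda>n f t. \<chi> i. x0 $ i + P (\<lambda>s. (A s *v f s) $ i) t - P (\<lambda>s. (A s *v f s) $ i) 0)"
  have y0: "y 0 = (\<lambda>t. x0)" by (simp add: y_def)
  have ySuc: "y (Suc n) t $ i = x0 $ i + P (\<lambda>s. (A s *v y n s) $ i) t - P (\<lambda>s. (A s *v y n s) $ i) 0" for n t i
    by (simp add: y_def)
  have hol_mult: "(\<lambda>s. (A s *v u s) $ i) holomorphic_on D"
    if "\<And>i. (\<lambda>t. u t $ i) holomorphic_on D" for u i
    unfolding matrix_vector_mult_def using A that by (auto intro!: holomorphic_intros)
  have y_hol: "(\<lambda>t. y n t $ i) holomorphic_on D" for n i
  proof (induction n arbitrary: i)
    case (Suc n)
    have "P (\<lambda>s. (A s *v y n s) $ i) holomorphic_on D"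
      using P[OF hol_mult[OF Suc]] by (auto simp: holomorphic_on_def field_differentiable_def
          intro: has_field_derivative_at_within)
    then show ?case unfolding ySuc by (intro holomorphic_intros)
  qed (simp add: y0)
  have y_deriv: "((\<lambda>t. y (Suc n) t $ i) has_field_derivative (A t *v y n t) $ i) (at t)"
    if "t \<in> D" for n i t
    unfolding ySuc by (auto intro!: derivative_eq_intros P[OF hol_mult[OF y_hol] that])
  have y_0: "y n 0 = x0" for n by (cases n) (simp_all add: y0 vec_eq_iff ySuc)
  define M where "M = real CARD('n) * m"
  have "0 \<le> m" using bound[OF D(2)] norm_ge_zero order_trans by blast
  then have M0: "0 \<le> M" by (simp add: M_def)
  have A_le: "norm ((A t *v x) $ i) \<le> M * b" if "t \<in> D" "\<And>j. norm (x $ j) \<le> b" for t x b i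
  proof -
    have "norm ((A t *v x) $ i) \<le> (\<Sum>j\<in>(UNIV :: 'n set). m * b)"
      unfolding matrix_vector_mult_def vec_lambda_beta
      by (intro sum_norm_le) (auto simp: norm_mult intro!: mult_mono bound that \<open>0 \<le> m\<close>)
    then show ?thesis by (simp add: M_def)
  qed
  define C where "C = norm x0"
  have step: "norm (y (Suc n) t $ i - y n t $ i) \<le> C * M ^ Suc n * norm t ^ Suc n / fact (Suc n)"
    if "t \<in> D" for n t i
    using that
  proof (induction n arbitrary: t i)
    case 0
    have seg: "of_real s * t \<in> D" if "0 \<le> s" "s \<le> 1" for s :: real
      using D(3)[OF 0] that by (force simp: in_segment scaleR_conv_of_real)
    have "norm (y 1 t $ i - y 0 t $ i) \<le> (M * C) * norm t ^ Suc 0 / Suc 0"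
    proof (rule norm_primitive_le[where f' = "\<lambda>s. (A s *v y 0 s) $ i"])
      fix s :: real assume s: "0 \<le> s" "s \<le> 1"
      show "((\<lambda>t. y 1 t $ i - y 0 t $ i) has_field_derivative (A (of_real s * t) *v y 0 (of_real s * t)) $ i)
          (at (of_real s * t))"
        using y_deriv[OF seg[OF s], of 0] by (auto simp: y0 intro!: derivative_eq_intros)
      show "norm ((A (of_real s * t) *v y 0 (of_real s * t)) $ i) \<le> M * C * norm (of_real s * t) ^ 0"
        using A_le[OF seg[OF s], of x0 C] by (simp add: y0 C_def Finite_Cartesian_Product.norm_nth_le)
    qed (simp add: y_0 y_0[of 1, simplified])
    then show ?case by (simp add: mult_ac)
  next
    case (Suc n)
    have seg: "of_real s * t \<in> D" if "0 \<le> s" "s \<le> 1" for s :: real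
      using D(3)[OF Suc.prems] that by (force simp: in_segment scaleR_conv_of_real)
    let ?K = "C * M ^ Suc (Suc n) / fact (Suc n)"
    have "norm (y (Suc (Suc n)) t $ i - y (Suc n) t $ i) \<le> ?K * norm t ^ Suc (Suc n) / Suc (Suc n)"
    proof (rule norm_primitive_le[where f' = "\<lambda>s. (A s *v (y (Suc n) s - y n s)) $ i"])
      fix s :: real assume s: "0 \<le> s" "s \<le> 1"
      let ?t = "of_real s * t"
      show "((\<lambda>t. y (Suc (Suc n)) t $ i - y (Suc n) t $ i) has_field_derivative
          (A ?t *v (y (Suc n) ?t - y n ?t)) $ i) (at ?t)"
        unfolding matrix_vector_mult_diff_distrib vector_minus_component
        by (intro derivative_intros y_deriv seg[OF s])
      have "norm ((A ?t *v (y (Suc n) ?t - y n ?t)) $ i) \<le> M * (C * M ^ Suc n * norm ?t ^ Suc n / fact (Suc n))"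
        by (rule A_le[OF seg[OF s]]) (use Suc.IH[OF seg[OF s]] in simp)
      then show "norm ((A ?t *v (y (Suc n) ?t - y n ?t)) $ i) \<le> ?K * norm ?t ^ Suc n"
        by (simp add: mult_ac)
    qed (simp add: y_0)
    also have "?K * norm t ^ Suc (Suc n) / Suc (Suc n)
        = C * M ^ Suc (Suc n) * norm t ^ Suc (Suc n) / fact (Suc (Suc n))"
      by (simp only: fact_Suc of_nat_mult) (simp add: field_simps del: of_nat_Suc)
    finally show ?case .
  qed
  define \<xi> where "\<xi> t = (\<chi> i. x0 $ i + (\<Sum>n. y (Suc n) t $ i - y n t $ i))" for t
  have ulim: "uniform_limit (D \<inter> cball 0 R) (\<lambda>n t. y n t $ i) (\<lambda>t. \<xi> t $ i) sequentially"
    if "0 \<le> R" for R i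
  proof -
    have lim_sum: "uniform_limit (D \<inter> cball 0 R) (\<lambda>n t. \<Sum>k<n. y (Suc k) t $ i - y k t $ i)
        (\<lambda>t. \<Sum>k. y (Suc k) t $ i - y k t $ i) sequentially"
    proof (rule Weierstrass_m_test)
      fix n t assume t: "t \<in> D \<inter> cball 0 R"
      have "norm (y (Suc n) t $ i - y n t $ i) \<le> C * M ^ Suc n * norm t ^ Suc n / fact (Suc n)"
        using step t by blast
      also have "\<dots> \<le> C * M ^ Suc n * R ^ Suc n / fact (Suc n)"
        using t M0 by (intro divide_right_mono mult_left_mono power_mono) (auto simp: C_def)
      also have "\<dots> = C * ((M * R) ^ Suc n /\<^sub>R fact (Suc n))"
        by (simp add: power_mult_distrib field_simps)
      finally show "norm (y (Suc n) t $ i - y n t $ i) \<le> C * ((M * R) ^ Suc n /\<^sub>R fact (Suc n))" .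
    next
      have "summable (\<lambda>n. (M * R) ^ n /\<^sub>R fact n)" by (rule summable_exp_generic)
      then show "summable (\<lambda>n. C * ((M * R) ^ Suc n /\<^sub>R fact (Suc n)))"
        by (intro summable_mult) (rule summable_Suc_iff[THEN iffD2])
    qed
    have "(\<Sum>k<n. y (Suc k) t $ i - y k t $ i) = y n t $ i - x0 $ i" for n t
      using sum_lessThan_telescope[of "\<lambda>k. y k t $ i" n] by (simp add: y0)
    then show ?thesis
      using uniform_limit_add[OF uniform_limit_const lim_sum, of "\<lambda>_. x0 $ i"]
      by (simp add: \<xi>_def)
  qed
  have lim: "(\<lambda>n. y n t $ i) \<longlonglongrightarrow> \<xi> t $ i" if "t \<in> D" for t i
    using tendsto_uniform_limitI[OF ulim[of "norm t" i]] that by simp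
  have "linear_ode_solution A \<xi> D"
    unfolding linear_ode_solution_def
  proof (intro ballI allI)
    fix t i assume t: "t \<in> D"
    have "\<exists>g'. \<forall>x\<in>D. ((\<lambda>t. \<xi> t $ i) has_field_derivative g' x) (at x) \<and>
        (\<lambda>n. (A x *v y n x) $ i) \<longlonglongrightarrow> g' x"
    proof (rule has_complex_derivative_uniform_sequence[OF D(1)])
      show "((\<lambda>t. y (Suc n) t $ i) has_field_derivative (A x *v y n x) $ i) (at x)" if "x \<in> D" for n x
        using y_deriv[OF that] .
      fix x assume x: "x \<in> D"
      then obtain d where d: "0 < d" "cball x d \<subseteq> D" using D(1) open_contains_cball by blast
      have "uniform_limit (D \<inter> cball 0 (norm x + d)) (\<lambda>n t. y (Suc n) t $ i) (\<lambda>t. \<xi> t $ i) sequentially"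
        using ulim[of "norm x + d" i] d(1)
        unfolding uniform_limit_iff eventually_sequentially by (meson add_nonneg_nonneg norm_ge_zero less_imp_le le_SucI)
      moreover have "cball x d \<subseteq> D \<inter> cball 0 (norm x + d)"
      proof -
        have "norm w \<le> norm x + d" if "w \<in> cball x d" for w
          using that norm_triangle_ineq[of x "w - x"] by (simp add: dist_norm norm_minus_commute)
        then show ?thesis using d(2) by auto
      qed
      ultimately show "\<exists>d>0. cball x d \<subseteq> D \<and>
          uniform_limit (cball x d) (\<lambda>n t. y (Suc n) t $ i) (\<lambda>t. \<xi> t $ i) sequentially"
        using d uniform_limit_on_subset by blast
    qed
    then obtain g' where g': "((\<lambda>t. \<xi> t $ i) has_field_derivative g' t) (at t)"
        "(\<lambda>n. (A t *v y n t) $ i) \<longlonglongrightarrow> g' t" using t by blast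
    have "(\<lambda>n. (A t *v y n t) $ i) \<longlonglongrightarrow> (A t *v \<xi> t) $ i"
      unfolding matrix_vector_mult_def vec_lambda_beta
      by (intro tendsto_sum tendsto_mult tendsto_const lim[OF t])
    then show "((\<lambda>s. \<xi> s $ i) has_field_derivative (A t *v \<xi> t) $ i) (at t)"
      using g' LIMSEQ_unique by metis
  qed
  moreover have "\<xi> 0 = x0" by (simp add: \<xi>_def vec_eq_iff y_0)
  ultimately show ?thesis using that by blast
qed

text \<open>A solution along the real line agrees with the complex solution of the same initial value; thus
  the latter is its holomorphic continuation.\<close>

lemma real_solution_extends:
  fixes A :: "complex \<Rightarrow> complex ^ 'n ^ 'n" and \<eta> :: "real \<Rightarrow> complex ^ 'n"
  assumes sol: "linear_ode_solution A \<xi> D" and D: "range complex_of_real \<subseteq> D"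
    and M: "\<And>t x. t \<in> D \<Longrightarrow> norm (A t *v x) \<le> M * norm x"
    and eta: "\<And>t. (\<eta> has_vector_derivative A (of_real t) *v \<eta> t) (at t)" and init: "\<xi> 0 = \<eta> 0"
  shows "\<xi> (of_real t) = \<eta> t"
proof -
  \<comment> \<open>the difference on the segment from \<open>0\<close> to \<open>t\<close>, parametrized by the unit interval\<close>
  define u where "u s = \<xi> (of_real (s * t)) - \<eta> (s * t)" for s
  have inD: "complex_of_real (s * t) \<in> D" for s using D by blast
  have "norm (u 1) \<le> exp (\<bar>t\<bar> * M) * norm (u 0)"
  proof (rule gronwall_norm)
    fix s :: real
    let ?s = "s * t"
    have "((\<lambda>s. \<xi> (0 + of_real s * of_real t)) has_vector_derivative
        of_real t *s (A (0 + of_real s * of_real t) *v \<xi> (0 + of_real s * of_real t))) (at s)"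
      using inD[of s] by (intro linear_ode_solution_vector_derivative[OF sol]) simp
    then have "((\<lambda>s. \<xi> (of_real (s * t))) has_vector_derivative of_real t *s (A (of_real ?s) *v \<xi> (of_real ?s))) (at s)"
      by simp
    moreover have "((\<lambda>s. \<eta> (s * t)) has_vector_derivative t *\<^sub>R (A (of_real ?s) *v \<eta> ?s)) (at s)"
    proof -
      have "((\<lambda>s. s * t) has_vector_derivative t) (at s)" by (auto intro!: derivative_eq_intros)
      from vector_diff_chain_at[OF this eta[of "s * t"]] show ?thesis by (simp add: o_def)
    qed
    moreover have "of_real t *s v = t *\<^sub>R v" for v :: "complex ^ 'n"
      by (auto simp: vec_eq_iff) (simp add: scaleR_conv_of_real)
    ultimately show "(u has_vector_derivative t *\<^sub>R (A (of_real ?s) *v u s)) (at s)"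
      unfolding u_def by (auto intro!: derivative_eq_intros simp: matrix_vector_mult_diff_distrib scaleR_diff_right)
    have "norm (A (of_real ?s) *v u s) \<le> M * norm (u s)" using inD[of s] by (rule M)
    from mult_left_mono[OF this, of "\<bar>t\<bar>"]
    show "norm (t *\<^sub>R (A (of_real ?s) *v u s)) \<le> \<bar>t\<bar> * M * norm (u s)" by (simp add: mult.assoc)
  qed
  moreover have "u 0 = 0" using init by (simp add: u_def)
  ultimately show ?thesis by (simp add: u_def)
qed

text \<open>A vanishing linear combination of the rows at \<open>p\<close> is a solution with zero initial value, so it
  vanishes at \<open>q\<close> too.\<close>

lemma fundamental_det_nonzero:
  fixes V :: "complex \<Rightarrow> complex ^ 'n ^ 'n"
  assumes sol: "\<And>i. linear_ode_solution A (\<lambda>t. V t $ i) D" and seg: "closed_segment p q \<subseteq> D"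
    and M: "\<And>t x. t \<in> D \<Longrightarrow> norm (A t *v x) \<le> M * norm x" and det: "det (V q) \<noteq> 0"
  shows "det (V p) \<noteq> 0"
proof
  assume "det (V p) = 0"
  then have "\<not> (\<exists>B. V p ** B = mat 1)" by (metis invertible_det_nz invertible_right_inverse)
  then obtain c where c: "(\<Sum>i\<in>UNIV. c i *s row i (V p)) = 0" "\<exists>i. c i \<noteq> 0"
    using matrix_right_invertible_independent_rows[of "V p"] by blast
  have row: "row i (V t) = V t $ i" for i t by (simp add: row_def vec_eq_iff)
  have "(\<Sum>i\<in>UNIV. c i *s V q $ i) = 0"
  proof (rule linear_ode_unique[of A "\<lambda>t. \<Sum>i\<in>UNIV. c i *s V t $ i" D "\<lambda>t. 0" p q M])
    show "linear_ode_solution A (\<lambda>t. \<Sum>i\<in>UNIV. c i *s V t $ i) D" by (intro linear_ode_solution_sum sol)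
    show "linear_ode_solution A (\<lambda>t. 0) D" by (simp add: linear_ode_solution_def)
  qed (use seg M c(1) in \<open>auto simp: row\<close>)
  then have "\<not> (\<exists>B. V q ** B = mat 1)"
    using matrix_right_invertible_independent_rows[of "V q"] c(2) by (auto simp: row)
  then show False using det by (metis invertible_det_nz invertible_right_inverse)
qed

section \<open>Triangular forms of complex matrices\<close>

text \<open>Take a nonzero polynomial \<open>p\<close> of least degree such that \<open>p (A) y\<close> lies in \<open>S\<close>. It exists because the
  powers of \<open>A\<close> applied to \<open>y\<close> are linearly dependent, and it is not constant because \<open>y\<close> is not in
  \<open>S\<close>. Splitting off a root \<open>l\<close> leaves \<open>p = (X - l) * q\<close>, and by minimality \<open>q (A) y\<close> is not in \<open>S\<close>.\<close>

lemma exists_eigenvector_mod_subspace: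
  fixes A :: "complex ^ 'n ^ 'n"
  assumes S: "0 \<in> S" "\<And>x y. x \<in> S \<Longrightarrow> y \<in> S \<Longrightarrow> x + y \<in> S" "\<And>c x. x \<in> S \<Longrightarrow> c *s x \<in> S"
    and inv: "\<And>x. x \<in> S \<Longrightarrow> A *v x \<in> S" and y: "y \<notin> S"
  obtains x l where "x \<notin> S" "A *v x - l *s x \<in> S"
proof -
  \<comment> \<open>\<open>ev p\<close> is \<open>p (A) y\<close>, evaluated by Horner's scheme\<close>
  define ev where "ev p = fold_coeffs (\<lambda>a v. a *s y + A *v v) p 0" for p :: "complex poly"
  have ev_pCons: "ev (pCons a p) = a *s y + A *v ev p" for a p
    by (cases "p = 0 \<and> a = 0") (auto simp: ev_def)
  have ev_0: "ev 0 = 0" by (simp add: ev_def)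
  have ev_add: "ev (p + q) = ev p + ev q" for p q
    by (induction p q rule: poly_induct2)
       (simp_all add: ev_0 ev_pCons vector_sadd_rdistrib matrix_vector_right_distrib)
  have ev_smult: "ev (smult c p) = c *s ev p" for c p
    by (induction p) (simp_all add: ev_0 ev_pCons vector_add_ldistrib vector_smult_assoc
        matrix_vector_mult_scaleR vec.scale)
  have "\<exists>p. p \<noteq> 0 \<and> ev p = 0"
  proof -
    define w where "w k = ev (monom 1 k)" for k
    show ?thesis
    proof (cases "inj_on w {..CARD('n)}")
      case False
      then obtain i j where ij: "i \<noteq> j" "w i = w j" by (auto simp: inj_on_def)
      then have "ev (monom 1 i + smult (-1) (monom 1 j)) = 0"
        unfolding ev_add ev_smult by (simp add: w_def vector_smult_lneg)
      moreover have "monom 1 i + smult (-1) (monom 1 j) \<noteq> (0 :: complex poly)"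
      proof
        assume "monom 1 i + smult (-1) (monom 1 j) = (0 :: complex poly)"
        then have "coeff (monom 1 i + smult (-1) (monom 1 j)) i = (0 :: complex)" by simp
        then show False using ij(1) by simp
      qed
      ultimately show ?thesis by blast
    next
      case True
      then have "card (w ` {..CARD('n)}) = Suc CARD('n)" by (simp add: card_image)
      then have "vec.dependent (w ` {..CARD('n)})"
        using vec.independent_bound_general[of "w ` {..CARD('n)}"] vec.dim_subset_UNIV[of "w ` {..CARD('n)}"]
        by (auto simp: vec.dimension_def card_cart_basis vec_dim_card)
      then obtain c where c: "\<exists>v\<in>w ` {..CARD('n)}. c v \<noteq> 0" "(\<Sum>v\<in>w ` {..CARD('n)}. c v *s v) = 0"
        using vec.dependent_finite[of "w ` {..CARD('n)}"] by auto
      define p where "p = (\<Sum>k\<le>CARD('n). monom (c (w k)) k)"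
      have ev_sum: "ev (\<Sum>k\<in>K. f k) = (\<Sum>k\<in>K. ev (f k))" for f and K :: "nat set"
        by (induction K rule: infinite_finite_induct) (auto simp: ev_0 ev_add)
      have "ev (monom a k) = a *s w k" for a k
        using ev_smult[of a "monom 1 k"] by (simp add: w_def smult_monom)
      then have "ev p = (\<Sum>k\<le>CARD('n). c (w k) *s w k)" by (simp add: p_def ev_sum)
      also have "\<dots> = 0" using c(2) by (simp add: sum.reindex[OF True])
      finally have "ev p = 0" .
      moreover obtain k where "k \<le> CARD('n)" "c (w k) \<noteq> 0" using c(1) by auto
      then have "coeff p k \<noteq> 0" by (simp add: p_def coeff_sum)
      then have "p \<noteq> 0" by auto
      ultimately show ?thesis by blast
    qed
  qed
  then have ex: "\<exists>d p. p \<noteq> 0 \<and> ev p \<in> S \<and> degree p = d" using S(1) by auto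
  define d where "d = (LEAST d. \<exists>p. p \<noteq> 0 \<and> ev p \<in> S \<and> degree p = d)"
  obtain p where p: "p \<noteq> 0" "ev p \<in> S" "degree p = d"
    using LeastI_ex[OF ex] unfolding d_def by blast
  have min: "ev q \<notin> S" if "q \<noteq> 0" "degree q < d" for q
    using not_less_Least[of "degree q" "\<lambda>d. \<exists>p. p \<noteq> 0 \<and> ev p \<in> S \<and> degree p = d"] that
    unfolding d_def by blast
  have "d \<noteq> 0"
  proof
    assume "d = 0"
    then obtain c where c: "p = [:c:]" using p(3) degree_eq_zeroE by blast
    then have "c \<noteq> 0" using p(1) by auto
    have "c *s y \<in> S" using p(2) c by (simp add: ev_pCons ev_0)
    then have "inverse c *s (c *s y) \<in> S" by (rule S(3))
    then show False using y \<open>c \<noteq> 0\<close> by (simp add: vector_smult_assoc)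
  qed
  then have "\<not> constant (poly p)" using p(3) by (simp add: constant_degree)
  then obtain l where "poly p l = 0" using fundamental_theorem_of_algebra by blast
  then obtain q where q: "p = [:- l, 1:] * q" by (auto simp: poly_eq_0_iff_dvd elim: dvdE)
  have "q \<noteq> 0" using p(1) q by auto
  then have "degree p = Suc (degree q)" unfolding q by (subst degree_mult_eq) auto
  then have "ev q \<notin> S" using min \<open>q \<noteq> 0\<close> p(3) by simp
  moreover have "p = pCons 0 q + smult (- l) q" by (simp add: q)
  then have "ev p = A *v ev q - l *s ev q"
    by (simp only: ev_add ev_smult ev_pCons) (simp add: vector_smult_lneg)
  ultimately show ?thesis using that[of "ev q" l] p(2) by metis
qed

text \<open>Schur triangularization without orthogonality: each new basis vector is an eigenvector modulo the
  span of the previous ones.\<close>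

lemma exists_triangular_similar:
  fixes A :: "complex ^ 'n::{finite,wellorder} ^ 'n::{finite,wellorder}"
  obtains P T :: "complex ^ 'n::{finite,wellorder} ^ 'n::{finite,wellorder}"
  where "invertible P" "A ** P = P ** T" "upper_triangular T"
proof -
  \<comment> \<open>\<open>comb s U\<close> is the span of the vectors \<open>s i\<close> with \<open>i\<close> in \<open>U\<close>\<close>
  define comb where "comb s U = range (\<lambda>c. \<Sum>i\<in>U. c i *s s i)"
    for s :: "'n \<Rightarrow> (complex, 'n) vec" and U :: "'n set"
  have comb_sub: "0 \<in> comb s U" "\<And>x y. x \<in> comb s U \<Longrightarrow> y \<in> comb s U \<Longrightarrow> x + y \<in> comb s U"
     "\<And>c x. x \<in> comb s U \<Longrightarrow> c *s x \<in> comb s U" for s U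
  proof -
    show "0 \<in> comb s U" by (auto simp: comb_def intro!: image_eqI[of _ _ "\<lambda>_. 0"])
    show "x + y \<in> comb s U" if "x \<in> comb s U" "y \<in> comb s U" for x y
    proof -
      obtain c d where "x = (\<Sum>i\<in>U. c i *s s i)" "y = (\<Sum>i\<in>U. d i *s s i)"
        using \<open>x \<in> comb s U\<close> \<open>y \<in> comb s U\<close> by (auto simp: comb_def)
      then have "x + y = (\<Sum>i\<in>U. (c i + d i) *s s i)"
        by (simp add: vector_sadd_rdistrib sum.distrib)
      then show ?thesis unfolding comb_def
        by (auto simp del: vector_sadd_rdistrib intro!: image_eqI[where x = "\<lambda>i. c i + d i"])
    qed
    show "c *s x \<in> comb s U" if "x \<in> comb s U" for c x
    proof -
      obtain d where "x = (\<Sum>i\<in>U. d i *s s i)" using \<open>x \<in> comb s U\<close> by (auto simp: comb_def)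
      then have "c *s x = (\<Sum>i\<in>U. (c * d i) *s s i)"
        by (simp add: vec.scale_sum_right vector_smult_assoc)
      then show ?thesis by (auto simp: comb_def)
    qed
  qed
  have comb_mono: "comb s V \<subseteq> comb s U" if VU: "V \<subseteq> U" for s U V
  proof
    fix x assume "x \<in> comb s V"
    then obtain c where "x = (\<Sum>i\<in>V. c i *s s i)" by (auto simp: comb_def)
    also have "\<dots> = (\<Sum>i\<in>U. (if i \<in> V then c i else 0) *s s i)"
      using VU by (intro sum.mono_neutral_cong_left) auto
    finally show "x \<in> comb s U" by (auto simp: comb_def)
  qed
  have comb_base: "s i \<in> comb s U" if "i \<in> U" for s i U
  proof -
    have "s i = (\<Sum>j\<in>U. (if j = i then 1 else 0) *s s j)"
      using that by (simp add: if_distrib[of "\<lambda>c. c *s _"] cong: if_cong)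
    then show ?thesis unfolding comb_def
      by (intro image_eqI[where x = "\<lambda>j. if j = i then 1 else 0"]) auto
  qed
  have comb_neq: "\<exists>y. y \<notin> comb s U" if "k \<notin> U" for s U k
  proof (rule ccontr)
    assume "\<nexists>y. y \<notin> comb s U"
    define M where "M = (\<chi> i j. if j \<in> U then s j $ i else 0)"
    have "surj ((*v) M)"
      unfolding surj_def
    proof
      fix y :: "(complex, 'n) vec"
      obtain c where "y = (\<Sum>i\<in>U. c i *s s i)" using \<open>\<nexists>y. y \<notin> comb s U\<close> by (auto simp: comb_def)
      also have "\<dots> = M *v (\<chi> i. c i)"
      proof -
        have "(\<Sum>j\<in>U. c j * s j $ i) = (\<Sum>j\<in>UNIV. (if j \<in> U then s j $ i else 0) * c j)" for i
          by (intro sum.mono_neutral_cong_left) auto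
        then show ?thesis by (simp add: M_def matrix_vector_mult_def vec_eq_iff)
      qed
      finally show "\<exists>x. y = M *v x" by blast
    qed
    then have "invertible M"
      using matrix_right_invertible_surjective[of M] by (simp add: invertible_right_inverse)
    moreover have "column k M = 0" using that by (simp add: M_def column_def vec_eq_iff)
    then have "det M = 0" by (rule det_zero_column)
    ultimately show False by (simp add: invertible_det_nz)
  qed
  have inv_comb: "A *v x \<in> comb s U"
    if tri: "\<And>k. k \<in> U \<Longrightarrow> A *v s k - l k *s s k \<in> comb s {i\<in>U. i < k}" and x: "x \<in> comb s U" for s l U x
  proof -
    have base: "A *v s k \<in> comb s U" if "k \<in> U" for k
    proof -
      have "A *v s k - l k *s s k \<in> comb s U" using tri[OF that] comb_mono[of "{i\<in>U. i < k}" U s] by auto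
      from comb_sub(2)[OF this comb_sub(3)[OF comb_base[OF that]], of "l k"] show ?thesis by simp
    qed
    obtain c where "x = (\<Sum>i\<in>U. c i *s s i)" using x by (auto simp: comb_def)
    then have "A *v x = (\<Sum>i\<in>U. c i *s (A *v s i))"
      by (simp add: matrix_vector_mult_def vec_eq_iff sum_distrib_left sum.swap[of _ U] mult_ac)
    moreover have "(\<Sum>i\<in>V. c i *s (A *v s i)) \<in> comb s U" if "V \<subseteq> U" for V
      using that base by (induction V rule: infinite_finite_induct) (auto intro: comb_sub)
    ultimately show ?thesis by simp
  qed
  have "\<exists>s l. \<forall>k\<in>U. s k \<notin> comb s {i\<in>U. i < k} \<and> A *v s k - l k *s s k \<in> comb s {i\<in>U. i < k}"
    if "finite U" for U :: "'n set"
    using that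
  proof (induction U rule: finite_linorder_max_induct)
    case (insert b U)
    obtain s l where sl: "\<And>k. k \<in> U \<Longrightarrow> s k \<notin> comb s {i\<in>U. i < k}"
        "\<And>k. k \<in> U \<Longrightarrow> A *v s k - l k *s s k \<in> comb s {i\<in>U. i < k}"
      using insert.IH by blast
    have "b \<notin> U" using insert.hyps(2) by auto
    then obtain y where "y \<notin> comb s U" using comb_neq by blast
    then obtain x m where x: "x \<notin> comb s U" "A *v x - m *s x \<in> comb s U"
      using exists_eigenvector_mod_subspace[OF comb_sub(1) comb_sub(2) comb_sub(3), of s U A y] inv_comb[of U s l, OF sl(2)]
      by metis
    have cong: "comb (s(b := x)) V = comb s V" if "V \<subseteq> U" for V
    proof -
      have "(\<Sum>i\<in>V. c i *s (s(b := x)) i) = (\<Sum>i\<in>V. c i *s s i)" for c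
        using that \<open>b \<notin> U\<close> by (intro sum.cong) auto
      then show ?thesis by (simp add: comb_def)
    qed
    have Ub: "{i \<in> insert b U. i < b} = U" using insert.hyps(2) by auto
    have Uk: "{i \<in> insert b U. i < k} = {i \<in> U. i < k}" if "k \<in> U" for k
      using insert.hyps(2) that by auto
    have "(s(b := x)) k \<notin> comb (s(b := x)) {i \<in> insert b U. i < k} \<and>
        A *v (s(b := x)) k - (l(b := m)) k *s (s(b := x)) k \<in> comb (s(b := x)) {i \<in> insert b U. i < k}"
      if "k \<in> insert b U" for k
    proof (cases "k = b")
      case True
      then show ?thesis using x unfolding True Ub by (simp add: cong)
    next
      case False
      then have k: "k \<in> U" using that by simp
      then have "comb (s(b := x)) {i \<in> U. i < k} = comb s {i \<in> U. i < k}" by (intro cong) auto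
      then show ?thesis using sl[OF k] False unfolding Uk[OF k] by simp
    qed
    then show ?case by blast
  qed simp
  from this[OF finite_class.finite_UNIV] obtain s l where
    indep: "\<And>k. s k \<notin> comb s {i. i < k}" and tri: "\<And>k. A *v s k - l k *s s k \<in> comb s {i. i < k}"
    by auto
  define P where "P = (\<chi> i j. s j $ i)"
  have "\<forall>k. \<exists>c. A *v s k - l k *s s k = (\<Sum>i\<in>{i. i < k}. c i *s s i)"
    using tri by (auto simp: comb_def)
  then obtain c where c: "\<And>k. A *v s k - l k *s s k = (\<Sum>i\<in>{i. i < k}. c k i *s s i)" by metis
  define T where "T = (\<chi> i k. if i < k then c k i else if i = k then l k else 0)"
  have eq: "A ** P = P ** T"
  proof -
    have "A *v s k = (\<Sum>i\<in>UNIV. T $ i $ k *s s i)" for k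
    proof -
      have "(\<Sum>i\<in>UNIV. T $ i $ k *s s i) = (\<Sum>i\<in>insert k {i. i < k}. T $ i $ k *s s i)"
        by (intro sum.mono_neutral_right) (auto simp: T_def)
      also have "\<dots> = l k *s s k + (\<Sum>i\<in>{i. i < k}. c k i *s s i)"
        by (simp add: T_def)
      finally show ?thesis using c[of k] by (simp add: algebra_simps)
    qed
    then have "(A *v s k) $ i = (\<Sum>j\<in>UNIV. T $ j $ k * s j $ i)" for i k by simp
    then show ?thesis
      by (simp add: vec_eq_iff P_def matrix_matrix_mult_def matrix_vector_mult_def mult.commute)
  qed
  have inv: "invertible P"
  proof -
    have "\<forall>i. d i = 0" if d: "(\<Sum>i\<in>UNIV. d i *s column i P) = 0" for d
    proof (rule ccontr)
      assume "\<not> (\<forall>i. d i = 0)"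
      then have ne: "{i. d i \<noteq> 0} \<noteq> {}" by auto
      define k where "k = Max {i. d i \<noteq> 0}"
      have k: "d k \<noteq> 0" using Max_in[OF _ ne] by (auto simp: k_def)
      have gt: "d i = 0" if "k < i" for i
      proof (rule ccontr)
        assume "d i \<noteq> 0"
        then have "i \<le> k" unfolding k_def by (intro Max_ge) auto
        then show False using that by simp
      qed
      have "column i P = s i" for i by (simp add: P_def column_def vec_eq_iff)
      then have "0 = (\<Sum>i\<in>UNIV. d i *s s i)" using d by simp
      also have "\<dots> = (\<Sum>i\<in>insert k {i. i < k}. d i *s s i)"
        using gt by (intro sum.mono_neutral_right) (auto simp: not_less_iff_gr_or_eq)
      also have "\<dots> = d k *s s k + (\<Sum>i\<in>{i. i < k}. d i *s s i)" by simp
      finally have "d k *s s k = - (\<Sum>i\<in>{i. i < k}. d i *s s i)" by (simp add: eq_neg_iff_add_eq_0)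
      then have "inverse (d k) *s (d k *s s k) = inverse (d k) *s (- (\<Sum>i\<in>{i. i < k}. d i *s s i))" by simp
      then have "s k = inverse (d k) *s (- (\<Sum>i\<in>{i. i < k}. d i *s s i))"
        using k by (simp add: vector_smult_assoc)
      also have "\<dots> = (- inverse (d k)) *s (\<Sum>i\<in>{i. i < k}. d i *s s i)"
        by (simp add: vec_eq_iff)
      also have "\<dots> \<in> comb s {i. i < k}" by (intro comb_sub) (auto simp: comb_def)
      finally show False using indep by blast
    qed
    then have "\<exists>B. B ** P = mat 1" using matrix_left_invertible_independent_columns[of P] by blast
    then show ?thesis by (metis invertible_left_inverse)
  qed
  have "upper_triangular T" by (auto simp: T_def upper_triangular_def)
  with inv eq show ?thesis by (rule that)
qed

text \<open>Conjugation with the diagonal matrix of the powers \<open>e ^ r j\<close>, where \<open>r j\<close> is the position of \<open>j\<close>,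
  multiplies the entry at \<open>(i, j)\<close> above the diagonal by \<open>e ^ (r j - r i)\<close>, a positive power of the
  small number \<open>e\<close>.\<close>

lemma scale_off_diagonal:
  fixes A P T :: "complex ^ 'n::{finite,wellorder} ^ 'n::{finite,wellorder}"
  assumes P: "invertible P" "A ** P = P ** T" "upper_triangular T" and k: "0 < k"
  obtains Q B :: "complex ^ 'n::{finite,wellorder} ^ 'n::{finite,wellorder}"
  where "invertible Q" "A ** Q = Q ** B" "\<And>i. B $ i $ i = T $ i $ i"
    "\<And>i j. i \<noteq> j \<Longrightarrow> norm (B $ i $ j) \<le> k"
proof -
  define C where "C = (\<Sum>i\<in>UNIV. \<Sum>j\<in>UNIV. norm (T $ i $ j)) + 1"
  have C1: "1 \<le> C" unfolding C_def by (simp add: sum_nonneg)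
  have TC: "norm (T $ i $ j) \<le> C" for i j
  proof -
    have "norm (T $ i $ j) \<le> (\<Sum>j\<in>UNIV. norm (T $ i $ j))" by (rule member_le_sum) auto
    also have "\<dots> \<le> (\<Sum>i\<in>UNIV. \<Sum>j\<in>UNIV. norm (T $ i $ j))"
      by (rule member_le_sum[of i UNIV "\<lambda>i. \<Sum>j\<in>UNIV. norm (T $ i $ j)"]) (auto intro: sum_nonneg)
    finally show ?thesis by (simp add: C_def)
  qed
  define e where "e = min 1 (k / C)"
  have e: "0 < e" "e \<le> 1" "e * C \<le> k"
  proof -
    show "0 < e" "e \<le> 1" using k C1 by (auto simp: e_def)
    have "e * C \<le> k / C * C" using C1 by (intro mult_right_mono) (auto simp: e_def)
    then show "e * C \<le> k" using C1 by simp
  qed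
  define r where "r i = card {j. j < i}" for i :: 'n
  have r: "r i < r j" if "i < j" for i j
    unfolding r_def using that by (intro psubset_card_mono) auto
  define E where "E = (\<chi> i j. if i = j then of_real e ^ r j else (0 :: complex))"
  define B where "B = (\<chi> i j. if i \<le> j then T $ i $ j * of_real e ^ (r j - r i) else 0)"
  have "det E = (\<Prod>i\<in>UNIV. E $ i $ i)" by (rule det_diagonal) (simp add: E_def)
  then have "invertible E" using e(1) by (simp add: invertible_det_nz E_def)
  then have "invertible (P ** E)" using P(1) by (rule invertible_mult[rotated])
  moreover have "T ** E = E ** B"
  proof -
    have "(T ** E) $ i $ j = (E ** B) $ i $ j" for i j
    proof -
      have 1: "(T ** E) $ i $ j = T $ i $ j * of_real e ^ r j"
        by (simp add: matrix_matrix_mult_def E_def if_distrib[of "\<lambda>x. _ * x"] cong: if_cong)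
      have 2: "(E ** B) $ i $ j = of_real e ^ r i * B $ i $ j"
        by (simp add: matrix_matrix_mult_def E_def if_distrib[of "\<lambda>x. x * _"] cong: if_cong)
      show ?thesis
      proof (cases "i \<le> j")
        case True
        then have "r i \<le> r j" using r[of i j] by (cases "i = j") (auto simp: less_le)
        then have "(of_real e :: complex) ^ r j = of_real e ^ r i * of_real e ^ (r j - r i)"
          by (simp flip: power_add)
        then show ?thesis unfolding 1 2 using True by (simp add: B_def)
      next
        case False
        then show ?thesis unfolding 1 2 using P(3) by (simp add: B_def upper_triangular_def)
      qed
    qed
    then show ?thesis by (simp add: vec_eq_iff)
  qed
  then have "A ** (P ** E) = (P ** E) ** B"
    by (metis P(2) matrix_mul_assoc)
  moreover have "B $ i $ i = T $ i $ i" for i by (simp add: B_def)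
  moreover have "norm (B $ i $ j) \<le> k" if "i \<noteq> j" for i j
  proof (cases "i \<le> j")
    case True
    then have "e ^ (r j - r i) \<le> e ^ 1"
      using r[of i j] that e by (intro power_decreasing) (auto simp: less_le Suc_le_eq)
    then have "norm (T $ i $ j) * e ^ (r j - r i) \<le> C * e"
      using TC[of i j] e C1 by (intro mult_mono) auto
    then show ?thesis using True e by (simp add: B_def norm_mult norm_power mult.commute)
  qed (use k in \<open>simp add: B_def\<close>)
  ultimately show ?thesis using that by blast
qed

lemma det_complexify: "det (map_matrix complex_of_real M) = complex_of_real (det M)"
  by (simp add: det_def)

lemma prod_linear_factors_eq_imp_mset_eq:
  fixes M N :: "'a::field multiset"
  assumes "(\<Prod>x\<in>#M. [:- x, 1:]) = (\<Prod>x\<in>#N. [:- x, 1:])"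
  shows "M = N"
proof (rule multiset_eqI)
  fix a
  have "order a (\<Prod>x\<in>#M. [:- x, 1:]) = count M a" for M :: "'a multiset"
  proof (induction M)
    case (add x M)
    have "(\<Prod>x\<in>#M. [:- x, 1:]) \<noteq> 0" by (auto simp: prod_mset_zero_iff)
    then have "[:- x, 1:] * (\<Prod>x\<in>#M. [:- x, 1:]) \<noteq> 0" by (simp del: mult_pCons_left)
    moreover have "order a [:- x, 1:] = (if x = a then 1 else 0)"
      using order_power_n_n[of a 1] by (auto intro!: order_0I)
    ultimately show ?case using add by (simp add: order_mult del: mult_pCons_left)
  qed simp
  then show "count M a = count N a" using assms by metis
qed

text \<open>The characteristic polynomials of \<open>T\<close> and of \<open>G\<close> agree at all real numbers, hence as complex
  polynomials, and linear factors are determined with their multiplicity.\<close>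

lemma real_eigenvalues_of_triangular:
  fixes G :: "real ^ 'n::{finite,wellorder} ^ 'n::{finite,wellorder}" and M :: "real multiset"
    and P T :: "complex ^ 'n::{finite,wellorder} ^ 'n::{finite,wellorder}"
  assumes char: "\<And>s. det (mat s - G) = (\<Prod>x\<in>#M. s - x)"
    and P: "invertible P" "map_matrix complex_of_real G ** P = P ** T" "upper_triangular T"
  obtains d where "\<And>i. T $ i $ i = of_real (d i)" "image_mset d (mset_set UNIV) = M"
proof -
  let ?A = "map_matrix complex_of_real G"
  have mat_mult: "mat c ** X = X ** mat c" for c :: complex and X :: "((complex, 'n) vec, 'n) vec"
    by (simp add: vec_eq_iff matrix_matrix_mult_def mat_def if_distrib[of "\<lambda>x. x * _"]
        if_distrib[of "\<lambda>x. _ * x"] mult.commute cong: if_cong)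
  have mult_diff_left: "(X - Y) ** Z = X ** Z - Y ** Z" and mult_diff_right: "Z ** (X - Y) = Z ** X - Z ** Y"
    for X Y Z :: "((complex, 'n) vec, 'n) vec"
    by (simp_all add: vec_eq_iff matrix_matrix_mult_def left_diff_distrib right_diff_distrib sum_subtractf)
  have eq: "(\<Prod>i\<in>UNIV. of_real s - T $ i $ i) = (\<Prod>x\<in>#M. of_real s - of_real x)" for s :: real
  proof -
    have "(mat (of_real s) - ?A) ** P = P ** (mat (of_real s) - T)"
      using P(2) mat_mult[of "of_real s" P] by (simp add: mult_diff_left mult_diff_right)
    then have "det (mat (of_real s) - ?A) * det P = det P * det (mat (of_real s) - T)"
      by (metis det_mul)
    then have "det (mat (of_real s) - ?A) = det (mat (of_real s) - T)"
      using P(1) by (simp add: invertible_det_nz)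
    moreover have "det (mat (of_real s) - T) = (\<Prod>i\<in>UNIV. (mat (of_real s) - T) $ i $ i)"
      using P(3) by (intro det_upperdiagonal) (auto simp: upper_triangular_def mat_def)
    moreover have "mat (of_real s) - ?A = map_matrix complex_of_real (mat s - G)"
      by (simp add: vec_eq_iff mat_def)
    ultimately have "(\<Prod>i\<in>UNIV. of_real s - T $ i $ i) = complex_of_real (\<Prod>x\<in>#M. s - x)"
      using char[of s] by (simp add: det_complexify mat_def)
    also have "\<dots> = (\<Prod>x\<in>#M. of_real s - of_real x)"
      by (induction M) auto
    finally show ?thesis .
  qed
  let ?D = "image_mset (\<lambda>i. T $ i $ i) (mset_set UNIV)" and ?M = "image_mset complex_of_real M"
  let ?p = "\<lambda>N. \<Prod>x\<in>#N. [:- x, 1 :: complex:]"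
  have poly_p: "poly (?p N) z = (\<Prod>x\<in>#N. z - x)" for N z
    by (induction N) (auto simp: algebra_simps)
  have "?p ?D = ?p ?M"
  proof (rule ccontr)
    assume "?p ?D \<noteq> ?p ?M"
    then have "finite {z. poly (?p ?D - ?p ?M) z = 0}" by (intro poly_roots_finite) simp
    moreover have "poly (?p ?D) (of_real s) = poly (?p ?M) (of_real s)" for s
      unfolding poly_p using eq[of s] by (simp add: image_mset.compositionality o_def prod_unfold_prod_mset)
    then have "range complex_of_real \<subseteq> {z. poly (?p ?D - ?p ?M) z = 0}"
      by (auto simp del: image_mset.compositionality)
    moreover have "infinite (range complex_of_real)"
      using infinite_UNIV_char_0 by (subst finite_image_iff) (auto simp: inj_on_def)
    ultimately show False using finite_subset by blast
  qed
  then have DM: "?D = ?M" by (rule prod_linear_factors_eq_imp_mset_eq)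
  define d where "d i = Re (T $ i $ i)" for i
  have "T $ i $ i = of_real (d i)" for i
  proof -
    have "T $ i $ i \<in># ?D" by simp
    then have "T $ i $ i \<in># ?M" unfolding DM .
    then show ?thesis by (auto simp: d_def)
  qed
  moreover have "image_mset d (mset_set UNIV) = M"
  proof -
    have "image_mset d (mset_set UNIV) = image_mset Re ?D"
      by (simp add: d_def[abs_def] image_mset.compositionality o_def)
    also have "\<dots> = M" unfolding DM by (simp add: image_mset.compositionality o_def)
    finally show ?thesis .
  qed
  ultimately show ?thesis using that by blast
qed

text \<open>A substitute for the Jordan form that suffices for perturbation estimates: it puts the hyperbolic
  splitting into the coordinates, up to an arbitrarily small error.\<close>

definition nearly_diagonalizable :: "complex ^ 'n ^ 'n \<Rightarrow> ('n \<Rightarrow> real) \<Rightarrow> bool" where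
  "nearly_diagonalizable A d \<longleftrightarrow>
     (\<forall>k>0. \<exists>(P :: complex ^ 'n ^ 'n) B. invertible P \<and> A ** P = P ** B \<and>
        (\<forall>i. B $ i $ i = of_real (d i)) \<and> (\<forall>i j. i \<noteq> j \<longrightarrow> norm (B $ i $ j) \<le> k))"

lemma nearly_diagonalizable_scale:
  fixes A :: "complex ^ 'n ^ 'n"
  assumes "nearly_diagonalizable A d"
  shows "nearly_diagonalizable (\<chi> i j. of_real a * A $ i $ j) (\<lambda>i. a * d i)"
  unfolding nearly_diagonalizable_def
proof (intro allI impI)
  fix k :: real assume "0 < k"
  then have "0 < k / (\<bar>a\<bar> + 1)" by simp
  then obtain P B where PB: "invertible P" "A ** P = P ** B" "\<And>i. B $ i $ i = of_real (d i)"
    "\<And>i j. i \<noteq> j \<Longrightarrow> norm (B $ i $ j) \<le> k / (\<bar>a\<bar> + 1)"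
    using assms unfolding nearly_diagonalizable_def by metis
  define aB where "aB = (\<chi> i j. of_real a * B $ i $ j)"
  have "(\<chi> i j. of_real a * A $ i $ j) ** P = P ** aB"
  proof -
    have "(\<Sum>m\<in>UNIV. A $ i $ m * P $ m $ j) = (\<Sum>m\<in>UNIV. P $ i $ m * B $ m $ j)" for i j
      using PB(2) by (simp add: vec_eq_iff matrix_matrix_mult_def)
    then have "(\<Sum>m\<in>UNIV. of_real a * A $ i $ m * P $ m $ j) = (\<Sum>m\<in>UNIV. of_real a * (P $ i $ m * B $ m $ j))" for i j
      by (simp add: mult.assoc flip: sum_distrib_left)
    then show ?thesis by (simp add: vec_eq_iff matrix_matrix_mult_def aB_def mult_ac)
  qed
  moreover have "norm (aB $ i $ j) \<le> k" if "i \<noteq> j" for i j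
  proof -
    have "\<bar>a\<bar> * norm (B $ i $ j) \<le> \<bar>a\<bar> * (k / (\<bar>a\<bar> + 1))" by (intro mult_left_mono PB(4) that) auto
    also have "\<dots> \<le> k" using \<open>0 < k\<close> by (simp add: field_simps)
    finally show ?thesis by (simp add: aB_def norm_mult)
  qed
  moreover have "aB $ i $ i = of_real (a * d i)" for i by (simp add: aB_def PB(3))
  ultimately show "\<exists>(P :: complex ^ 'n ^ 'n) B. invertible P \<and> (\<chi> i j. of_real a * A $ i $ j) ** P = P ** B \<and>
        (\<forall>i. B $ i $ i = of_real (a * d i)) \<and> (\<forall>i j. i \<noteq> j \<longrightarrow> norm (B $ i $ j) \<le> k)"
    using PB(1) by blast
qed

lemma hyperbolic_nearly_diagonalizable:
  fixes G :: "real ^ 4 ^ 4"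
  assumes char: "\<And>s. det (mat s - G) = (s - l1) * (s - l2) * (s - l3) * (s - l4)"
    and l: "l1 < 0" "l2 < 0" "0 < l3" "0 < l4"
  obtains d where "nearly_diagonalizable (map_matrix complex_of_real G) d" "\<And>i. d i \<noteq> 0"
    "card {i. d i < 0} \<le> 2" "card {i. 0 < d i} \<le> 2"
proof -
  obtain P T :: "complex ^ 4 ^ 4" where PT: "invertible P" "map_matrix complex_of_real G ** P = P ** T" "upper_triangular T"
    using exists_triangular_similar[of "map_matrix complex_of_real G"] by blast
  have char': "det (mat s - G) = (\<Prod>x\<in>#{#l1, l2, l3, l4#}. s - x)" for s
    by (simp add: char mult_ac)
  obtain d where d: "\<And>i. T $ i $ i = of_real (d i)" "image_mset d (mset_set UNIV) = {#l1, l2, l3, l4#}"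
    using real_eigenvalues_of_triangular[OF char' PT] by blast
  have card: "card {i. Q (d i)} = size (filter_mset Q {#l1, l2, l3, l4#})" for Q
    by (simp flip: d(2) add: filter_mset_image_mset)
  show ?thesis
  proof (rule that[of d])
    show "nearly_diagonalizable (map_matrix complex_of_real G) d"
      unfolding nearly_diagonalizable_def
    proof (intro allI impI)
      fix k :: real assume "0 < k"
      from scale_off_diagonal[OF PT this] obtain Q B :: "complex ^ 4 ^ 4" where "invertible Q"
        "map_matrix complex_of_real G ** Q = Q ** B" "\<And>i. B $ i $ i = T $ i $ i" "\<And>i j. i \<noteq> j \<Longrightarrow> norm (B $ i $ j) \<le> k"
        by blast
      then show "\<exists>(P :: complex ^ 4 ^ 4) B. invertible P \<and> map_matrix complex_of_real G ** P = P ** B \<and>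
        (\<forall>i. B $ i $ i = of_real (d i)) \<and> (\<forall>i j. i \<noteq> j \<longrightarrow> norm (B $ i $ j) \<le> k)"
        using d(1) by metis
    qed
    show "card {i. d i < 0} \<le> 2" "card {i. 0 < d i} \<le> 2" using card[of "\<lambda>x. x < 0"] card[of "\<lambda>x. 0 < x"] l by simp_all
    show "d i \<noteq> 0" for i
    proof -
      have "d i \<in># {#l1, l2, l3, l4#}" by (simp flip: d(2))
      then have "d i = l1 \<or> d i = l2 \<or> d i = l3 \<or> d i = l4" by auto
      then show ?thesis using l by auto
    qed
  qed
qed

section \<open>Bounded solutions of asymptotically hyperbolic systems\<close>

text \<open>Gaussian elimination: one equation is solved for one unknown.\<close>

lemma homogeneous_system_nontrivial:
  fixes a :: "'i \<Rightarrow> 'j \<Rightarrow> 'a::field"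
  assumes "finite I" "finite J" "card I < card J"
  shows "\<exists>c. (\<exists>j\<in>J. c j \<noteq> 0) \<and> (\<forall>i\<in>I. (\<Sum>j\<in>J. c j * a i j) = 0)"
  using assms
proof (induction I arbitrary: J a rule: finite_induct)
  case empty
  then obtain j where "j \<in> J" by fastforce
  then show ?case by (intro exI[of _ "\<lambda>_. 1"]) auto
next
  case (insert i I)
  show ?case
  proof (cases "\<forall>j\<in>J. a i j = 0")
    case True
    have "card I < card J" using insert.prems insert.hyps by simp
    from insert.IH[OF insert.prems(1) this, of a] show ?thesis using True by auto
  next
    case False
    then obtain k where k: "k \<in> J" "a i k \<noteq> 0" by blast
    define b where "b i' j = a i' j - a i' k * a i j / a i k" for i' j
    have "card I < card (J - {k})" using insert k by (simp add: card_Diff_singleton)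
    from insert.IH[OF _ this, of b] obtain c where
      c: "\<exists>j\<in>J - {k}. c j \<noteq> 0" "\<And>i'. i' \<in> I \<Longrightarrow> (\<Sum>j\<in>J - {k}. c j * b i' j) = 0"
      using insert.prems by auto
    define c' where "c' = c(k := - (\<Sum>j\<in>J - {k}. c j * a i j) / a i k)"
    have sum: "(\<Sum>j\<in>J. c' j * a i' j) = c' k * a i' k + (\<Sum>j\<in>J - {k}. c j * a i' j)" for i'
    proof -
      have "(\<Sum>j\<in>J - {k}. c' j * a i' j) = (\<Sum>j\<in>J - {k}. c j * a i' j)"
        by (intro sum.cong) (auto simp: c'_def)
      then show ?thesis using sum.remove[OF insert.prems(1) k(1), of "\<lambda>j. c' j * a i' j"] by simp
    qed
    have "(\<Sum>j\<in>J. c' j * a i j) = 0" unfolding sum using k(2) by (simp add: c'_def)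
    moreover have "(\<Sum>j\<in>J. c' j * a i' j) = 0" if "i' \<in> I" for i'
    proof -
      have "(\<Sum>j\<in>J - {k}. c j * b i' j)
          = (\<Sum>j\<in>J - {k}. c j * a i' j) - a i' k / a i k * (\<Sum>j\<in>J - {k}. c j * a i j)"
        by (simp add: b_def right_diff_distrib sum_subtractf sum_distrib_left mult_ac)
      then show ?thesis unfolding sum using c(2)[OF that] by (simp add: c'_def)
    qed
    moreover have "\<exists>j\<in>J. c' j \<noteq> 0" using c(1) by (auto simp: c'_def)
    ultimately show ?thesis by auto
  qed
qed

text \<open>In coordinates that nearly diagonalize the limit, let \<open>q\<close> be the sum of \<open>sgn (d i) * norm (y i) ^ 2\<close>.
  Its derivative along solutions is at least \<open>b * norm y ^ 2\<close>, hence at least \<open>b * q\<close>, for a constant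
  \<open>b\<close> that no \<open>abs (d i)\<close> falls below; so a bounded solution cannot have \<open>q\<close> positive. Having more solutions
  than negative \<open>d i\<close>, some combination has vanishing stable coordinates at one time \<open>T1\<close>. There \<open>q\<close>
  is the squared norm, so this combination is zero.\<close>

lemma dependent_bounded_solutions:
  fixes A :: "real \<Rightarrow> complex ^ 'n ^ 'n" and u :: "'j \<Rightarrow> real \<Rightarrow> complex ^ 'n"
  assumes lim: "\<And>i j. ((\<lambda>t. A t $ i $ j) \<longlongrightarrow> A0 $ i $ j) at_top"
    and M: "\<And>t x. T0 \<le> t \<Longrightarrow> norm (A t *v x) \<le> M * norm x"
    and d: "\<And>i. d i \<noteq> (0 :: real)" and J: "finite J" "card {i. d i < 0} < card J"
    and diag: "nearly_diagonalizable A0 d"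
    and sol: "\<And>j t. j \<in> J \<Longrightarrow> T0 \<le> t \<Longrightarrow> (u j has_vector_derivative A t *v u j t) (at t)"
    and bdd: "\<And>j. j \<in> J \<Longrightarrow> bounded (u j ` {T0..})"
  shows "\<exists>c. (\<exists>j\<in>J. c j \<noteq> 0) \<and> (\<forall>t\<ge>T0. (\<Sum>j\<in>J. c j *s u j t) = 0)"
proof -
  define b where "b = Min (range (\<lambda>i. \<bar>d i\<bar>))"
  have b: "0 < b" "\<And>i. b \<le> \<bar>d i\<bar>" using d by (auto simp: b_def)
  define n where "n = real CARD('n)"
  have n: "1 \<le> n" by (simp add: n_def Suc_leI)
  \<comment> \<open>the limit matrix contributes the error \<open>k\<close> off the diagonal and the approach to the limit
    another \<open>k\<close>; with this choice both together cost at most half of the growth rate \<open>2 * b\<close>\<close>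
  define k where "k = b / (4 * n)"
  have k: "0 < k" "4 * k * n = b" using b n by (auto simp: k_def)
  obtain P B where P: "invertible P" "A0 ** P = P ** B"
    and Bd: "\<And>i. B $ i $ i = of_real (d i)" and Bo: "\<And>i j. i \<noteq> j \<Longrightarrow> norm (B $ i $ j) \<le> k"
    using diag[unfolded nearly_diagonalizable_def, rule_format, OF k(1)] by blast
  obtain Q where Q: "Q ** P = mat 1" "P ** Q = mat 1" using P(1) by (auto simp: invertible_def)
  define At where "At t = Q ** A t ** P" for t
  have "((\<lambda>t. At t $ i $ j) \<longlongrightarrow> (Q ** A0 ** P) $ i $ j) at_top" for i j
    unfolding At_def matrix_matrix_mult_def vec_lambda_beta
    by (intro tendsto_sum tendsto_mult tendsto_const lim)
  moreover have "Q ** A0 ** P = B" by (metis P(2) Q(1) matrix_mul_assoc matrix_mul_lid)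
  ultimately have "\<forall>\<^sub>F t in at_top. dist (At t $ i $ j) (B $ i $ j) < k" for i j
    using k(1) by (metis tendstoD)
  then have "\<forall>\<^sub>F t in at_top. T0 \<le> t \<and> (\<forall>i j. dist (At t $ i $ j) (B $ i $ j) < k)"
    by (intro eventually_conj eventually_ge_at_top eventually_all_finite)
  then obtain T1 where T1: "\<And>t. T1 \<le> t \<Longrightarrow> T0 \<le> t \<and> (\<forall>i j. dist (At t $ i $ j) (B $ i $ j) < k)"
    by (auto simp: eventually_at_top_linorder)
  define I where "I = {i. d i < 0}"
  obtain c where c: "\<exists>j\<in>J. c j \<noteq> 0" "\<And>i. i \<in> I \<Longrightarrow> (\<Sum>j\<in>J. c j * (Q *v u j T1) $ i) = 0"
    using homogeneous_system_nontrivial[of I J "\<lambda>i j. (Q *v u j T1) $ i"] J by (auto simp: I_def)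
  define v where "v t = (\<Sum>j\<in>J. c j *s u j t)" for t
  define y where "y t = Q *v v t" for t
  have dv: "(v has_vector_derivative A t *v v t) (at t)" if "T0 \<le> t" for t
  proof -
    have "((\<lambda>t. c j *s u j t) has_vector_derivative c j *s (A t *v u j t)) (at t)" if "j \<in> J" for j
      using sol[OF that \<open>T0 \<le> t\<close>] unfolding has_vector_derivative_vec_iff
      by (auto intro!: has_vector_derivative_mult_right)
    then have "(v has_vector_derivative (\<Sum>j\<in>J. c j *s (A t *v u j t))) (at t)"
      unfolding v_def by (rule has_vector_derivative_sum)
    moreover have "A t *v v t = (\<Sum>j\<in>J. c j *s (A t *v u j t))"
      by (simp add: v_def matrix_vector_mult_def vec_eq_iff sum_distrib_left sum.swap[of _ J] mult_ac)
    ultimately show ?thesis by simp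
  qed
  have dy: "((\<lambda>t. y t $ i) has_vector_derivative (At t *v y t) $ i) (at t)" if "T0 \<le> t" for t i
  proof -
    have "((\<lambda>t. \<Sum>l\<in>UNIV. Q $ i $ l * v t $ l) has_vector_derivative
        (\<Sum>l\<in>UNIV. Q $ i $ l * (A t *v v t) $ l)) (at t)"
      using dv[OF that] unfolding has_vector_derivative_vec_iff
      by (intro has_vector_derivative_sum has_vector_derivative_mult_right) auto
    moreover have "At t *v y t = Q *v (A t *v v t)"
      unfolding At_def y_def using Q(2)
      by (metis matrix_mul_assoc matrix_mul_rid matrix_vector_mul_assoc)
    ultimately show ?thesis by (simp add: y_def matrix_vector_mult_def)
  qed
  \<comment> \<open>the indefinite quadratic form, and the definite one by which it is bounded\<close>
  define q where "q t = (\<Sum>i\<in>UNIV. sgn (d i) * (y t $ i \<bullet> y t $ i))" for t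
  define N where "N t = (\<Sum>i\<in>UNIV. y t $ i \<bullet> y t $ i)" for t
  have qN: "q t \<le> N t" for t
    unfolding q_def N_def by (intro sum_mono) (auto simp: sgn_if mult_le_cancel_right1)
  have dq: "\<exists>q'. (q has_real_derivative q') (at t) \<and> b * N t \<le> q'" if t: "T1 \<le> t" for t
  proof -
    define q' where "q' = (\<Sum>i\<in>UNIV. sgn (d i) * (2 * (y t $ i \<bullet> (At t *v y t) $ i)))"
    have T0: "T0 \<le> t" using T1 t by blast
    have "((\<lambda>t. y t $ i \<bullet> y t $ i) has_real_derivative 2 * (y t $ i \<bullet> (At t *v y t) $ i)) (at t)" for i
      using bounded_bilinear.has_vector_derivative[OF bounded_bilinear_inner dy[OF T0, of i] dy[OF T0, of i]]
      by (simp add: has_real_derivative_iff_has_vector_derivative inner_commute)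
    then have "(q has_real_derivative q') (at t)"
      unfolding q_def q'_def by (intro DERIV_sum DERIV_cmult)
    moreover have "b * N t \<le> q'"
    proof -
      define E where "E i = (At t *v y t) $ i - d i *\<^sub>R y t $ i" for i
      have Eij: "norm (At t $ i $ j - (if i = j then of_real (d i) else 0)) \<le> 2 * k" for i j
      proof -
        have "norm (At t $ i $ j - B $ i $ j) \<le> k" using T1[OF t] by (auto simp: dist_norm less_imp_le)
        moreover have "norm (B $ i $ j - (if i = j then of_real (d i) else 0)) \<le> k"
          using Bo[of i j] Bd[of i] k(1) by auto
        ultimately show ?thesis
          using norm_triangle_ineq[of "At t $ i $ j - B $ i $ j" "B $ i $ j - (if i = j then of_real (d i) else 0)"]
          by simp
      qed
      have En: "norm (E i) \<le> 2 * k * (\<Sum>j\<in>UNIV. norm (y t $ j))" for i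
      proof -
        have "E i = (\<Sum>j\<in>UNIV. (At t $ i $ j - (if i = j then of_real (d i) else 0)) * y t $ j)"
          by (simp add: E_def matrix_vector_mult_def left_diff_distrib sum_subtractf scaleR_conv_of_real
              if_distrib[of "\<lambda>x. x * _"] cong: if_cong)
        also have "norm \<dots> \<le> (\<Sum>j\<in>UNIV. 2 * k * norm (y t $ j))"
          by (intro sum_norm_le) (simp only: norm_mult, intro mult_right_mono Eij norm_ge_zero)
        finally show ?thesis by (simp add: sum_distrib_left)
      qed
      define S where "S = (\<Sum>j\<in>UNIV. norm (y t $ j))"
      have S2: "S\<^sup>2 \<le> n * N t"
        unfolding S_def n_def N_def using Cauchy_Schwarz_ineq_sum[of "\<lambda>_. 1" "\<lambda>j. norm (y t $ j)" UNIV]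
        by (simp add: dot_square_norm)
      have term_le: "2 * b * (y t $ i \<bullet> y t $ i) - 4 * k * (norm (y t $ i) * S)
          \<le> sgn (d i) * (2 * (y t $ i \<bullet> (At t *v y t) $ i))" for i
      proof -
        have "(At t *v y t) $ i = d i *\<^sub>R y t $ i + E i" by (simp add: E_def)
        then have "sgn (d i) * (2 * (y t $ i \<bullet> (At t *v y t) $ i))
            = 2 * \<bar>d i\<bar> * (y t $ i \<bullet> y t $ i) + 2 * (sgn (d i) * (y t $ i \<bullet> E i))"
          by (simp add: inner_add_right algebra_simps sgn_mult_self_eq abs_sgn)
        moreover have "2 * b * (y t $ i \<bullet> y t $ i) \<le> 2 * \<bar>d i\<bar> * (y t $ i \<bullet> y t $ i)"
          using b(2)[of i] by (intro mult_right_mono) auto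
        moreover have "\<bar>sgn (d i) * (y t $ i \<bullet> E i)\<bar> \<le> norm (y t $ i) * (2 * k * S)"
        proof -
          have "\<bar>sgn (d i) * (y t $ i \<bullet> E i)\<bar> \<le> \<bar>y t $ i \<bullet> E i\<bar>" by (simp add: abs_mult abs_sgn_eq)
          also have "\<dots> \<le> norm (y t $ i) * norm (E i)" by (rule Cauchy_Schwarz_ineq2)
          also have "\<dots> \<le> norm (y t $ i) * (2 * k * S)"
            using En[of i] by (intro mult_left_mono) (auto simp: S_def)
          finally show ?thesis .
        qed
        ultimately show ?thesis unfolding abs_le_iff by (simp add: algebra_simps)
      qed
      have "q' \<ge> (\<Sum>i\<in>UNIV. 2 * b * (y t $ i \<bullet> y t $ i) - 4 * k * (norm (y t $ i) * S))"
        unfolding q'_def by (intro sum_mono term_le)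
      also have "(\<Sum>i\<in>UNIV. 2 * b * (y t $ i \<bullet> y t $ i) - 4 * k * (norm (y t $ i) * S))
          = 2 * b * N t - 4 * k * ((\<Sum>i\<in>UNIV. norm (y t $ i)) * S)"
        by (simp add: sum_subtractf N_def sum_distrib_left sum_distrib_right)
      also have "\<dots> = 2 * b * N t - 4 * k * S\<^sup>2" by (simp add: S_def power2_eq_square)
      finally have "2 * b * N t - 4 * k * S\<^sup>2 \<le> q'" .
      moreover have "4 * k * S\<^sup>2 \<le> b * N t"
        using mult_left_mono[OF S2, of "4 * k"] k by (simp flip: k(2) add: mult.assoc)
      ultimately show ?thesis by simp
    qed
    ultimately show ?thesis by blast
  qed
  have grow: "exp (b * (t - T1)) * q T1 \<le> q t" if "T1 \<le> t" for t
  proof -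
    define g where "g s = exp (- (b * s)) * q s" for s
    have "g T1 \<le> g t"
    proof (rule DERIV_nonneg_imp_nondecreasing[OF that])
      fix s assume s: "T1 \<le> s" "s \<le> t"
      obtain q' where q': "(q has_real_derivative q') (at s)" "b * N s \<le> q'" using dq[OF s(1)] by blast
      have "(g has_real_derivative exp (- (b * s)) * (q' - b * q s)) (at s)"
        unfolding g_def by (auto intro!: derivative_eq_intros q'(1) simp: algebra_simps)
      moreover have "b * q s \<le> b * N s" using b(1) qN by (intro mult_left_mono) auto
      then have "0 \<le> exp (- (b * s)) * (q' - b * q s)" using q'(2) by simp
      ultimately show "\<exists>y. (g has_real_derivative y) (at s) \<and> 0 \<le> y" by blast
    qed
    then have "exp (b * t) * (exp (- (b * T1)) * q T1) \<le> exp (b * t) * (exp (- (b * t)) * q t)"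
      unfolding g_def by (intro mult_left_mono) auto
    then show ?thesis by (simp add: mult_exp_exp right_diff_distrib flip: mult.assoc)
  qed
  have q1: "q T1 = N T1"
  proof -
    have "y T1 $ i = 0" if "i \<in> I" for i
    proof -
      have "y T1 $ i = (\<Sum>j\<in>J. c j * (Q *v u j T1) $ i)"
        by (simp add: y_def v_def matrix_vector_mult_def sum_distrib_left sum.swap[of _ J] mult_ac)
      then show ?thesis using c(2)[OF that] by simp
    qed
    then show ?thesis unfolding q_def N_def using d
      by (intro sum.cong) (auto simp: I_def sgn_if not_less_iff_gr_or_eq)
  qed
  have "y T1 = 0"
  proof (rule ccontr)
    assume "y T1 \<noteq> 0"
    then obtain i where i: "y T1 $ i \<noteq> 0" by (auto simp: vec_eq_iff)
    have "0 < N T1" unfolding N_def using i by (intro sum_pos2[where i = i]) auto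
    then have q_pos: "0 < q T1" using q1 by simp
    have "bounded (v ` {T0..})"
    proof -
      have "\<forall>j\<in>J. \<exists>C. \<forall>t\<ge>T0. norm (u j t) \<le> C" using bdd by (fastforce simp: bounded_iff)
      then obtain C where C: "\<And>j t. j \<in> J \<Longrightarrow> T0 \<le> t \<Longrightarrow> norm (u j t) \<le> C j" by metis
      have "norm (v t) \<le> (\<Sum>j\<in>J. norm (c j) * C j)" if "T0 \<le> t" for t
        unfolding v_def using C[OF _ that]
        by (intro sum_norm_le) (auto simp: norm_smult_vec intro!: mult_left_mono)
      then show ?thesis by (auto simp: bounded_iff)
    qed
    then obtain C where C: "\<And>t. T0 \<le> t \<Longrightarrow> norm (v t) \<le> C" by (auto simp: bounded_iff)
    define m where "m = (\<Sum>i\<in>UNIV. \<Sum>j\<in>UNIV. norm (Q $ i $ j)) * C"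
    have ym: "norm (y t) \<le> m" if "T1 \<le> t" for t
      unfolding y_def m_def using T1[OF that] C[of t]
      by (intro order_trans[OF norm_matrix_vector_mult_le] mult_left_mono) (auto intro!: sum_nonneg)
    have qm: "q t \<le> m\<^sup>2" if "T1 \<le> t" for t
    proof -
      have "q t \<le> N t" by (rule qN)
      also have "N t = (norm (y t))\<^sup>2" by (simp add: N_def flip: dot_square_norm inner_vec_def)
      also have "\<dots> \<le> m\<^sup>2" using ym[OF that] by (intro power_mono) auto
      finally show ?thesis .
    qed
    \<comment> \<open>late enough for the linear lower bound of the exponential to exceed the upper bound \<open>m ^ 2\<close>\<close>
    define t where "t = T1 + m\<^sup>2 / (b * q T1)"
    have t: "T1 \<le> t" using b q_pos by (simp add: t_def)
    have "1 + b * (t - T1) \<le> exp (b * (t - T1))" by (rule exp_ge_add_one_self)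
    then have "(1 + b * (t - T1)) * q T1 \<le> exp (b * (t - T1)) * q T1"
      using q_pos by (intro mult_right_mono) auto
    also have "\<dots> \<le> m\<^sup>2" using grow[OF t] qm[OF t] by simp
    finally have "q T1 + b * (t - T1) * q T1 \<le> m\<^sup>2" by (simp add: algebra_simps)
    moreover have "b * (t - T1) * q T1 = m\<^sup>2" using b q_pos by (simp add: t_def)
    ultimately show False using q_pos by simp
  qed
  then have "P *v y T1 = 0" by simp
  then have v1: "v T1 = 0" using Q(2) by (simp add: y_def matrix_vector_mul_assoc)
  have "v t = 0" if "T0 \<le> t" for t
  proof -
    have ge: "T0 \<le> T1 + s * (t - T1)" if s: "0 \<le> s" "s \<le> 1" for s
    proof -
      have "T0 = (1 - s) * T0 + s * T0" by (simp add: algebra_simps)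
      also have "\<dots> \<le> (1 - s) * T1 + s * t"
        using s T1[of T1] \<open>T0 \<le> t\<close> by (intro add_mono mult_left_mono) auto
      finally show ?thesis by (simp add: algebra_simps)
    qed
    have "norm (v (T1 + 1 * (t - T1))) \<le> exp (\<bar>t - T1\<bar> * M) * norm (v (T1 + 0 * (t - T1)))"
    proof (rule gronwall_norm[where u = "\<lambda>s. v (T1 + s * (t - T1))"])
      fix s :: real assume s: "0 \<le> s" "s \<le> 1"
      let ?s = "T1 + s * (t - T1)"
      have "((\<lambda>s. T1 + s * (t - T1)) has_vector_derivative (t - T1)) (at s)"
        by (auto intro!: derivative_eq_intros)
      from vector_diff_chain_at[OF this dv[OF ge[OF s]]]
      show "((\<lambda>s. v (T1 + s * (t - T1))) has_vector_derivative (t - T1) *\<^sub>R (A ?s *v v ?s)) (at s)"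
        by (simp add: o_def)
      show "norm ((t - T1) *\<^sub>R (A ?s *v v ?s)) \<le> \<bar>t - T1\<bar> * M * norm (v ?s)"
        using mult_left_mono[OF M[OF ge[OF s], of "v ?s"], of "\<bar>t - T1\<bar>"] by (simp add: mult_ac)
    qed
    then show ?thesis using v1 by simp
  qed
  then show ?thesis using c(1) by (auto simp: v_def)
qed

section \<open>The Jacobian of a holomorphic map\<close>

lemma matrix_vector_mult_axis: "A *v axis j 1 = column j A" for A :: "'a::comm_semiring_1 ^ 'n ^ 'm"
  by (simp add: vec_eq_iff matrix_vector_mult_def column_def axis_def if_distrib[of "\<lambda>x. _ * x"] cong: if_cong)

lemma jacobian_eqI:
  fixes F :: "complex ^ 'n \<Rightarrow> complex ^ 'm"
  assumes "(F has_derivative (\<lambda>h. J *v h)) (at x)"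
  shows "jacobian F (at x) = J"
  unfolding jacobian_def frechet_derivative_at[OF assms, symmetric] by simp

text \<open>The chain rule for a curve in the domain of a holomorphic map of several variables.\<close>

lemma has_field_derivative_compose_vec:
  fixes F :: "complex ^ 'n \<Rightarrow> complex ^ 'm"
  assumes F: "(F has_derivative (\<lambda>h. J *v h)) (at (Y t))"
    and Y: "\<And>i. ((\<lambda>s. Y s $ i) has_field_derivative y' $ i) (at t)"
  shows "((\<lambda>s. F (Y s) $ i) has_field_derivative (J *v y') $ i) (at t)"
proof -
  have "(Y has_derivative (\<lambda>h. h *s y')) (at t)"
  proof (rule has_derivative_vecI)
    fix i
    have "(\<lambda>h. (h *s y') $ i) = (*) (y' $ i)" by (auto simp: fun_eq_iff mult.commute)
    then show "((\<lambda>s. Y s $ i) has_derivative (\<lambda>h. (h *s y') $ i)) (at t)"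
      using Y[of i] by (simp add: has_field_derivative_def)
  qed
  then have "((\<lambda>s. F (Y s)) has_derivative (\<lambda>h. J *v (h *s y'))) (at t)"
    using diff_chain_at[of Y "\<lambda>h. h *s y'" t F] F by (simp add: o_def)
  then have "((\<lambda>s. F (Y s) $ i) has_derivative (\<lambda>h. (J *v (h *s y')) $ i)) (at t)"
    by (rule bounded_linear.has_derivative[OF bounded_linear_vec_nth])
  moreover have "(\<lambda>h. (J *v (h *s y')) $ i) = (*) ((J *v y') $ i)"
    by (auto simp: fun_eq_iff matrix_vector_mult_def sum_distrib_left sum_distrib_right mult_ac)
  ultimately show ?thesis by (simp add: has_field_derivative_def)
qed

context
  fixes F :: "complex ^ 'n \<Rightarrow> complex ^ 'm" and W
  assumes W: "open W" and F: "\<And>x. x \<in> W \<Longrightarrow> \<exists>J. (F has_derivative (\<lambda>h. J *v h)) (at x)"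
begin

lemma has_derivative_jacobian:
  "x \<in> W \<Longrightarrow> (F has_derivative (\<lambda>h. jacobian F (at x) *v h)) (at x)"
  using F jacobian_eqI by metis

lemma continuous_on_complexified: "continuous_on W F"
  using has_derivative_jacobian by (meson continuous_at_imp_continuous_on has_derivative_continuous)

text \<open>The partial derivatives are locally uniform limits of difference quotients. In one variable this
  is Taylor's formula of first order; the second derivative in the remainder is bounded by Cauchy's
  inequality, uniformly in the base point. So continuity and holomorphy pass from the map to its
  Jacobian.\<close>

lemma difference_quotient_uniform:
  assumes x0: "x0 \<in> W"
  obtains r where "0 < r" "cball x0 r \<subseteq> W"
    "\<And>k x j. norm x \<le> r \<Longrightarrow> inverse (real (Suc k)) < r \<Longrightarrow> x0 + x + axis j (of_real (inverse (real (Suc k)))) \<in> W"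
    "\<And>i j. uniform_limit (cball x0 r)
       (\<lambda>k x. of_nat (Suc k) * (F (x + axis j (of_real (inverse (real (Suc k))))) $ i - F x $ i))
       (\<lambda>x. jacobian F (at x) $ i $ j) sequentially"
proof -
  obtain R where R: "0 < R" "cball x0 R \<subseteq> W" using W x0 open_contains_cball by blast
  \<comment> \<open>the base point moves by \<open>r\<close>, the variable of the restriction \<open>g\<close> runs up to \<open>3 * r\<close>\<close>
  define r where "r = R / 4"
  have r: "0 < r" "R = 4 * r" using R(1) by (auto simp: r_def)
  have norm_axis: "norm (axis j z :: complex ^ 'n) \<le> norm z" for j z
    using norm_le_sum_components[of "axis j z :: complex ^ 'n"] by (simp add: axis_def if_distrib cong: if_cong)
  have in_ball: "x + axis j z \<in> cball x0 R" if "x \<in> cball x0 r" "norm z \<le> 3 * r" for x j z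
    using that norm_axis[of j z] norm_triangle_ineq[of "x - x0" "axis j z"]
    by (auto simp: dist_norm norm_minus_commute r(2) add_diff_eq diff_add_eq)
  have "compact (F ` cball x0 R)"
    using continuous_on_subset[OF continuous_on_complexified R(2)] by (intro compact_continuous_image) auto
  then obtain B where B: "\<And>x. x \<in> cball x0 R \<Longrightarrow> norm (F x) \<le> B"
    using compact_imp_bounded bounded_iff by (metis imageI)
  have quot: "norm (of_nat (Suc k) * (F (x + axis j (of_real (inverse (real (Suc k))))) $ i - F x $ i)
      - jacobian F (at x) $ i $ j) \<le> 2 * B / r\<^sup>2 * inverse (real (Suc k))"
    if x: "x \<in> cball x0 r" and k: "inverse (real (Suc k)) < r" for x i j k
  proof -
    define g where "g z = F (x + axis j z) $ i" for z
    have dg: "(g has_field_derivative jacobian F (at (x + axis j z)) $ i $ j) (at z)" if "norm z \<le> 3 * r" for z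
    proof -
      have "(g has_field_derivative (jacobian F (at (x + axis j z)) *v axis j 1) $ i) (at z)"
        unfolding g_def
      proof (rule has_field_derivative_compose_vec)
        show "(F has_derivative (*v) (jacobian F (at (x + axis j z)))) (at (x + axis j z))"
          using has_derivative_jacobian in_ball[OF x that] R(2) by blast
        show "((\<lambda>s. (x + axis j s) $ l) has_field_derivative axis j 1 $ l) (at z)" for l
          by (cases "l = j") (auto simp: axis_def intro!: derivative_eq_intros)
      qed
      then show ?thesis by (simp add: matrix_vector_mult_axis column_def)
    qed
    have hol: "g holomorphic_on ball 0 (3 * r)"
    proof (rule holomorphic_onI)
      fix z :: complex assume "z \<in> ball 0 (3 * r)"
      then have "norm z \<le> 3 * r" by simp
      from dg[OF this] show "g field_differentiable at z within ball 0 (3 * r)"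
        using field_differentiable_at_within field_differentiable_def by blast
    qed
    have S: "ball 0 r \<subseteq> ball (0 :: complex) (3 * r)" using r(1) by (intro subset_ball) simp
    define h :: complex where "h = of_real (inverse (real (Suc k)))"
    have nh: "norm h = inverse (real (Suc k))" by (simp add: h_def norm_inverse del: of_nat_Suc)
    have hk: "of_nat (Suc k) * h = 1" by (simp add: h_def field_simps del: of_nat_Suc)
    have "norm ((deriv ^^ 0) g h - (\<Sum>i\<le>1. (deriv ^^ i) g 0 * (h - 0) ^ i / fact i))
        \<le> 2 * B / r\<^sup>2 * norm (h - 0) ^ Suc 1 / fact 1"
    proof (rule complex_Taylor[of "ball 0 r" 1 "\<lambda>i. (deriv ^^ i) g"])
      show "((deriv ^^ n) g has_field_derivative (deriv ^^ Suc n) g z) (at z within ball 0 r)"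
        if "z \<in> ball 0 r" for n z
      proof -
        have "(deriv ^^ n) g holomorphic_on ball 0 (3 * r)"
          by (rule holomorphic_higher_deriv[OF hol]) simp
        then show ?thesis
          using that S holomorphic_derivI[of "(deriv ^^ n) g" "ball 0 (3 * r)" z] by auto
      qed
      show "norm ((deriv ^^ Suc 1) g z) \<le> 2 * B / r\<^sup>2" if "z \<in> ball 0 r" for z
      proof -
        have sub: "cball z r \<subseteq> ball 0 (3 * r)"
        proof
          fix w assume "w \<in> cball z r"
          then show "w \<in> ball 0 (3 * r)"
            using that norm_triangle_ineq[of z "w - z"] r(1) by (auto simp: dist_norm norm_minus_commute)
        qed
        have "norm ((deriv ^^ 2) g z) \<le> fact 2 * B / r ^ 2"
        proof (rule Cauchy_inequality)
          show "g holomorphic_on ball z r" using hol sub by (meson ball_subset_cball holomorphic_on_subset order_trans)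
          show "continuous_on (cball z r) g"
            using hol sub by (meson holomorphic_on_imp_continuous_on holomorphic_on_subset)
          fix w assume "norm (z - w) = r"
          then have "w \<in> ball 0 (3 * r)" using sub by (auto simp: dist_norm)
          then have "x + axis j w \<in> cball x0 R" by (intro in_ball x) simp
          then show "norm (g w) \<le> B"
            unfolding g_def using B Finite_Cartesian_Product.norm_nth_le order_trans by blast
        qed (use r in auto)
        then show ?thesis by (simp add: numeral_2_eq_2)
      qed
    qed (use k r nh in auto)
    moreover have "deriv g 0 = jacobian F (at x) $ i $ j"
      using DERIV_imp_deriv[OF dg[of 0]] r by (simp add: axis_def vec_eq_iff flip: zero_vec_def)
    moreover have "axis j 0 = (0 :: complex ^ 'n)" by (simp add: axis_def vec_eq_iff)
    ultimately have "norm (g h - g 0 - jacobian F (at x) $ i $ j * h) \<le> 2 * B / r\<^sup>2 * (inverse (real (Suc k)))\<^sup>2"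
      by (simp add: diff_diff_eq power2_eq_square nh)
    then have "real (Suc k) * norm (g h - g 0 - jacobian F (at x) $ i $ j * h)
        \<le> real (Suc k) * (2 * B / r\<^sup>2 * (inverse (real (Suc k)))\<^sup>2)"
      by (intro mult_left_mono) auto
    also have "real (Suc k) * norm (g h - g 0 - jacobian F (at x) $ i $ j * h)
       = norm (of_nat (Suc k) * (g h - g 0 - jacobian F (at x) $ i $ j * h))"
      by (simp only: norm_mult norm_of_nat)
    also have "of_nat (Suc k) * (g h - g 0 - jacobian F (at x) $ i $ j * h)
       = of_nat (Suc k) * (g h - g 0) - jacobian F (at x) $ i $ j"
      using hk by (simp add: right_diff_distrib mult.left_commute[of _ _ h] mult.commute[of _ h] del: of_nat_Suc)
    also have "real (Suc k) * (2 * B / r\<^sup>2 * (inverse (real (Suc k)))\<^sup>2) = 2 * B / r\<^sup>2 * inverse (real (Suc k))"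
      by (simp add: power2_eq_square del: of_nat_Suc)
    finally show ?thesis using \<open>axis j 0 = 0\<close> by (simp add: g_def h_def del: of_nat_Suc)
  qed
  have "uniform_limit (cball x0 r)
       (\<lambda>k x. of_nat (Suc k) * (F (x + axis j (of_real (inverse (real (Suc k))))) $ i - F x $ i))
       (\<lambda>x. jacobian F (at x) $ i $ j) sequentially" for i j
  proof (rule uniform_limitI)
    fix e :: real assume e: "0 < e"
    have "(\<lambda>k. 2 * B / r\<^sup>2 * inverse (real (Suc k))) \<longlonglongrightarrow> 2 * B / r\<^sup>2 * 0"
      by (intro tendsto_mult tendsto_const LIMSEQ_inverse_real_of_nat)
    then have "\<forall>\<^sub>F k in sequentially. 2 * B / r\<^sup>2 * inverse (real (Suc k)) < e"
      using e by (intro order_tendstoD(2)) auto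
    moreover have "\<forall>\<^sub>F k in sequentially. inverse (real (Suc k)) < r"
      using r(1) by (intro order_tendstoD(2)[OF LIMSEQ_inverse_real_of_nat]) auto
    ultimately show "\<forall>\<^sub>F k in sequentially. \<forall>x\<in>cball x0 r.
        dist (of_nat (Suc k) * (F (x + axis j (of_real (inverse (real (Suc k))))) $ i - F x $ i))
          (jacobian F (at x) $ i $ j) < e"
    proof eventually_elim
      case (elim k)
      show ?case unfolding dist_norm by (intro ballI le_less_trans[OF quot elim(1)] elim(2))
    qed
  qed
  moreover have "x0 + x + axis j (of_real (inverse (real (Suc k)))) \<in> W"
    if "norm x \<le> r" "inverse (real (Suc k)) < r" for k x j
  proof -
    have "norm (of_real (inverse (real (Suc k))) :: complex) \<le> 3 * r"
      unfolding norm_of_real using that(2) r(1) by simp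
    moreover have "x0 + x \<in> cball x0 r" using that(1) by (simp add: dist_norm)
    ultimately show ?thesis using in_ball R(2) by blast
  qed
  moreover have "cball x0 r \<subseteq> cball x0 R" using r by (intro subset_cball) simp
  then have "cball x0 r \<subseteq> W" using R(2) by blast
  ultimately show ?thesis using that r(1) by blast
qed

lemma jacobian_continuous_on: "continuous_on W (\<lambda>x. jacobian F (at x) $ i $ j)"
proof (rule continuous_at_imp_continuous_on, rule ballI)
  fix x0 assume "x0 \<in> W"
  then obtain r where r: "0 < r" "cball x0 r \<subseteq> W"
    "\<And>k x j. norm x \<le> r \<Longrightarrow> inverse (real (Suc k)) < r \<Longrightarrow> x0 + x + axis j (of_real (inverse (real (Suc k)))) \<in> W"
    "\<And>i j. uniform_limit (cball x0 r)
       (\<lambda>k x. of_nat (Suc k) * (F (x + axis j (of_real (inverse (real (Suc k))))) $ i - F x $ i))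
       (\<lambda>x. jacobian F (at x) $ i $ j) sequentially"
    using difference_quotient_uniform by blast
  have "continuous_on (cball x0 r) (\<lambda>x. jacobian F (at x) $ i $ j)"
  proof (rule uniform_limit_theorem[OF _ r(4)])
    have "\<forall>\<^sub>F k in sequentially. inverse (real (Suc k)) < r"
      using r(1) by (intro order_tendstoD(2)[OF LIMSEQ_inverse_real_of_nat]) auto
    then show "\<forall>\<^sub>F k in sequentially. continuous_on (cball x0 r)
       (\<lambda>x. of_nat (Suc k) * (F (x + axis j (of_real (inverse (real (Suc k))))) $ i - F x $ i))"
    proof eventually_elim
      case (elim k)
      have "x + axis j (of_real (inverse (real (Suc k)))) \<in> W" if "x \<in> cball x0 r" for x
        using r(3)[of "x - x0" k j] elim that by (simp add: dist_norm norm_minus_commute del: of_nat_Suc)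
      then show ?case using r(2)
        by (intro continuous_intros continuous_on_compose2[OF continuous_on_complexified]) auto
    qed
  qed simp
  then have "continuous_on (ball x0 r) (\<lambda>x. jacobian F (at x) $ i $ j)"
    by (rule continuous_on_subset) auto
  then show "isCont (\<lambda>x. jacobian F (at x) $ i $ j) x0"
    using r(1) by (simp add: continuous_on_eq_continuous_at)
qed

lemma jacobian_along_holomorphic:
  assumes Om: "open \<Omega>" and Y: "vec_holomorphic_on Y \<Omega>" "Y ` \<Omega> \<subseteq> W"
  shows "(\<lambda>t. jacobian F (at (Y t)) $ i $ j) holomorphic_on \<Omega>"
proof (rule holomorphic_onI)
  fix t0 assume t0: "t0 \<in> \<Omega>"
  have Yi: "(\<lambda>s. Y s $ i) holomorphic_on \<Omega>" for i using Y(1) by (simp add: vec_holomorphic_on_def)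
  then have dY: "((\<lambda>s. Y s $ i) has_field_derivative (\<chi> i. deriv (\<lambda>s. Y s $ i) t) $ i) (at t)" if "t \<in> \<Omega>" for t i
    using holomorphic_derivI[OF _ Om that] by simp
  have "isCont Y t0"
  proof -
    have "isCont (\<lambda>s. Y s $ i) t0" for i using dY[OF t0] DERIV_isCont by blast
    then show ?thesis unfolding isCont_def by (rule vec_tendstoI)
  qed
  have "Y t0 \<in> W" using t0 Y(2) by auto
  then obtain r where r: "0 < r" "cball (Y t0) r \<subseteq> W"
    "\<And>k x j. norm x \<le> r \<Longrightarrow> inverse (real (Suc k)) < r \<Longrightarrow> Y t0 + x + axis j (of_real (inverse (real (Suc k)))) \<in> W"
    "\<And>i j. uniform_limit (cball (Y t0) r)
       (\<lambda>k x. of_nat (Suc k) * (F (x + axis j (of_real (inverse (real (Suc k))))) $ i - F x $ i))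
       (\<lambda>x. jacobian F (at x) $ i $ j) sequentially"
    using difference_quotient_uniform by blast
  have "\<forall>\<^sub>F t in at t0. dist (Y t) (Y t0) < r"
    using \<open>isCont Y t0\<close> r(1) unfolding isCont_def by (rule tendstoD)
  then obtain d1 where d1: "0 < d1" "\<And>t. dist t t0 < d1 \<Longrightarrow> dist (Y t) (Y t0) < r"
    using r(1) unfolding eventually_at by (metis UNIV_I dist_self)
  obtain d2 where d2: "0 < d2" "cball t0 d2 \<subseteq> \<Omega>" using Om t0 open_contains_cball by blast
  define d where "d = min (d1 / 2) d2"
  have d: "0 < d" "cball t0 d \<subseteq> \<Omega>" "\<And>t. t \<in> cball t0 d \<Longrightarrow> Y t \<in> cball (Y t0) r"
    using d1 d2 by (auto simp: d_def dist_commute subset_iff intro!: less_imp_le d1(2))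
  have "\<forall>\<^sub>F k in sequentially. inverse (real (Suc k)) < r"
    using r(1) by (intro order_tendstoD(2)[OF LIMSEQ_inverse_real_of_nat]) auto
  then have ev: "\<forall>\<^sub>F k in sequentially. continuous_on (cball t0 d) (\<lambda>t. of_nat (Suc k) * (F (Y t + axis j (of_real (inverse (real (Suc k))))) $ i - F (Y t) $ i))
      \<and> (\<lambda>t. of_nat (Suc k) * (F (Y t + axis j (of_real (inverse (real (Suc k))))) $ i - F (Y t) $ i)) holomorphic_on ball t0 d"
  proof eventually_elim
    case (elim k)
    let ?a = "axis j (of_real (inverse (real (Suc k)))) :: complex ^ 'n"
    let ?g = "\<lambda>t. of_nat (Suc k) * (F (Y t + ?a) $ i - F (Y t) $ i)"
    have "?g field_differentiable (at t)" if "t \<in> cball t0 d" for t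
    proof -
      have "Y t + ?a \<in> W"
        using r(3)[of "Y t - Y t0" k j] elim d(3)[OF that] by (simp add: dist_norm norm_minus_commute del: of_nat_Suc)
      then have 1: "(F has_derivative (*v) (jacobian F (at (Y t + ?a)))) (at (Y t + ?a))"
        by (rule has_derivative_jacobian)
      have 2: "(F has_derivative (*v) (jacobian F (at (Y t)))) (at (Y t))"
        using d(3)[OF that] r(2) by (intro has_derivative_jacobian) auto
      have 3: "((\<lambda>s. (Y s + ?a) $ l) has_field_derivative (\<chi> i. deriv (\<lambda>s. Y s $ i) t) $ l) (at t)" for l
        using dY[of t l] d(2) that by (auto intro!: derivative_eq_intros)
      have 4: "((\<lambda>s. Y s $ l) has_field_derivative (\<chi> i. deriv (\<lambda>s. Y s $ i) t) $ l) (at t)" for l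
        using dY[of t l] d(2) that by auto
      show ?thesis
        using DERIV_cmult[OF DERIV_diff[OF has_field_derivative_compose_vec[OF 1 3] has_field_derivative_compose_vec[OF 2 4]]]
        unfolding field_differentiable_def by blast
    qed
    then show ?case
      by (auto simp: holomorphic_on_def field_differentiable_at_within
          intro!: continuous_at_imp_continuous_on field_differentiable_imp_continuous_at)
  qed
  have "uniform_limit (cball t0 d)
       (\<lambda>k t. of_nat (Suc k) * (F (Y t + axis j (of_real (inverse (real (Suc k))))) $ i - F (Y t) $ i))
       (\<lambda>t. jacobian F (at (Y t)) $ i $ j) sequentially"
    using r(4)[of j i] d(3) unfolding uniform_limit_iff by (auto elim!: eventually_mono)
  from holomorphic_uniform_limit[OF ev this] have "(\<lambda>t. jacobian F (at (Y t)) $ i $ j) holomorphic_on ball t0 d"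
    by auto
  then show "(\<lambda>t. jacobian F (at (Y t)) $ i $ j) field_differentiable at t0 within \<Omega>"
    using d(1) by (meson centre_in_ball field_differentiable_at_within holomorphic_on_imp_differentiable_at open_ball)
qed

end

text \<open>The derivative of the complexification is real on real vectors because its values on real points
  are, and so it restricts to the derivative of the real map.\<close>

lemma complexification_jacobian:
  fixes g :: "real ^ 'n \<Rightarrow> real ^ 'n"
  assumes "complexification g F W"
  shows "(g has_derivative (\<lambda>h. jacobian g (at x) *v h)) (at x)"
    and "jacobian F (at (cvec x)) = map_matrix complex_of_real (jacobian g (at x))"
proof -
  have W: "cvec x \<in> W" and Fg: "\<And>x. F (cvec x) = cvec (g x)"
    using assms by (auto simp: complexification_def)
  have "\<exists>J. (F has_derivative (\<lambda>h. J *v h)) (at (cvec x))"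
    using assms W by (auto simp: complexification_def)
  then obtain J :: "complex ^ 'n ^ 'n" where J: "(F has_derivative (\<lambda>h. J *v h)) (at (cvec x))" by blast
  have "(cvec has_derivative cvec) (at x)"
    by (intro has_derivative_vecI)
       (auto simp: cvec_def intro!: derivative_eq_intros bounded_linear.has_derivative[OF bounded_linear_vec_nth])
  from diff_chain_at[OF this J] have d: "((\<lambda>x. cvec (g x)) has_derivative (\<lambda>h. J *v cvec h)) (at x)"
    by (simp add: o_def Fg)
  then have di: "((\<lambda>x. complex_of_real (g x $ i)) has_derivative (\<lambda>h. (J *v cvec h) $ i)) (at x)" for i
    using bounded_linear.has_derivative[OF bounded_linear_vec_nth d, of i] by (simp add: cvec_def)
  have im: "Im ((J *v cvec h) $ i) = 0" for h i
  proof -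
    have "((\<lambda>x. 0 :: real) has_derivative (\<lambda>h. Im ((J *v cvec h) $ i))) (at x)"
      using bounded_linear.has_derivative[OF bounded_linear_Im di[of i]] by simp
    moreover have "((\<lambda>x. 0 :: real) has_derivative (\<lambda>h. 0)) (at x)" by (rule has_derivative_const)
    ultimately have "(\<lambda>h. Im ((J *v cvec h) $ i)) = (\<lambda>h. 0)" by (rule has_derivative_unique)
    then show ?thesis by (rule fun_cong)
  qed
  define G :: "real ^ 'n ^ 'n" where "G = (\<chi> i j. Re (J $ i $ j))"
  have JG: "J $ i $ j = of_real (G $ i $ j)" for i j
  proof -
    have "J *v cvec (axis j 1) = column j J"
    proof -
      have "cvec (axis j 1) = axis j 1" by (simp add: cvec_def axis_def vec_eq_iff)
      then show ?thesis by (simp add: matrix_vector_mult_axis)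
    qed
    then have "Im (J $ i $ j) = 0" using im[of "axis j 1" i] by (simp add: column_def)
    then show ?thesis by (simp add: G_def complex_eq_iff)
  qed
  have Jc: "J *v cvec h = cvec (G *v h)" for h
    by (simp add: vec_eq_iff matrix_vector_mult_def cvec_def JG)
  have "((\<lambda>x. g x $ i) has_derivative (\<lambda>h. (G *v h) $ i)) (at x)" for i
    using bounded_linear.has_derivative[OF bounded_linear_Re di[of i]]
    unfolding Jc by (simp add: cvec_def)
  then have dg: "(g has_derivative (\<lambda>h. G *v h)) (at x)" by (rule has_derivative_vecI)
  have gG: "jacobian g (at x) = G"
    unfolding jacobian_def frechet_derivative_at[OF dg, symmetric] by simp
  show "(g has_derivative (\<lambda>h. jacobian g (at x) *v h)) (at x)" unfolding gG by (rule dg)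
  show "jacobian F (at (cvec x)) = map_matrix complex_of_real (jacobian g (at x))"
    unfolding gG jacobian_eqI[OF J] by (simp add: vec_eq_iff JG)
qed

section \<open>Semi-invariant functions at an end of the orbit\<close>

text \<open>The set \<open>0 < norm z < r\<close> in the coordinate \<open>z = exp (l * t)\<close>, seen in the time coordinate. The sign
  of \<open>l\<close> tells the end: \<open>l < 0\<close> belongs to \<open>Re t \<rightarrow> \<infinity>\<close> and \<open>l > 0\<close> to \<open>Re t \<rightarrow> -\<infinity>\<close>, so that both ends are
  treated at once. The strip leaves room for two turns in either direction: besides the values of the
  principal logarithm it contains their translates by one period, which are needed to continue the
  logarithm across its cut.\<close>

definition end_strip :: "real \<Rightarrow> real \<Rightarrow> complex set" where
  "end_strip l r = {t. norm (exp (of_real l * t)) < r \<and> \<bar>l * Im t\<bar> < 4 * pi}"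

abbreviation end_period :: "real \<Rightarrow> complex" where
  "end_period l \<equiv> 2 * of_real pi * \<i> / of_real l"

lemma open_end_strip: "open (end_strip l r)"
proof -
  have "open {t :: complex. norm (exp (of_real l * t)) < r}" "open {t. \<bar>l * Im t\<bar> < 4 * pi}"
    by (intro open_Collect_less continuous_intros)+
  then show ?thesis by (simp add: end_strip_def Collect_conj_eq open_Int)
qed

lemma end_strip_iff: "0 < r \<Longrightarrow> t \<in> end_strip l r \<longleftrightarrow> l * Re t < ln r \<and> \<bar>l * Im t\<bar> < 4 * pi"
  using exp_less_cancel_iff[of "l * Re t" "ln r"] by (simp add: end_strip_def)

lemma convex_end_strip: "convex (end_strip l r)"
proof (cases "0 < r")
  case True
  have "end_strip l r = {t. l * Re t < ln r} \<inter> ({t. l * Im t < 4 * pi} \<inter> {t. - (4 * pi) < l * Im t})"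
    using end_strip_iff[OF True] by (auto simp: abs_less_iff)
  moreover have "{t. l * Re t < ln r} = {t. of_real l \<bullet> t < ln r}"
    "{t. l * Im t < 4 * pi} = {t. (of_real l * \<i>) \<bullet> t < 4 * pi}"
    "{t. - (4 * pi) < l * Im t} = {t. (of_real l * \<i>) \<bullet> t > - (4 * pi)}"
    by (auto simp: inner_complex_def)
  ultimately show ?thesis
    by (simp only: convex_Int convex_halfspace_lt convex_halfspace_gt)
next
  case False
  then have "\<not> norm w < r" for w :: complex using norm_ge_zero[of w] by linarith
  then have "end_strip l r = {}" by (simp add: end_strip_def del: norm_exp_eq_Re)
  then show ?thesis by simp
qed

lemma exp_end_period: "l \<noteq> 0 \<Longrightarrow> exp (of_real l * (t + end_period l)) = exp (of_real l * t)"
  using exp_two_pi_i by (simp add: distrib_left exp_add)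

lemma end_strip_add_period:
  assumes "l \<noteq> 0"
  shows "t + end_period l \<in> end_strip l r \<longleftrightarrow> norm (exp (of_real l * t)) < r \<and> \<bar>l * Im t + 2 * pi\<bar> < 4 * pi"
  using exp_end_period[OF assms, of t] assms
  by (simp add: end_strip_def distrib_left)

text \<open>Exponential growth in \<open>t\<close> is growth like a power of \<open>1 / z\<close> at the end.\<close>

definition moderate_growth :: "complex set \<Rightarrow> (complex \<Rightarrow> complex) \<Rightarrow> bool" where
  "moderate_growth E f \<longleftrightarrow> (\<exists>C\<ge>0. \<exists>K\<ge>0. \<forall>t\<in>E. norm (f t) \<le> C * exp (K * norm t))"

lemma moderate_growth_const: "moderate_growth E (\<lambda>_. c)"
  unfolding moderate_growth_def by (intro exI[of _ "norm c"] conjI exI[of _ 0]) auto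

lemma moderate_growth_add:
  assumes "moderate_growth E f" "moderate_growth E g"
  shows "moderate_growth E (\<lambda>t. f t + g t)"
proof -
  obtain C K C' K' where *: "0 \<le> C" "0 \<le> K" "0 \<le> C'" "0 \<le> K'"
    "\<And>t. t \<in> E \<Longrightarrow> norm (f t) \<le> C * exp (K * norm t)" "\<And>t. t \<in> E \<Longrightarrow> norm (g t) \<le> C' * exp (K' * norm t)"
    using assms unfolding moderate_growth_def by metis
  have "norm (f t + g t) \<le> (C + C') * exp ((K + K') * norm t)" if t: "t \<in> E" for t
  proof -
    have "norm (f t) \<le> C * exp ((K + K') * norm t)"
      using *(5)[OF t] * by (elim order_trans) (auto intro!: mult_left_mono mult_right_mono)
    moreover have "norm (g t) \<le> C' * exp ((K + K') * norm t)"
      using *(6)[OF t] * by (elim order_trans) (auto intro!: mult_left_mono mult_right_mono)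
    ultimately show ?thesis using norm_triangle_ineq[of "f t" "g t"] by (simp add: distrib_right)
  qed
  then show ?thesis unfolding moderate_growth_def using * by (meson add_nonneg_nonneg)
qed

lemma moderate_growth_mult:
  assumes "moderate_growth E f" "moderate_growth E g"
  shows "moderate_growth E (\<lambda>t. f t * g t)"
proof -
  obtain C K C' K' where *: "0 \<le> C" "0 \<le> K" "0 \<le> C'" "0 \<le> K'"
    "\<And>t. t \<in> E \<Longrightarrow> norm (f t) \<le> C * exp (K * norm t)" "\<And>t. t \<in> E \<Longrightarrow> norm (g t) \<le> C' * exp (K' * norm t)"
    using assms unfolding moderate_growth_def by metis
  have "norm (f t * g t) \<le> (C * C') * exp ((K + K') * norm t)" if t: "t \<in> E" for t
  proof -
    have "exp ((K + K') * norm t) = exp (K * norm t) * exp (K' * norm t)" by (simp add: distrib_right exp_add)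
    then show ?thesis using mult_mono[OF *(5)[OF t] *(6)[OF t]] * by (simp add: norm_mult mult_ac)
  qed
  then show ?thesis unfolding moderate_growth_def using *(1-4)
    by (intro exI[of _ "C * C'"] conjI exI[of _ "K + K'"]) auto
qed

lemma moderate_growth_sum: "(\<And>i. i \<in> I \<Longrightarrow> moderate_growth E (f i)) \<Longrightarrow> moderate_growth E (\<lambda>t. \<Sum>i\<in>I. f i t)"
  by (induction I rule: infinite_finite_induct) (auto intro: moderate_growth_const moderate_growth_add)

lemma moderate_growth_prod: "(\<And>i. i \<in> I \<Longrightarrow> moderate_growth E (f i)) \<Longrightarrow> moderate_growth E (\<lambda>t. \<Prod>i\<in>I. f i t)"
  by (induction I rule: infinite_finite_induct) (auto intro: moderate_growth_const moderate_growth_mult)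

lemma moderate_growth_det:
  "(\<And>i j. moderate_growth E (\<lambda>t. N t $ i $ j)) \<Longrightarrow> moderate_growth E (\<lambda>t. det (N t))"
  unfolding det_def by (intro moderate_growth_sum moderate_growth_mult moderate_growth_const moderate_growth_prod) auto

text \<open>Multiplication with \<open>exp (- c * t)\<close> makes \<open>n\<close> periodic, hence a function of \<open>z\<close> that is holomorphic
  off \<open>0\<close>; across the cut of the principal logarithm it continues because of the periodicity. Moderate
  growth bounds it by a power of \<open>1 / z\<close>, so the singularity at \<open>0\<close> is not essential.\<close>

lemma semi_invariant_meromorphic:
  fixes n :: "complex \<Rightarrow> complex"
  assumes l: "l \<noteq> 0" and r: "0 < r" "r \<le> 1"
    and hol: "n holomorphic_on end_strip l r"
    and semi: "\<And>t. t \<in> end_strip l r \<Longrightarrow> t + end_period l \<in> end_strip l r \<Longrightarrow>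
                 n (t + end_period l) = exp (c * end_period l) * n t"
    and growth: "moderate_growth (end_strip l r) n"
  shows "(\<lambda>z. exp (- (c * (Ln z / of_real l))) * n (Ln z / of_real l)) meromorphic_on ball 0 r"
proof -
  define p where "p t = exp (- (c * t)) * n t" for t
  define q where "q z = p (Ln z / of_real l)" for z
  have p_hol: "p holomorphic_on end_strip l r"
    unfolding p_def by (intro holomorphic_intros hol)
  have p_per: "p (t + end_period l) = p t" if "t \<in> end_strip l r" "t + end_period l \<in> end_strip l r" for t
  proof -
    have "exp (- (c * (t + T))) * (exp (c * T) * x) = exp (- (c * t)) * x" for T x
      by (simp add: algebra_simps exp_add exp_diff exp_minus divide_inverse)
    then show ?thesis unfolding p_def semi[OF that] .
  qed
  have p_eq: "p s = p t"
    if st: "s \<in> end_strip l r" "t \<in> end_strip l r" "exp (of_real l * s) = exp (of_real l * t)"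
      and im: "\<bar>l * Im s - l * Im t\<bar> < 4 * pi" for s t
  proof -
    obtain k :: int where k: "of_real l * s = of_real l * t + (of_int (2 * k) * of_real pi) * \<i>"
      using st(3) by (auto simp: exp_eq)
    then have "Im (of_real l * s) = Im (of_real l * t + (of_int (2 * k) * of_real pi) * \<i>)" by simp
    then have "l * Im s - l * Im t = 2 * of_int k * pi" by simp
    then have "\<bar>of_int k\<bar> * (2 * pi) < 2 * (2 * pi)" using im by (simp add: abs_mult)
    then have "\<bar>of_int k :: real\<bar> < 2" by (rule mult_right_less_imp_less) simp
    then have "k = - 1 \<or> k = 0 \<or> k = 1" by linarith
    moreover have s: "s = t + of_int k * end_period l"
      using k l by (simp add: field_simps)
    ultimately consider "s = t" | "s = t + end_period l" | "t = s + end_period l" by fastforce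
    then show ?thesis using p_per st(1,2) by cases auto
  qed
  have Ln_strip: "Ln z / of_real l \<in> end_strip l r" if "z \<noteq> 0" "norm z < r" for z
    using that l Im_Ln_le_pi[of z] mpi_less_Im_Ln[of z] by (auto simp: end_strip_def abs_if)
  have q_hol: "q field_differentiable at w" if w: "w \<noteq> 0" "norm w < r" for w
  proof -
    \<comment> \<open>\<open>L\<close> is a holomorphic branch of the logarithm near \<open>w\<close>, divided by \<open>l\<close>; it may differ by one period
      from the principal branch\<close>
    define B where "B = ball w (norm w) \<inter> ball 0 r"
    define L where "L z = (Ln (z / w) + Ln w) / of_real l" for z
    have B: "open B" "w \<in> B" using w by (auto simp: B_def)
    have Bz: "z \<noteq> 0" "Re (z / w) > 0" "norm z < r" if "z \<in> B" for z
    proof -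
      have "norm (1 - z / w) < 1"
        using that w(1) by (simp add: B_def dist_norm norm_divide divide_simps flip: diff_divide_distrib)
      then have "Re (1 - z / w) < 1" using complex_Re_le_cmod le_less_trans by blast
      then show "Re (z / w) > 0" by simp
      then show "z \<noteq> 0" by auto
      show "norm z < r" using that by (simp add: B_def)
    qed
    have expL: "exp (of_real l * L z) = z" if "z \<in> B" for z
      using Bz[OF that] w l by (simp add: L_def exp_add)
    have ImL: "\<bar>l * Im (L z)\<bar> < 3 * pi / 2 + pi" if "z \<in> B" for z
    proof -
      have "\<bar>Im (Ln (z / w))\<bar> < pi / 2"
        using Bz[OF that] w(1) by (subst Re_Ln_pos_lt) auto
      then show ?thesis
        using l Im_Ln_le_pi[OF w(1)] mpi_less_Im_Ln[OF w(1)] by (simp add: L_def abs_if split: if_splits)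
    qed
    have L_strip: "L z \<in> end_strip l r" if "z \<in> B" for z
      unfolding end_strip_def mem_Collect_eq expL[OF that] using Bz(3)[OF that] ImL[OF that] pi_gt_zero by simp
    have "L holomorphic_on B"
      unfolding L_def
    proof (intro holomorphic_intros)
      show "z / w \<notin> \<real>\<^sub>\<le>\<^sub>0" if "z \<in> B" for z
        using Bz(2)[OF that] by (auto simp: complex_nonpos_Reals_iff)
    qed (use l w in auto)
    then have "(p \<circ> L) holomorphic_on B"
      using p_hol L_strip by (intro holomorphic_on_compose_gen[where t = "end_strip l r"]) auto
    moreover have "q z = (p \<circ> L) z" if "z \<in> B" for z
      unfolding q_def o_def
    proof (rule p_eq)
      show "Ln z / of_real l \<in> end_strip l r" using Ln_strip Bz[OF that] by blast
      show "exp (of_real l * (Ln z / of_real l)) = exp (of_real l * L z)"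
        using Bz(1)[OF that] l expL[OF that] by simp
      have "\<bar>l * Im (Ln z / of_real l)\<bar> \<le> pi"
        using l Im_Ln_le_pi[OF Bz(1)[OF that]] mpi_less_Im_Ln[OF Bz(1)[OF that]] by (simp add: abs_if)
      then show "\<bar>l * Im (Ln z / of_real l) - l * Im (L z)\<bar> < 4 * pi"
        using ImL[OF that] pi_gt_zero by (simp add: abs_if split: if_splits)
    qed (rule L_strip[OF that])
    ultimately have "q holomorphic_on B" by (simp cong: holomorphic_cong)
    then show ?thesis using B holomorphic_on_imp_differentiable_at by blast
  qed
  then have q_hol': "q holomorphic_on ball 0 r - {0}"
    by (auto simp: holomorphic_on_def intro: field_differentiable_at_within)
  have "moderate_growth (end_strip l r) p"
  proof -
    have "moderate_growth (end_strip l r) (\<lambda>t. exp (- (c * t)))"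
    proof -
      have "norm (exp (- (c * t))) \<le> 1 * exp (norm c * norm t)" for t
        using norm_exp[of "- (c * t)"] by (simp only: norm_minus_cancel norm_mult mult_1)
      then show ?thesis unfolding moderate_growth_def by (metis norm_ge_zero zero_le_one)
    qed
    then show ?thesis unfolding p_def using growth by (rule moderate_growth_mult)
  qed
  then obtain C K where CK: "0 \<le> C" "0 \<le> K" "\<And>t. t \<in> end_strip l r \<Longrightarrow> norm (p t) \<le> C * exp (K * norm t)"
    unfolding moderate_growth_def by blast
  \<comment> \<open>\<open>norm t\<close> is at most \<open>- ln (norm z) / \<bar>l\<bar>\<close> up to a constant\<close>
  define N where "N = nat \<lceil>K / \<bar>l\<bar>\<rceil>"
  define C' where "C' = C * exp (K * (pi / \<bar>l\<bar>))"
  have q_bound: "norm (q z * z ^ N) \<le> C'" if z: "z \<noteq> 0" "norm z < r" for z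
  proof -
    have z1: "ln (norm z) \<le> 0" using z r by simp
    have "norm (Ln z) \<le> \<bar>Re (Ln z)\<bar> + \<bar>Im (Ln z)\<bar>" by (rule cmod_le)
    also have "\<dots> \<le> - ln (norm z) + pi"
      using z z1 Im_Ln_le_pi[of z] mpi_less_Im_Ln[of z] by (auto simp: abs_if)
    finally have "K * norm (Ln z / of_real l) \<le> K * ((- ln (norm z) + pi) / \<bar>l\<bar>)"
      using CK(2) by (intro mult_left_mono) (auto simp: norm_divide intro: divide_right_mono)
    also have "\<dots> = (K / \<bar>l\<bar>) * (- ln (norm z)) + K * (pi / \<bar>l\<bar>)"
      by (simp add: add_divide_distrib diff_divide_distrib algebra_simps)
    also have "\<dots> \<le> real N * (- ln (norm z)) + K * (pi / \<bar>l\<bar>)"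
    proof -
      have "K / \<bar>l\<bar> \<le> real N" unfolding N_def by linarith
      then show ?thesis using z1 by (intro add_right_mono mult_right_mono) auto
    qed
    finally have "exp (K * norm (Ln z / of_real l)) \<le> exp (real N * (- ln (norm z)) + K * (pi / \<bar>l\<bar>))"
      by simp
    also have "\<dots> = inverse (norm z ^ N) * exp (K * (pi / \<bar>l\<bar>))"
      using z by (simp add: exp_diff exp_of_nat_mult divide_inverse)
    finally have "C * exp (K * norm (Ln z / of_real l)) \<le> C * (inverse (norm z ^ N) * exp (K * (pi / \<bar>l\<bar>)))"
      using CK(1) by (rule mult_left_mono)
    then have "norm (q z) \<le> C' * inverse (norm z ^ N)"
      using CK(3)[OF Ln_strip[OF z]] by (simp add: q_def C'_def mult_ac)
    then have "norm (q z) * norm z ^ N \<le> C' * inverse (norm z ^ N) * norm z ^ N"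
      by (intro mult_right_mono) auto
    also have "\<dots> = C'" using z(1) by simp
    finally show ?thesis by (simp add: norm_mult norm_power)
  qed
  define g where "g z = q z * z ^ Suc N" for z
  have "(g \<longlongrightarrow> 0) (at 0)"
  proof (rule Lim_null_comparison)
    have "\<forall>\<^sub>F z in at 0. z \<in> ball 0 r - {0}"
      using r by (intro eventually_at_in_open) auto
    then show "\<forall>\<^sub>F z in at 0. norm (g z) \<le> C' * norm z"
    proof eventually_elim
      case (elim z)
      then have "norm (q z * z ^ N) * norm z \<le> C' * norm z" by (intro mult_right_mono q_bound) auto
      then show ?case by (simp add: g_def norm_mult norm_power mult_ac)
    qed
    show "((\<lambda>z. C' * norm z) \<longlongrightarrow> 0) (at 0)" by (auto intro!: tendsto_eq_intros)
  qed
  then have "not_essential g 0" by (auto simp: not_essential_def)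
  moreover have "g holomorphic_on ball 0 r - {0}" unfolding g_def by (intro holomorphic_intros q_hol')
  then have "isolated_singularity_at g 0"
    using r(1) by (intro isolated_singularity_at_holomorphic[where s = "ball 0 r"]) auto
  ultimately have "g meromorphic_on {0}" by (simp add: meromorphic_at_iff)
  then have "(\<lambda>z. g z / z ^ Suc N) meromorphic_on {0}" by (intro meromorphic_intros)
  moreover have "\<forall>\<^sub>F z in at 0. g z / z ^ Suc N = q z"
    unfolding eventually_at_filter g_def by auto
  ultimately have q0: "q meromorphic_on {0}"
    using meromorphic_on_cong[of "{0}" "\<lambda>z. g z / z ^ Suc N" q "{0}"] by simp
  have "q analytic_on ball 0 r - {0}"
    using q_hol' by (subst analytic_on_open) auto
  then have "q meromorphic_on (ball 0 r - {0}) \<union> {0}"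
    by (intro meromorphic_on_Un[OF analytic_on_imp_meromorphic_on q0])
  then have "q meromorphic_on ball 0 r" by (rule meromorphic_on_subset) auto
  then show ?thesis unfolding q_def[abs_def] p_def .
qed

section \<open>Meromorphic functions on the surface\<close>

text \<open>A function of the time coordinate as a family of functions of the chart coordinates; at the ends
  it is single-valued only under a periodicity assumption, and the principal branch is chosen.\<close>

definition surface_function :: "real \<Rightarrow> real \<Rightarrow> (complex \<Rightarrow> complex) \<Rightarrow> chart \<Rightarrow> complex \<Rightarrow> complex" where
  "surface_function lm lp G c z =
     (case c of Neg \<Rightarrow> G (Ln z / of_real lp) | Mid \<Rightarrow> G z | Pos \<Rightarrow> G (Ln z / of_real lm))"

lemma gamma_loc_open: "gamma_loc lm lp e \<Sigma> \<Longrightarrow> open (\<Sigma> c)"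
  by (cases c) (auto simp: gamma_loc_def)

lemma gamma_loc_connected: "gamma_loc lm lp e \<Sigma> \<Longrightarrow> connected (\<Sigma> c)"
  by (cases c) (auto simp: gamma_loc_def simply_connected_imp_connected)

lemma open_overlap:
  assumes "gamma_loc lm lp e \<Sigma>"
  shows "open (overlap_pos lm \<Sigma>)" "open (overlap_neg lp \<Sigma>)"
proof -
  have *: "open ((\<lambda>t. exp (of_real l * t)) -` \<Sigma> c)" for l c
    using gamma_loc_open[OF assms] by (intro open_vimage continuous_intros)
  have "open {t. 0 < Re t}" "open {t. Re t < 0}" by (intro open_Collect_less continuous_intros)+
  moreover have "overlap_pos lm \<Sigma> = \<Sigma> Mid \<inter> {t. 0 < Re t} \<inter> (\<lambda>t. exp (of_real lm * t)) -` \<Sigma> Pos"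
    "overlap_neg lp \<Sigma> = \<Sigma> Mid \<inter> {t. Re t < 0} \<inter> (\<lambda>t. exp (of_real lp * t)) -` \<Sigma> Neg"
    by (auto simp: overlap_pos_def overlap_neg_def)
  ultimately show "open (overlap_pos lm \<Sigma>)" "open (overlap_neg lp \<Sigma>)"
    using * gamma_loc_open[OF assms, of Mid] by (simp_all only: open_Int)
qed

text \<open>Where the middle part overlaps with an end it is so narrow that the principal logarithm recovers
  \<open>t\<close> from \<open>z\<close>.\<close>

lemma surface_function_in_mero:
  assumes loc: "gamma_loc lm lp e \<Sigma>" and l: "lm \<noteq> 0" "lp \<noteq> 0" "e * \<bar>lm\<bar> \<le> pi" "e * \<bar>lp\<bar> \<le> pi"
    and G: "G meromorphic_on {t. \<bar>Im t\<bar> < e}"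
      "(\<lambda>z. G (Ln z / of_real lm)) meromorphic_on ball 0 e"
      "(\<lambda>z. G (Ln z / of_real lp)) meromorphic_on ball 0 e"
  shows "surface_function lm lp G \<in> mero_functions lm lp \<Sigma>"
proof -
  have sub: "\<Sigma> Mid \<subseteq> {t. \<bar>Im t\<bar> < e}" "\<Sigma> Pos \<subseteq> ball 0 e" "\<Sigma> Neg \<subseteq> ball 0 e"
    using loc by (auto simp: gamma_loc_def)
  have "surface_function lm lp G c meromorphic_on \<Sigma> c" for c
    using sub G unfolding surface_function_def[abs_def]
    by (cases c) (auto intro: meromorphic_on_subset)
  moreover have Ln: "Ln (exp (of_real l * t)) / of_real l = t"
    if "\<bar>Im t\<bar> < e" "l \<noteq> 0" "e * \<bar>l\<bar> \<le> pi" for l :: real and t :: complex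
  proof -
    have "\<bar>l * Im t\<bar> < pi"
    proof -
      have "\<bar>l * Im t\<bar> = \<bar>Im t\<bar> * \<bar>l\<bar>" by (simp add: abs_mult)
      also have "\<dots> < e * \<bar>l\<bar>" using that by (intro mult_strict_right_mono) auto
      finally show ?thesis using that(3) by simp
    qed
    then show ?thesis using that by (subst Ln_exp) (auto simp: abs_less_iff)
  qed
  have "\<forall>\<^sub>\<approx>t\<in>overlap_pos lm \<Sigma>. surface_function lm lp G Mid t = surface_function lm lp G Pos (exp (of_real lm * t))"
    using eventually_in_cosparse[OF subset_refl open_overlap(1)[OF loc]]
    by eventually_elim (use sub l in \<open>auto simp: overlap_pos_def surface_function_def Ln subset_iff\<close>)
  moreover have "\<forall>\<^sub>\<approx>t\<in>overlap_neg lp \<Sigma>. surface_function lm lp G Mid t = surface_function lm lp G Neg (exp (of_real lp * t))"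
    using eventually_in_cosparse[OF subset_refl open_overlap(2)[OF loc]]
    by eventually_elim (use sub l in \<open>auto simp: overlap_neg_def surface_function_def Ln subset_iff\<close>)
  ultimately show ?thesis by (simp add: mero_functions_def)
qed

text \<open>Only the values at the added points \<open>z = 0\<close> differ: the principal logarithm of \<open>0\<close> is a default value,
  while a parametrization by \<open>z\<close> gives the value at the equilibrium.\<close>

lemma mero_functions_cong_ends:
  assumes loc: "gamma_loc lm lp e \<Sigma>" and g: "g \<in> mero_functions lm lp \<Sigma>"
    and Mid: "\<And>z. h Mid z = g Mid z"
    and ends: "\<And>z. z \<noteq> 0 \<Longrightarrow> norm z < e \<Longrightarrow> h Pos z = g Pos z" "\<And>z. z \<noteq> 0 \<Longrightarrow> norm z < e \<Longrightarrow> h Neg z = g Neg z"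
  shows "h \<in> mero_functions lm lp \<Sigma>"
proof -
  have sub: "\<Sigma> Pos \<subseteq> ball 0 e" "\<Sigma> Neg \<subseteq> ball 0 e" using loc by (auto simp: gamma_loc_def)
  have "\<forall>\<^sub>F z in at z0. h c z = g c z" if "z0 \<in> \<Sigma> c" for c z0
  proof (cases "c = Mid")
    case False
    then have "z0 \<in> ball 0 e" using sub that by (cases c) auto
    then have "\<forall>\<^sub>F z in at z0. z \<in> ball 0 e" by (intro eventually_at_in_open') auto
    moreover have "\<forall>\<^sub>F z in at z0. z \<noteq> 0" by (rule eventually_neq_at_within)
    ultimately show ?thesis by eventually_elim (use False ends in \<open>cases c; auto\<close>)
  qed (simp add: Mid)
  then have "h c meromorphic_on \<Sigma> c" for c
    using meromorphic_on_cong[of "\<Sigma> c" "h c" "g c" "\<Sigma> c"] g by (simp add: mero_functions_def)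
  moreover have "\<forall>\<^sub>\<approx>t\<in>overlap_pos lm \<Sigma>. h Mid t = h Pos (exp (of_real lm * t))"
  proof -
    have "\<forall>\<^sub>\<approx>t\<in>overlap_pos lm \<Sigma>. t \<in> overlap_pos lm \<Sigma>"
      by (rule eventually_in_cosparse[OF subset_refl open_overlap(1)[OF loc]])
    moreover have "\<forall>\<^sub>\<approx>t\<in>overlap_pos lm \<Sigma>. g Mid t = g Pos (exp (of_real lm * t))" using g by (simp add: mero_functions_def)
    ultimately show ?thesis
    proof eventually_elim
      case (elim t)
      then have "norm (exp (of_real lm * t)) < e" using sub(1) by (auto simp: overlap_pos_def subset_iff simp del: norm_exp_eq_Re)
      then show ?case using elim(2) Mid ends(1)[of "exp (of_real lm * t)"] by simp
    qed
  qed
  moreover have "\<forall>\<^sub>\<approx>t\<in>overlap_neg lp \<Sigma>. h Mid t = h Neg (exp (of_real lp * t))"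
  proof -
    have "\<forall>\<^sub>\<approx>t\<in>overlap_neg lp \<Sigma>. t \<in> overlap_neg lp \<Sigma>"
      by (rule eventually_in_cosparse[OF subset_refl open_overlap(2)[OF loc]])
    moreover have "\<forall>\<^sub>\<approx>t\<in>overlap_neg lp \<Sigma>. g Mid t = g Neg (exp (of_real lp * t))" using g by (simp add: mero_functions_def)
    ultimately show ?thesis
    proof eventually_elim
      case (elim t)
      then have "norm (exp (of_real lp * t)) < e" using sub(2) by (auto simp: overlap_neg_def subset_iff simp del: norm_exp_eq_Re)
      then show ?case using elim(2) Mid ends(2)[of "exp (of_real lp * t)"] by simp
    qed
  qed
  ultimately show ?thesis by (simp add: mero_functions_def)
qed

lemma mero_functions_const: "(\<lambda>c z. a) \<in> mero_functions lm lp \<Sigma>"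
  by (auto simp: mero_functions_def)

lemma mero_functions_add:
  assumes "g \<in> mero_functions lm lp \<Sigma>" "h \<in> mero_functions lm lp \<Sigma>"
  shows "(\<lambda>c z. g c z + h c z) \<in> mero_functions lm lp \<Sigma>"
  using assms unfolding mero_functions_def
  by (auto intro!: meromorphic_intros elim: eventually_elim2)

lemma mero_functions_mult:
  assumes "g \<in> mero_functions lm lp \<Sigma>" "h \<in> mero_functions lm lp \<Sigma>"
  shows "(\<lambda>c z. g c z * h c z) \<in> mero_functions lm lp \<Sigma>"
  using assms unfolding mero_functions_def
  by (auto intro!: meromorphic_intros elim: eventually_elim2)

lemma mero_functions_sum:
  "(\<And>i. i \<in> I \<Longrightarrow> g i \<in> mero_functions lm lp \<Sigma>) \<Longrightarrow> (\<lambda>c z. \<Sum>i\<in>I. g i c z) \<in> mero_functions lm lp \<Sigma>"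
  by (induction I rule: infinite_finite_induct) (auto simp: mero_functions_const mero_functions_add)

lemma mero_functions_prod:
  "(\<And>i. i \<in> I \<Longrightarrow> g i \<in> mero_functions lm lp \<Sigma>) \<Longrightarrow> (\<lambda>c z. \<Prod>i\<in>I. g i c z) \<in> mero_functions lm lp \<Sigma>"
  by (induction I rule: infinite_finite_induct) (auto simp: mero_functions_const mero_functions_mult)

lemma filterlim_exp_mult_at:
  fixes t0 :: complex
  assumes "l \<noteq> 0"
  shows "filterlim (\<lambda>t. exp (of_real l * t)) (at (exp (of_real l * t0))) (at t0)"
proof -
  have "(\<lambda>t. exp (of_real l * t)) \<midarrow>t0\<rightarrow> exp (of_real l * t0)" by (intro tendsto_intros)
  moreover have "\<forall>\<^sub>F t in at t0. exp (of_real l * t) \<noteq> exp (of_real l * t0)"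
  proof -
    have "\<forall>\<^sub>F t in at t0. t \<in> ball t0 (2 * pi / \<bar>l\<bar>) - {t0}"
      using assms pi_gt_zero by (intro eventually_at_in_open) auto
    then show ?thesis
    proof eventually_elim
      case (elim t)
      have "\<bar>Im t - Im t0\<bar> \<le> norm (t - t0)" using abs_Im_le_cmod[of "t - t0"] by simp
      also have "\<dots> < 2 * pi / \<bar>l\<bar>" using elim by (simp add: dist_norm norm_minus_commute)
      finally have "\<bar>l\<bar> * \<bar>Im t - Im t0\<bar> < 2 * pi" using assms by (simp add: field_simps)
      then have "\<bar>Im (of_real l * t) - Im (of_real l * t0)\<bar> < 2 * pi"
        by (simp flip: abs_mult right_diff_distrib)
      then show ?case using elim assms exp_complex_eqI[of "of_real l * t" "of_real l * t0"] by auto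
    qed
  qed
  ultimately show ?thesis by (simp add: filterlim_at)
qed

text \<open>The chain rule on an overlap: \<open>d/dt\<close> is \<open>l * z * d/dz\<close>. Agreement off a sparse set suffices, since
  derivatives are local.\<close>

lemma deriv_transition:
  assumes l: "l \<noteq> 0" and V: "open V" and U: "open U"
    and sub: "\<And>t. t \<in> U \<Longrightarrow> exp (of_real l * t) \<in> V"
    and h: "h meromorphic_on V" and eq: "\<forall>\<^sub>\<approx>t\<in>U. g t = h (exp (of_real l * t))"
  shows "\<forall>\<^sub>\<approx>t\<in>U. deriv g t = of_real l * exp (of_real l * t) * deriv h (exp (of_real l * t))"
  unfolding eventually_cosparse_open_eq[OF U]
proof
  fix t0 assume t0: "t0 \<in> U"
  let ?z = "exp (of_real l * t0)"
  have "\<forall>\<^sub>F z in at ?z. h analytic_on {z}"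
    using meromorphic_on_imp_analytic_cosparse[OF h] sub[OF t0] V
    by (simp add: eventually_cosparse_open_eq)
  moreover have "filterlim (\<lambda>t. exp (of_real l * t)) (at ?z) (at t0)"
    using l by (rule filterlim_exp_mult_at)
  ultimately have an: "\<forall>\<^sub>F t in at t0. h analytic_on {exp (of_real l * t)}"
    by (rule eventually_compose_filterlim)
  have "\<forall>\<^sub>F t in at t0. g t = h (exp (of_real l * t))"
    using eq t0 U by (simp add: eventually_cosparse_open_eq)
  have "\<forall>\<^sub>F t in at t0. \<forall>\<^sub>F s in nhds t. g s = h (exp (of_real l * s))"
  proof -
    obtain S where S: "open S" "t0 \<in> S" "\<And>t. t \<in> S \<Longrightarrow> t \<noteq> t0 \<Longrightarrow> g t = h (exp (of_real l * t))"
      using \<open>\<forall>\<^sub>F t in at t0. g t = h (exp (of_real l * t))\<close> unfolding eventually_at_topological by blast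
    have "\<forall>\<^sub>F t in at t0. t \<in> S - {t0}" using S by (intro eventually_at_in_open) auto
    then show ?thesis
    proof eventually_elim
      case (elim t)
      then have "\<forall>\<^sub>F s in nhds t. s \<in> S - {t0}" using S by (intro eventually_nhds_in_open) (auto intro: open_delete)
      then show ?case by eventually_elim (use S in auto)
    qed
  qed
  with an show "\<forall>\<^sub>F t in at t0. deriv g t = of_real l * exp (of_real l * t) * deriv h (exp (of_real l * t))"
  proof eventually_elim
    case (elim t)
    have "(h has_field_derivative deriv h (exp (of_real l * t))) (at (exp (of_real l * t)))"
      using elim(1) analytic_on_imp_differentiable_at by (simp add: DERIV_deriv_iff_field_differentiable)
    moreover have "((\<lambda>t. exp (of_real l * t)) has_field_derivative of_real l * exp (of_real l * t)) (at t)"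
      by (auto intro!: derivative_eq_intros)
    ultimately have "((\<lambda>t. h (exp (of_real l * t))) has_field_derivative
        deriv h (exp (of_real l * t)) * (of_real l * exp (of_real l * t))) (at t)"
      by (rule DERIV_chain2[where f = h and g = "\<lambda>t. exp (of_real l * t)" and x = t])
    then have "deriv (\<lambda>t. h (exp (of_real l * t))) t = of_real l * exp (of_real l * t) * deriv h (exp (of_real l * t))"
      by (simp add: DERIV_imp_deriv mult_ac)
    then show ?case using deriv_cong_ev[OF elim(2) refl] by simp
  qed
qed

lemma mero_functions_deriv:
  assumes loc: "gamma_loc lm lp e \<Sigma>" and l: "lm \<noteq> 0" "lp \<noteq> 0" and g: "g \<in> mero_functions lm lp \<Sigma>"
  shows "mero_deriv lm lp g \<in> mero_functions lm lp \<Sigma>"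
proof -
  have mero: "g c meromorphic_on \<Sigma> c" for c using g by (simp add: mero_functions_def)
  have "mero_deriv lm lp g c meromorphic_on \<Sigma> c" for c
    unfolding mero_deriv_def[abs_def] using mero[of c]
    by (cases c) (auto intro!: meromorphic_intros)
  moreover have "\<forall>\<^sub>\<approx>t\<in>overlap_pos lm \<Sigma>. mero_deriv lm lp g Mid t = mero_deriv lm lp g Pos (exp (of_real lm * t))"
    using deriv_transition[OF l(1) gamma_loc_open[OF loc, of Pos] open_overlap(1)[OF loc] _ mero[of Pos], of "g Mid"] g
    by (auto simp: mero_deriv_def mero_functions_def overlap_pos_def)
  moreover have "\<forall>\<^sub>\<approx>t\<in>overlap_neg lp \<Sigma>. mero_deriv lm lp g Mid t = mero_deriv lm lp g Neg (exp (of_real lp * t))"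
    using deriv_transition[OF l(2) gamma_loc_open[OF loc, of Neg] open_overlap(2)[OF loc] _ mero[of Neg], of "g Mid"] g
    by (auto simp: mero_deriv_def mero_functions_def overlap_neg_def)
  ultimately show ?thesis by (simp add: mero_functions_def)
qed

text \<open>The real half line is connected and covered by the middle part and the end, and it meets both.\<close>

lemma overlap_nonempty:
  assumes loc: "gamma_loc lm lp e \<Sigma>" and l: "lm < 0" "0 < lp"
  shows "overlap_pos lm \<Sigma> \<noteq> {}" "overlap_neg lp \<Sigma> \<noteq> {}"
proof -
  have meet: "\<exists>s. 0 < s \<and> of_real (exp (l * s)) \<in> V \<and> of_real (a * s) \<in> \<Sigma> Mid"
    if l: "l < 0" and V: "open V" "0 \<in> V"
      and cover: "\<And>s. 0 \<le> s \<Longrightarrow> \<not> (0 < s \<and> of_real (exp (l * s)) \<in> V) \<Longrightarrow> of_real (a * s) \<in> \<Sigma> Mid" for l a :: real and V :: "complex set"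
  proof (rule ccontr)
    assume no: "\<not> ?thesis"
    define S1 where "S1 = {s. 0 < s} \<inter> (\<lambda>s. complex_of_real (exp (l * s))) -` V"
    define S2 where "S2 = (\<lambda>s. complex_of_real (a * s)) -` \<Sigma> Mid"
    have "open S1" unfolding S1_def by (intro open_Int open_vimage V continuous_intros open_Collect_less)
    moreover have "open S2" unfolding S2_def by (intro open_vimage gamma_loc_open[OF loc] continuous_intros)
    moreover have "{0..} \<subseteq> S1 \<union> S2" using cover by (force simp: S1_def S2_def)
    moreover have "S1 \<inter> S2 \<inter> {0..} = {}" using no by (auto simp: S1_def S2_def)
    moreover have "S2 \<inter> {0..} \<noteq> {}" using cover[of 0] by (force simp: S2_def)
    moreover have "S1 \<inter> {0..} \<noteq> {}"
    proof -
      have "((\<lambda>s. complex_of_real (exp (l * s))) \<longlongrightarrow> of_real 0) at_top"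
        using l by (intro tendsto_of_real filterlim_compose[OF exp_at_bot] filterlim_tendsto_neg_mult_at_bot[OF tendsto_const] filterlim_ident)
      then have "\<forall>\<^sub>F s in at_top. complex_of_real (exp (l * s)) \<in> V"
        using V topological_tendstoD by (metis of_real_0)
      moreover have "\<forall>\<^sub>F s in at_top. (0::real) < s" by (rule eventually_gt_at_top)
      ultimately have "\<forall>\<^sub>F s in at_top. 0 < s \<and> complex_of_real (exp (l * s)) \<in> V" by eventually_elim simp
      then obtain s where "0 < s" "complex_of_real (exp (l * s)) \<in> V"
        by (auto simp: eventually_at_top_linorder)
      then have "s \<in> S1 \<inter> {0..}" by (simp add: S1_def)
      then show ?thesis by blast
    qed
    ultimately show False using connectedD[OF connected_Ici[of "0::real"], of S1 S2] by blast
  qed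
  have V: "open (\<Sigma> Pos)" "0 \<in> \<Sigma> Pos" "open (\<Sigma> Neg)" "0 \<in> \<Sigma> Neg"
    and cover: "\<And>t::real. \<not> (0 < t \<and> of_real (exp (lm * t)) \<in> \<Sigma> Pos) \<Longrightarrow>
                \<not> (t < 0 \<and> of_real (exp (lp * t)) \<in> \<Sigma> Neg) \<Longrightarrow> of_real t \<in> \<Sigma> Mid"
    using loc by (auto simp: gamma_loc_def)
  obtain s where "0 < s" "of_real (exp (lm * s)) \<in> \<Sigma> Pos" "of_real (1 * s) \<in> \<Sigma> Mid"
    using meet[of lm "\<Sigma> Pos" 1] l V cover by auto
  then have "of_real s \<in> overlap_pos lm \<Sigma>" by (simp add: overlap_pos_def exp_of_real flip: of_real_mult)
  then show "overlap_pos lm \<Sigma> \<noteq> {}" by blast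
  have "of_real (- 1 * s) \<in> \<Sigma> Mid" if "0 \<le> s" "\<not> (0 < s \<and> of_real (exp (- lp * s)) \<in> \<Sigma> Neg)" for s
    using cover[of "- s"] that by auto
  from meet[of "- lp", OF _ V(3,4) this] l(2)
  obtain s where "0 < s" "of_real (exp (- lp * s)) \<in> \<Sigma> Neg" "of_real (- 1 * s) \<in> \<Sigma> Mid" by auto
  then have "of_real (- s) \<in> overlap_neg lp \<Sigma>"
    by (simp add: overlap_neg_def exp_of_real flip: of_real_mult of_real_minus)
  then show "overlap_neg lp \<Sigma> \<noteq> {}" by blast
qed

text \<open>The identity theorem holds on each chart and carries over to the ends through the overlaps. It
  reduces identities in the field of meromorphic functions to a neighborhood of \<open>t = 0\<close>, where all
  functions in question are given explicitly.\<close>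

lemma mero_identity:
  assumes loc: "gamma_loc lm lp e \<Sigma>" and l: "lm < 0" "0 < lp"
    and g: "g \<in> mero_functions lm lp \<Sigma>" and zero: "\<forall>\<^sub>F t in at 0. g Mid t = 0"
  shows "mero_eq \<Sigma> g (\<lambda>c z. 0)"
proof -
  have mero: "g c meromorphic_on \<Sigma> c" for c using g by (simp add: mero_functions_def)
  have spread: "\<forall>\<^sub>\<approx>z\<in>\<Sigma> c. g c z = 0" if "z0 \<in> \<Sigma> c" "\<exists>\<^sub>F z in at z0. g c z = 0" for c z0
  proof -
    consider "\<forall>\<^sub>\<approx>z\<in>\<Sigma> c. g c z = 0" | "\<forall>\<^sub>\<approx>z\<in>\<Sigma> c. g c z \<noteq> 0"
      using meromorphic_imp_constant_or_avoid[OF mero gamma_loc_open[OF loc] gamma_loc_connected[OF loc]] by blast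
    then show ?thesis
    proof cases
      case 2
      then have "\<forall>\<^sub>F z in at z0. g c z \<noteq> 0"
        using that(1) gamma_loc_open[OF loc] by (simp add: eventually_cosparse_open_eq)
      then show ?thesis using that(2) by (simp add: frequently_def)
    qed
  qed
  have "0 \<in> \<Sigma> Mid"
  proof -
    have "complex_of_real 0 \<in> \<Sigma> Mid" using loc unfolding gamma_loc_def by blast
    then show ?thesis by simp
  qed
  then have Mid: "\<forall>\<^sub>\<approx>z\<in>\<Sigma> Mid. g Mid z = 0"
    using zero by (intro spread eventually_frequently) auto
  have ends: "\<forall>\<^sub>\<approx>z\<in>\<Sigma> c. g c z = 0"
    if l: "l \<noteq> 0" and U: "open U" "U \<noteq> {}" "U \<subseteq> \<Sigma> Mid" "\<And>t. t \<in> U \<Longrightarrow> exp (of_real l * t) \<in> \<Sigma> c"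
      and eq: "\<forall>\<^sub>\<approx>t\<in>U. g Mid t = g c (exp (of_real l * t))" for l :: real and U c
  proof -
    obtain t0 where t0: "t0 \<in> U" using U by blast
    have "\<forall>\<^sub>F t in at t0. g Mid t = g c (exp (of_real l * t))"
      using eq t0 U by (simp add: eventually_cosparse_open_eq)
    moreover have "\<forall>\<^sub>F t in at t0. g Mid t = 0"
      using Mid t0 U gamma_loc_open[OF loc] by (auto simp: eventually_cosparse_open_eq)
    ultimately have ev: "\<forall>\<^sub>F t in at t0. g c (exp (of_real l * t)) = 0" by eventually_elim simp
    show ?thesis
    proof (rule spread[OF U(4)[OF t0]], rule ccontr)
      assume "\<not> (\<exists>\<^sub>F z in at (exp (of_real l * t0)). g c z = 0)"
      then have "\<forall>\<^sub>F z in at (exp (of_real l * t0)). g c z \<noteq> 0" by (simp add: frequently_def)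
      moreover have "filterlim (\<lambda>t. exp (of_real l * t)) (at (exp (of_real l * t0))) (at t0)"
        using l by (rule filterlim_exp_mult_at)
      ultimately have "\<forall>\<^sub>F t in at t0. g c (exp (of_real l * t)) \<noteq> 0" by (rule eventually_compose_filterlim)
      with ev have "\<forall>\<^sub>F t in at t0. False" by eventually_elim simp
      then show False by simp
    qed
  qed
  have "\<forall>\<^sub>\<approx>z\<in>\<Sigma> Pos. g Pos z = 0"
    using l g overlap_nonempty[OF loc l] open_overlap[OF loc]
    by (intro ends[of lm "overlap_pos lm \<Sigma>"]) (auto simp: overlap_pos_def mero_functions_def)
  moreover have "\<forall>\<^sub>\<approx>z\<in>\<Sigma> Neg. g Neg z = 0"
    using l g overlap_nonempty[OF loc l] open_overlap[OF loc]
    by (intro ends[of lp "overlap_neg lp \<Sigma>"]) (auto simp: overlap_neg_def mero_functions_def)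
  ultimately have "\<forall>\<^sub>\<approx>z\<in>\<Sigma> c. g c z = 0" for c using Mid by (cases c) auto
  then show ?thesis by (simp add: mero_eq_def)
qed

section \<open>From a flag of solutions to the Galois group\<close>

lemma mero_functions_det:
  assumes "\<And>i j. g i j \<in> mero_functions lm lp \<Sigma>"
  shows "(\<lambda>c z. det (\<chi> i j. g i j c z)) \<in> mero_functions lm lp \<Sigma>"
  unfolding det_def
  by (intro mero_functions_sum mero_functions_mult mero_functions_const) (simp add: mero_functions_prod assms)

context
  fixes lm lp :: real and \<Sigma> \<delta> and \<iota> :: "(chart \<Rightarrow> complex \<Rightarrow> complex) \<Rightarrow> 'l::field"
  assumes emb: "mero_embedding lm lp \<Sigma> \<delta> \<iota>"
begin

lemma embedding_add: "g \<in> mero_functions lm lp \<Sigma> \<Longrightarrow> h \<in> mero_functions lm lp \<Sigma> \<Longrightarrow>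
    \<iota> (\<lambda>c z. g c z + h c z) = \<iota> g + \<iota> h"
  and embedding_mult: "g \<in> mero_functions lm lp \<Sigma> \<Longrightarrow> h \<in> mero_functions lm lp \<Sigma> \<Longrightarrow>
    \<iota> (\<lambda>c z. g c z * h c z) = \<iota> g * \<iota> h"
  and embedding_eq_iff: "g \<in> mero_functions lm lp \<Sigma> \<Longrightarrow> h \<in> mero_functions lm lp \<Sigma> \<Longrightarrow>
    \<iota> g = \<iota> h \<longleftrightarrow> mero_eq \<Sigma> g h"
  and embedding_1: "\<iota> (\<lambda>c z. 1) = 1"
  and embedding_deriv: "g \<in> mero_functions lm lp \<Sigma> \<Longrightarrow> \<iota> (mero_deriv lm lp g) = \<delta> (\<iota> g)"
  using emb unfolding mero_embedding_def by blast+

lemma embedding_0: "\<iota> (\<lambda>c z. 0) = 0"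
proof -
  have "\<iota> (\<lambda>c z. 0) = \<iota> (\<lambda>c z. 0) + \<iota> (\<lambda>c z. 0)"
    using embedding_add[OF mero_functions_const[of 0] mero_functions_const[of 0]] by (simp only: add_0_left)
  then show ?thesis by (metis add.right_neutral add_left_cancel)
qed

lemma embedding_sum:
  "(\<And>i. i \<in> I \<Longrightarrow> g i \<in> mero_functions lm lp \<Sigma>) \<Longrightarrow> \<iota> (\<lambda>c z. \<Sum>i\<in>I. g i c z) = (\<Sum>i\<in>I. \<iota> (g i))"
  by (induction I rule: infinite_finite_induct) (auto simp: embedding_0 embedding_add mero_functions_sum)

lemma embedding_prod:
  "(\<And>i. i \<in> I \<Longrightarrow> g i \<in> mero_functions lm lp \<Sigma>) \<Longrightarrow> \<iota> (\<lambda>c z. \<Prod>i\<in>I. g i c z) = (\<Prod>i\<in>I. \<iota> (g i))"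
  by (induction I rule: infinite_finite_induct) (auto simp: embedding_1 embedding_mult mero_functions_prod)

lemma embedding_sign: "\<iota> (\<lambda>c z. of_int (sign p)) = of_int (sign p)"
proof -
  have "\<iota> (\<lambda>c z. - 1) + \<iota> (\<lambda>c z. 1) = 0"
    using embedding_add[OF mero_functions_const[of "- 1"] mero_functions_const[of 1]] by (simp add: embedding_0)
  then have "\<iota> (\<lambda>c z. - 1) = - 1" by (simp add: embedding_1 eq_neg_iff_add_eq_0)
  then show ?thesis by (simp add: sign_def embedding_1)
qed

lemma embedding_det:
  assumes g: "\<And>i j. g i j \<in> mero_functions lm lp \<Sigma>"
  shows "\<iota> (\<lambda>c z. det (\<chi> i j. g i j c z)) = det (\<chi> i j. \<iota> (g i j))"
proof -
  have "(\<lambda>c z. \<Prod>i\<in>UNIV. g i (p i) c z) \<in> mero_functions lm lp \<Sigma>" for p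
    by (intro mero_functions_prod g)
  then show ?thesis
    by (simp add: det_def embedding_sum embedding_mult embedding_prod embedding_sign
        mero_functions_mult mero_functions_const g)
qed

text \<open>The matrix \<open>r\<close> annihilates the flag: row \<open>i\<close> vanishes on the solutions before \<open>i\<close>. Differentiating
  this relation gives the same for row \<open>i\<close> of \<open>N = R' + R ** A\<close>, the left hand side of the gauge
  equation. Hence row \<open>i\<close> of \<open>N\<close> is a combination of the rows of \<open>R\<close> from \<open>i\<close> on, that is, \<open>N = B ** R\<close>
  with \<open>B\<close> triangular. All this is verified near \<open>t = 0\<close> and transported to the abstract field by the
  identity theorem; by Cramer's rule, the entries of \<open>B\<close> vanish together with certain determinants.\<close>

lemma triangularizable_if_gauge_functions:
  fixes r a :: "'n::{finite,wellorder} \<Rightarrow> 'n \<Rightarrow> chart \<Rightarrow> complex \<Rightarrow> complex"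
    and V :: "complex \<Rightarrow> complex ^ 'n::{finite,wellorder} ^ 'n::{finite,wellorder}"
    and Y :: "'l ^ 'n::{finite,wellorder} ^ 'n::{finite,wellorder}"
  assumes loc: "gamma_loc lm lp e \<Sigma>" and l: "lm < 0" "0 < lp"
    and pv: "picard_vessiot \<delta> (\<iota> ` mero_functions lm lp \<Sigma>) (\<chi> i j. \<iota> (a i j)) L Y"
    and r: "\<And>i j. r i j \<in> mero_functions lm lp \<Sigma>" and a: "\<And>i j. a i j \<in> mero_functions lm lp \<Sigma>"
    and S: "open S" "0 \<in> S"
    and dV: "\<And>t i j. t \<in> S \<Longrightarrow>
        ((\<lambda>s. V s $ i $ j) has_field_derivative (\<Sum>k\<in>UNIV. a j k Mid t * V t $ i $ k)) (at t)"
    and dr: "\<And>t i j. t \<in> S \<Longrightarrow> r i j Mid field_differentiable at t"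
    and tri: "\<And>t i j. t \<in> S \<Longrightarrow> j < i \<Longrightarrow> (\<Sum>k\<in>UNIV. r i k Mid t * V t $ j $ k) = 0"
    and detV: "\<And>t. t \<in> S \<Longrightarrow> det (V t) \<noteq> 0"
    and detr: "\<And>t. t \<in> S \<Longrightarrow> det (\<chi> i j. r i j Mid t) * kappa = 1"
  shows "triangularizable (constants \<delta> (\<iota> ` mero_functions lm lp \<Sigma>))
           (galois_matrices \<delta> (\<iota> ` mero_functions lm lp \<Sigma>) L Y)"
proof -
  let ?M = "mero_functions lm lp \<Sigma>"
  have zeroI: "\<iota> g = 0" if g: "g \<in> ?M" and "\<And>t. t \<in> S \<Longrightarrow> g Mid t = 0" for g
  proof -
    have "\<forall>\<^sub>F t in at 0. t \<in> S - {0}" using S by (intro eventually_at_in_open) auto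
    then have "\<forall>\<^sub>F t in at 0. g Mid t = 0" by eventually_elim (use that in auto)
    then have "mero_eq \<Sigma> g (\<lambda>c z. 0)" by (rule mero_identity[OF loc l g])
    then show ?thesis using embedding_eq_iff[OF g mero_functions_const[of 0]] by (simp add: embedding_0)
  qed
  define R where "R = (\<chi> i j. \<iota> (r i j))"
  define A where "A = (\<chi> i j. \<iota> (a i j))"
  define n where "n i j = (\<lambda>c z. mero_deriv lm lp (r i j) c z + (\<Sum>k\<in>UNIV. r i k c z * a k j c z))" for i j
  have dr_M: "mero_deriv lm lp (r i j) \<in> ?M" for i j
    using l by (intro mero_functions_deriv[OF loc _ _ r]) auto
  have n_M: "n i j \<in> ?M" for i j
    unfolding n_def by (intro mero_functions_add dr_M mero_functions_sum mero_functions_mult r a)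
  define N where "N = (\<chi> i j. \<iota> (n i j))"
  have N_eq: "N = map_matrix \<delta> R + R ** A"
    by (simp add: vec_eq_iff N_def R_def A_def n_def matrix_matrix_mult_def embedding_add dr_M
        embedding_sum embedding_mult mero_functions_sum mero_functions_mult r a embedding_deriv)
  have det_R: "det R \<noteq> 0"
  proof
    assume "det R = 0"
    have "\<iota> (\<lambda>c z. det (\<chi> i j. r i j c z) * kappa + - 1) = 0"
      using detr by (intro zeroI mero_functions_add mero_functions_mult mero_functions_det mero_functions_const r) auto
    also have "\<iota> (\<lambda>c z. det (\<chi> i j. r i j c z) * kappa + - 1) = det R * \<iota> (\<lambda>c z. kappa) + \<iota> (\<lambda>c z. - 1)"
    proof -
      have det_M: "(\<lambda>c z. det (\<chi> i j. r i j c z)) \<in> ?M" by (intro mero_functions_det r)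
      show ?thesis
        unfolding embedding_add[OF mero_functions_mult[OF det_M mero_functions_const] mero_functions_const]
          embedding_mult[OF det_M mero_functions_const] embedding_det[OF r] R_def ..
    qed
    finally have "\<iota> (\<lambda>c z. - 1) = 0" using \<open>det R = 0\<close> by simp
    then show False
      using embedding_add[OF mero_functions_const[of "- 1"] mero_functions_const[of 1]] by (simp add: embedding_0 embedding_1)
  qed
  then have R_inv: "invertible R" by (simp add: invertible_det_nz)
  define B where "B = N ** matrix_inv R"
  have BR: "B ** R = N"
    unfolding B_def using invertible_matrix_inv(2)[OF R_inv] by (metis matrix_mul_assoc matrix_mul_rid)
  have "B $ i $ j = 0" if ji: "j < i" for i j
  proof -
    \<comment> \<open>\<open>R\<close> with its row \<open>j\<close> replaced by row \<open>i\<close> of \<open>N\<close>; its determinant is \<open>B $ i $ j * det R\<close>\<close>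
    define X where "X a' b = (if a' = j then n i b else r a' b)" for a' b
    have X_M: "X a' b \<in> ?M" for a' b by (simp add: X_def n_M r)
    have "det (\<chi> a' b. X a' b Mid t) = 0" if t: "t \<in> S" for t
    proof -
      define Xt where "Xt = (\<chi> a' b. X a' b Mid t)"
      have n_V: "(\<Sum>m\<in>UNIV. n i m Mid t * V t $ b $ m) = 0" if b: "b < i" for b
      proof -
        have "((\<lambda>s. \<Sum>k\<in>UNIV. r i k Mid s * V s $ b $ k) has_field_derivative
            (\<Sum>k\<in>UNIV. r i k Mid t * (\<Sum>m\<in>UNIV. a k m Mid t * V t $ b $ m) + deriv (r i k Mid) t * V t $ b $ k)) (at t)"
          using dr[OF t] by (intro DERIV_sum DERIV_mult' dV[OF t]) (simp add: DERIV_deriv_iff_field_differentiable)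
        moreover have "((\<lambda>s. \<Sum>k\<in>UNIV. r i k Mid s * V s $ b $ k) has_field_derivative 0) (at t)"
          using tri[OF _ b] by (intro has_field_derivative_transform_within_open[OF DERIV_const S(1) t]) auto
        ultimately have "(\<Sum>k\<in>UNIV. r i k Mid t * (\<Sum>m\<in>UNIV. a k m Mid t * V t $ b $ m)
            + deriv (r i k Mid) t * V t $ b $ k) = 0"
          by (rule DERIV_unique)
        moreover have "(\<Sum>k\<in>UNIV. r i k Mid t * (\<Sum>m\<in>UNIV. a k m Mid t * V t $ b $ m))
            = (\<Sum>m\<in>UNIV. (\<Sum>k\<in>UNIV. r i k Mid t * a k m Mid t) * V t $ b $ m)"
          by (simp add: sum_distrib_left sum_distrib_right mult.assoc) (rule sum.swap)
        ultimately show ?thesis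
          by (simp add: n_def mero_deriv_def distrib_right sum.distrib add.commute)
      qed
      have "det (Xt ** transpose (V t)) = (\<Prod>c\<in>UNIV. (Xt ** transpose (V t)) $ c $ c)"
      proof (rule det_upperdiagonal)
        fix a' b :: 'n assume "b < a'"
        then show "(Xt ** transpose (V t)) $ a' $ b = 0"
          using n_V[of b] tri[OF t, of b a'] ji
          by (cases "a' = j") (auto simp: Xt_def X_def matrix_matrix_mult_def transpose_def)
      qed
      also have "\<dots> = 0"
      proof (rule prod_zero)
        have "(Xt ** transpose (V t)) $ j $ j = 0"
          using n_V[OF ji] by (simp add: Xt_def X_def matrix_matrix_mult_def transpose_def)
        then show "\<exists>c\<in>UNIV. (Xt ** transpose (V t)) $ c $ c = 0" by blast
      qed simp
      finally show ?thesis using detV[OF t] by (simp add: det_mul Xt_def)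
    qed
    then have "\<iota> (\<lambda>c z. det (\<chi> a' b. X a' b c z)) = 0"
      by (intro zeroI mero_functions_det X_M)
    then have "det (\<chi> a' b. \<iota> (X a' b)) = 0" by (simp add: embedding_det X_M)
    moreover have "(\<chi> a' b. \<iota> (X a' b)) = (\<chi> a'. if a' = j then (\<Sum>k\<in>UNIV. (row i B) $ k *s row k R) else row a' R)"
    proof -
      have "(\<Sum>k\<in>UNIV. B $ i $ k * R $ k $ b) = N $ i $ b" for b
        using BR by (simp flip: BR add: matrix_matrix_mult_def)
      then show ?thesis by (auto simp: vec_eq_iff X_def row_def R_def N_def)
    qed
    ultimately have "row i B $ j * det R = 0"
      using cramer_lemma_transpose[of j "row i B" R] by simp
    then show ?thesis using det_R by (simp add: row_def)
  qed
  then have "upper_triangular B" by (auto simp: upper_triangular_def)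
  moreover have "matrix_entries R \<subseteq> \<iota> ` ?M" using r by (auto simp: matrix_entries_def R_def)
  ultimately show ?thesis
    using pv R_inv BR N_eq by (intro triangularizable_if_gauge_triangular[of \<delta> _ A]) (auto simp: A_def)
qed

end

text \<open>As a linear form in \<open>x\<close>, this vanishes on the solutions before \<open>k\<close>; the rows after \<open>k\<close> are filled up
  with constant vectors. The coefficients of the form are its values at the unit vectors.\<close>

definition flag_minor ::
    "'a::comm_ring_1 ^ 'n::{finite,linorder} ^ 'n::{finite,linorder} \<Rightarrow> 'a ^ 'n::{finite,linorder} ^ 'n::{finite,linorder} \<Rightarrow> 'n \<Rightarrow> 'a ^ 'n::{finite,linorder} \<Rightarrow> 'a" where
  "flag_minor V V0 k x = det (\<chi> i. if i < k then V $ i else if i = k then x else V0 $ i)"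

lemma flag_minor_sum:
  fixes x :: "'a::comm_ring_1 ^ 'n::{finite,linorder}"
  shows "(\<Sum>j\<in>UNIV. x $ j * flag_minor V V0 k (axis j 1)) = flag_minor V V0 k x"
proof -
  let ?c = "\<lambda>i. if i < k then V $ i else V0 $ i"
  have swap: "(\<chi> i. if i < k then V $ i else if i = k then y else V0 $ i) = (\<chi> i. if i = k then y else ?c i)" for y
    by (auto simp: vec_eq_iff)
  have expansion: "(\<Sum>j\<in>UNIV. x $ j *s axis j 1) = x" by (rule basis_expansion)
  have "flag_minor V V0 k x = det (\<chi> i. if i = k then (\<Sum>j\<in>UNIV. x $ j *s axis j 1) else ?c i)"
    unfolding flag_minor_def swap expansion ..
  also have "\<dots> = (\<Sum>j\<in>UNIV. det (\<chi> i. if i = k then x $ j *s axis j 1 else ?c i))"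
    by (rule det_linear_row_sum) simp
  also have "\<dots> = (\<Sum>j\<in>UNIV. x $ j * flag_minor V V0 k (axis j 1))"
    unfolding det_row_mul flag_minor_def swap ..
  finally show ?thesis ..
qed

lemma flag_minor_lower: "i < k \<Longrightarrow> flag_minor V V0 k (V $ i) = 0"
  and flag_minor_upper: "k < i \<Longrightarrow> flag_minor V V0 k (V0 $ i) = 0"
  unfolding flag_minor_def
  by (rule det_identical_rows[of i k]; auto simp: row_def vec_eq_iff)+

lemma flag_minor_base: "flag_minor V V k (V $ k) = det V"
  by (simp add: flag_minor_def if_distrib cong: if_cong)
     (rule arg_cong[of _ _ det], auto simp: vec_eq_iff)

text \<open>This is why the flag has to be preserved: only the rows before \<open>k\<close> change, and among themselves.\<close>

lemma flag_minor_lower_triangular_mult: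
  fixes C :: "'a::comm_ring_1 ^ 'n::{finite,wellorder} ^ 'n::{finite,wellorder}"
  assumes C: "\<And>i j. i < j \<Longrightarrow> C $ i $ j = 0"
  shows "flag_minor (C ** V) V0 k x = (\<Prod>i | i < k. C $ i $ i) * flag_minor V V0 k x"
proof -
  define Q where "Q = (\<chi> i j. if i < k then C $ i $ j else if i = j then 1 else 0)"
  let ?N = "\<lambda>V. \<chi> i. if i < k then V $ i else if i = k then x else V0 $ i"
  have "?N (C ** V) = Q ** ?N V"
  proof -
    have "(Q ** ?N V) $ i $ j = ?N (C ** V) $ i $ j" for i j
    proof (cases "i < k")
      case True
      have "(Q ** ?N V) $ i $ j = (\<Sum>m\<in>UNIV. C $ i $ m * ?N V $ m $ j)"
        using True by (simp add: matrix_matrix_mult_def Q_def)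
      also have "\<dots> = (\<Sum>m\<in>UNIV. C $ i $ m * V $ m $ j)"
      proof (rule sum.cong[OF refl])
        fix m show "C $ i $ m * ?N V $ m $ j = C $ i $ m * V $ m $ j"
          using True C[of i m] by (cases "i < m") auto
      qed
      finally show ?thesis using True by (simp add: matrix_matrix_mult_def)
    next
      case False
      then show ?thesis
        by (simp add: matrix_matrix_mult_def Q_def if_distrib[of "\<lambda>x. x * _"] cong: if_cong)
    qed
    then show ?thesis by (simp add: vec_eq_iff)
  qed
  moreover have "det Q = (\<Prod>i\<in>UNIV. Q $ i $ i)" by (rule det_lowerdiagonal) (auto simp: Q_def C)
  moreover have "(\<Prod>i\<in>UNIV. Q $ i $ i) = (\<Prod>i | i < k. C $ i $ i)"
    by (simp add: Q_def prod.If_cases)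
  ultimately show ?thesis by (simp add: flag_minor_def det_mul)
qed

lemma holomorphic_on_det:
  "(\<And>i j. (\<lambda>t. N t $ i $ j) holomorphic_on S) \<Longrightarrow> (\<lambda>t. det (N t)) holomorphic_on S"
  unfolding det_def by (intro holomorphic_intros)

lemma flag_minor_holomorphic:
  assumes "\<And>i j. (\<lambda>t. V t $ i $ j) holomorphic_on S"
  shows "(\<lambda>t. flag_minor (V t) V0 k x) holomorphic_on S"
  unfolding flag_minor_def
proof (rule holomorphic_on_det)
  fix i j
  show "(\<lambda>t. (\<chi> i. if i < k then V t $ i else if i = k then x else V0 $ i) $ i $ j) holomorphic_on S"
    using assms by (cases "i < k"; cases "i = k") auto
qed

lemma flag_minor_moderate:
  assumes "\<And>i j. moderate_growth S (\<lambda>t. V t $ i $ j)"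
  shows "moderate_growth S (\<lambda>t. flag_minor (V t) V0 k x)"
  unfolding flag_minor_def
proof (rule moderate_growth_det)
  fix i j
  show "moderate_growth S (\<lambda>t. (\<chi> i. if i < k then V t $ i else if i = k then x else V0 $ i) $ i $ j)"
    using assms moderate_growth_const by (cases "i < k"; cases "i = k") auto
qed

text \<open>The factors \<open>exp (- c * t)\<close> that make numerator and denominator periodic are equal and cancel.\<close>

lemma semi_invariant_quotient_meromorphic:
  assumes l: "l \<noteq> 0" and r: "0 < r" "r \<le> 1"
    and hol: "n holomorphic_on end_strip l r" "d holomorphic_on end_strip l r"
    and growth: "moderate_growth (end_strip l r) n" "moderate_growth (end_strip l r) d"
    and m: "m \<noteq> 0"
    and semi: "\<And>t. t \<in> end_strip l r \<Longrightarrow> t + end_period l \<in> end_strip l r \<Longrightarrow> n (t + end_period l) = m * n t"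
      "\<And>t. t \<in> end_strip l r \<Longrightarrow> t + end_period l \<in> end_strip l r \<Longrightarrow> d (t + end_period l) = m * d t"
  shows "(\<lambda>z. n (Ln z / of_real l) / d (Ln z / of_real l)) meromorphic_on ball 0 r"
proof -
  define c where "c = Ln m / end_period l"
  have c: "exp (c * end_period l) = m" using l m by (simp add: c_def)
  have "(\<lambda>z. exp (- (c * (Ln z / of_real l))) * n (Ln z / of_real l)) meromorphic_on ball 0 r"
    "(\<lambda>z. exp (- (c * (Ln z / of_real l))) * d (Ln z / of_real l)) meromorphic_on ball 0 r"
    by (rule semi_invariant_meromorphic[OF l r hol(1) _ growth(1)], simp only: c semi)
       (rule semi_invariant_meromorphic[OF l r hol(2) _ growth(2)], simp only: c semi)
  from meromorphic_on_divide[OF this] show ?thesis by simp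
qed

text \<open>Row \<open>k\<close> of the gauge matrix is the linear form of the minor for \<open>k\<close>, normalized to take the value \<open>1\<close>
  at the initial value of the solution \<open>k\<close>. Numerator and denominator acquire the same factor at each
  end, so the entries are meromorphic on the surface; and applied to the initial values
  the matrix is triangular with ones on the diagonal, so it is invertible.\<close>

theorem triangularizable_if_triangular_monodromy:
  fixes A :: "complex \<Rightarrow> complex ^ 'n::{finite,wellorder} ^ 'n::{finite,wellorder}"
    and V :: "complex \<Rightarrow> complex ^ 'n::{finite,wellorder} ^ 'n::{finite,wellorder}"
    and a :: "'n::{finite,wellorder} \<Rightarrow> 'n \<Rightarrow> chart \<Rightarrow> complex \<Rightarrow> complex"
    and Y :: "'l::field ^ 'n::{finite,wellorder} ^ 'n::{finite,wellorder}"
  assumes l: "lm < 0" "0 < lp" and loc: "gamma_loc lm lp e \<Sigma>"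
    and e: "0 < e" "e \<le> 1" "e * \<bar>lm\<bar> \<le> pi" "e * \<bar>lp\<bar> \<le> pi"
    and D: "open D" "{t. \<bar>Im t\<bar> < e} \<subseteq> D" "end_strip lm e \<subseteq> D" "end_strip lp e \<subseteq> D"
    and sol: "\<And>i. linear_ode_solution A (\<lambda>t. V t $ i) D"
    and growth: "\<And>i j. moderate_growth D (\<lambda>t. V t $ i $ j)"
    and det0: "det (V 0) \<noteq> 0"
    and mono: "\<And>l. l \<in> {lm, lp} \<Longrightarrow> \<exists>C. (\<forall>i j. i < j \<longrightarrow> C $ i $ j = 0) \<and> (\<forall>i. C $ i $ i \<noteq> 0) \<and>
        (\<forall>t. t \<in> end_strip l e \<longrightarrow> t + end_period l \<in> end_strip l e \<longrightarrow> V (t + end_period l) = C ** V t)"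
    and emb: "mero_embedding lm lp \<Sigma> \<delta> \<iota>"
    and a: "\<And>i j. a i j \<in> mero_functions lm lp \<Sigma>" "\<And>i j t. \<bar>Im t\<bar> < e \<Longrightarrow> a i j Mid t = A t $ i $ j"
    and pv: "picard_vessiot \<delta> (\<iota> ` mero_functions lm lp \<Sigma>) (\<chi> i j. \<iota> (a i j)) L Y"
  shows "triangularizable (constants \<delta> (\<iota> ` mero_functions lm lp \<Sigma>))
           (galois_matrices \<delta> (\<iota> ` mero_functions lm lp \<Sigma>) L Y)"
proof -
  define n where "n k x t = flag_minor (V t) (V 0) k x" for k x t
  define G where "G k j t = n k (axis j 1) t / n k (V 0 $ k) t" for k j t
  have V_hol: "(\<lambda>t. V t $ i $ j) holomorphic_on D" for i j
    using linear_ode_solution_holomorphic[OF sol] .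
  have n_hol: "n k x holomorphic_on D" for k x
    unfolding n_def[abs_def] by (intro flag_minor_holomorphic V_hol)
  have n_growth: "moderate_growth D (n k x)" for k x
    unfolding n_def[abs_def] by (intro flag_minor_moderate growth)
  have growth_sub: "moderate_growth E f" if "moderate_growth D f" "E \<subseteq> D" for E f
    using that unfolding moderate_growth_def by (meson subsetD)
  have G_end: "(\<lambda>z. G k j (Ln z / of_real l)) meromorphic_on ball 0 e" if ll: "l \<in> {lm, lp}" for k j l
  proof -
    have sub: "end_strip l e \<subseteq> D" using ll D by auto
    obtain C where C: "\<And>i j. i < j \<Longrightarrow> C $ i $ j = 0" "\<And>i. C $ i $ i \<noteq> 0"
      "\<And>t. t \<in> end_strip l e \<Longrightarrow> t + end_period l \<in> end_strip l e \<Longrightarrow> V (t + end_period l) = C ** V t"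
      using mono[OF ll] by blast
    have n_semi: "n k x (t + end_period l) = (\<Prod>i | i < k. C $ i $ i) * n k x t"
      if "t \<in> end_strip l e" "t + end_period l \<in> end_strip l e" for x t
      unfolding n_def C(3)[OF that] by (rule flag_minor_lower_triangular_mult[OF C(1)])
    show ?thesis
      unfolding G_def
      using ll l e C(2) n_hol n_growth sub n_semi
      by (intro semi_invariant_quotient_meromorphic[where m = "\<Prod>i | i < k. C $ i $ i"])
         (auto intro: holomorphic_on_subset growth_sub)
  qed
  define r where "r k j = surface_function lm lp (G k j)" for k j
  have "G k j meromorphic_on {t. \<bar>Im t\<bar> < e}" for k j
  proof -
    have "n k x analytic_on D" for x using n_hol D(1) by (simp add: analytic_on_open)
    then have "n k x meromorphic_on {t. \<bar>Im t\<bar> < e}" for x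
      using D(2) analytic_on_imp_meromorphic_on meromorphic_on_subset by blast
    then show ?thesis unfolding G_def[abs_def] by (intro meromorphic_intros)
  qed
  then have r_M: "r k j \<in> mero_functions lm lp \<Sigma>" for k j
    unfolding r_def using l e G_end by (intro surface_function_in_mero[OF loc]) auto
  have r_Mid: "r k j Mid t = n k (axis j 1) t / n k (V 0 $ k) t" for k j t
    by (simp add: r_def surface_function_def G_def)
  have sum_r: "(\<Sum>j\<in>UNIV. r k j Mid t * x $ j) = n k x t / n k (V 0 $ k) t" for k x t
    unfolding r_Mid n_def flag_minor_sum[of x, symmetric] by (simp add: sum_divide_distrib mult.commute)
  \<comment> \<open>a neighborhood of \<open>t = 0\<close> where no denominator vanishes\<close>
  define S where
    "S = {t \<in> D. det (V t) \<noteq> 0} \<inter> (\<Inter>k. {t \<in> D. n k (V 0 $ k) t \<noteq> 0}) \<inter> {t. \<bar>Im t\<bar> < e}"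
  have "0 \<in> D" using D(2) e(1) by auto
  have "open S"
  proof -
    have "open {t \<in> D. f t \<noteq> 0}" if "f holomorphic_on D" for f :: "complex \<Rightarrow> complex"
    proof -
      have "open (D \<inter> f -` (- {0}))"
        using holomorphic_on_imp_continuous_on[OF that] D(1) by (rule continuous_open_preimage) auto
      moreover have "{t \<in> D. f t \<noteq> 0} = D \<inter> f -` (- {0})" by auto
      ultimately show ?thesis by simp
    qed
    then show ?thesis
      unfolding S_def using n_hol holomorphic_on_det[OF V_hol]
      by (intro open_Int open_INT open_Collect_less continuous_intros) auto
  qed
  have "0 \<in> S" using \<open>0 \<in> D\<close> det0 e(1) by (simp add: S_def n_def flag_minor_base)
  show ?thesis
  proof (rule triangularizable_if_gauge_functions[OF emb loc l pv r_M a(1) \<open>open S\<close> \<open>0 \<in> S\<close>, where V = V and kappa = "det (V 0)"])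
    fix t assume t: "t \<in> S"
    then have tD: "t \<in> D" and te: "\<bar>Im t\<bar> < e" and nz: "\<And>k. n k (V 0 $ k) t \<noteq> 0" and "det (V t) \<noteq> 0"
      by (auto simp: S_def)
    show "det (V t) \<noteq> 0" by fact
    show "((\<lambda>s. V s $ i $ j) has_field_derivative (\<Sum>k\<in>UNIV. a j k Mid t * V t $ i $ k)) (at t)" for i j
      using sol[of i] tD a(2)[OF te] by (simp add: linear_ode_solution_def matrix_vector_mult_def)
    show "r i j Mid field_differentiable at t" for i j
    proof -
      have "n i x field_differentiable at t" for x
        using n_hol D(1) tD holomorphic_on_imp_differentiable_at by blast
      then have "(\<lambda>t. n i (axis j 1) t / n i (V 0 $ i) t) field_differentiable at t"
        using nz by (intro field_differentiable_divide)
      moreover have "r i j Mid = (\<lambda>t. n i (axis j 1) t / n i (V 0 $ i) t)" by (simp add: fun_eq_iff r_Mid)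
      ultimately show ?thesis by simp
    qed
    show "(\<Sum>k\<in>UNIV. r i k Mid t * V t $ j $ k) = 0" if "j < i" for i j
      unfolding sum_r using that by (simp add: n_def flag_minor_lower)
    show "det (\<chi> i j. r i j Mid t) * det (V 0) = 1"
    proof -
      let ?R = "\<chi> i j. r i j Mid t"
      have RV: "(?R ** transpose (V 0)) $ i $ j = n i (V 0 $ j) t / n i (V 0 $ i) t" for i j
        using sum_r[of i t "V 0 $ j"] by (simp add: matrix_matrix_mult_def transpose_def)
      have "det (?R ** transpose (V 0)) = (\<Prod>i\<in>UNIV. (?R ** transpose (V 0)) $ i $ i)"
        by (rule det_lowerdiagonal) (simp add: RV n_def flag_minor_upper)
      also have "\<dots> = 1" using nz by (simp add: RV)
      finally show ?thesis by (simp add: det_mul)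
    qed
  qed
qed

section \<open>Monodromy at an end of the orbit\<close>

text \<open>The sign makes the half line run into the end for \<open>s \<rightarrow> \<infinity>\<close>, whichever end \<open>l\<close> describes.\<close>

definition end_ray :: "real \<Rightarrow> real \<Rightarrow> complex" where
  "end_ray l s = of_real (- sgn l * s)"

text \<open>Where one turn around the end can be made inside the strip.\<close>

definition end_overlap :: "real \<Rightarrow> real \<Rightarrow> complex set" where
  "end_overlap l r = {t. t \<in> end_strip l r \<and> t + end_period l \<in> end_strip l r}"

lemma end_overlap_eq:
  assumes "l \<noteq> 0"
  shows "end_overlap l r = end_strip l r \<inter> {t. \<bar>l * Im t + 2 * pi\<bar> < 4 * pi}"
  unfolding end_overlap_def end_strip_add_period[OF assms] by (auto simp: end_strip_def)

lemma convex_end_overlap: "l \<noteq> 0 \<Longrightarrow> convex (end_overlap l r)"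
proof -
  assume l: "l \<noteq> 0"
  have "end_overlap l r = end_strip l r \<inter> (\<lambda>t. - end_period l + t) ` end_strip l r"
    unfolding end_overlap_def by (auto intro!: image_eqI[where x = "_ + end_period l"])
  then show ?thesis by (simp only: convex_Int convex_end_strip convex_translation)
qed

lemma end_ray_in:
  assumes "l \<noteq> 0" "0 < r" "- ln r / \<bar>l\<bar> < s"
  shows "end_ray l s \<in> end_overlap l r" "end_ray l s \<in> end_strip l r"
proof -
  have "- ln r < \<bar>l\<bar> * s" using assms by (simp add: field_simps)
  then have "l * Re (end_ray l s) < ln r" by (simp add: end_ray_def abs_sgn mult_ac)
  then show "end_ray l s \<in> end_strip l r"
    using end_strip_iff[OF assms(2)] by (simp add: end_ray_def)
  then show "end_ray l s \<in> end_overlap l r"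
    unfolding end_overlap_eq[OF assms(1)] by (simp add: end_ray_def)
qed

definition bounded_on_ray :: "real \<Rightarrow> (complex \<Rightarrow> complex ^ 'n) \<Rightarrow> bool" where
  "bounded_on_ray l u \<longleftrightarrow> (\<exists>T. bounded ((\<lambda>s. u (end_ray l s)) ` {T..}))"

text \<open>The situation at one end: periodic coefficients that tend to a hyperbolic limit with at most two
  eigenvalues of each sign. Solutions that are bounded into the end belong to the negative eigenvalues for \<open>l < 0\<close>
  and to the positive ones for \<open>l > 0\<close>; therefore both counts are assumed.\<close>

locale end_system =
  fixes A :: "complex \<Rightarrow> complex ^ 'n ^ 'n" and A0 :: "complex ^ 'n ^ 'n" and l r M :: real and d :: "'n \<Rightarrow> real"
  assumes l: "l \<noteq> 0" and r: "0 < r"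
    and period: "\<And>t. t \<in> end_overlap l r \<Longrightarrow> A (t + end_period l) = A t"
    and bound: "\<And>t x. t \<in> end_strip l r \<Longrightarrow> norm (A t *v x) \<le> M * norm x"
    and lim: "\<And>i j. ((\<lambda>s. A (end_ray l s) $ i $ j) \<longlongrightarrow> A0 $ i $ j) at_top"
    and diag: "nearly_diagonalizable A0 d"
    and hyp: "\<And>i. d i \<noteq> 0" "card {i. d i < 0} \<le> 2" "card {i. 0 < d i} \<le> 2"
begin

lemma solution_unique:
  assumes "linear_ode_solution A \<xi> (end_overlap l r)" "linear_ode_solution A \<eta> (end_overlap l r)"
    and "p \<in> end_overlap l r" "q \<in> end_overlap l r" "\<xi> p = \<eta> p"
  shows "\<xi> q = \<eta> q"
proof (rule linear_ode_unique[OF assms(1,2) _ _ assms(5)])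
  show sub: "closed_segment p q \<subseteq> end_overlap l r"
    using convex_end_overlap[OF l] assms(3,4) by (rule closed_segment_subset[rotated 2])
  show "norm (A t *v x) \<le> M * norm x" if "t \<in> closed_segment p q" for t x
    using sub that by (intro bound) (auto simp: end_overlap_def)
qed

text \<open>Along the ray, \<open>dependent_bounded_solutions\<close> yields a linear relation; by uniqueness it persists
  on the overlap.\<close>

lemma bounded_solutions_dependent:
  fixes u :: "nat \<Rightarrow> complex \<Rightarrow> complex ^ 'n"
  assumes sol: "\<And>j. j < 3 \<Longrightarrow> linear_ode_solution A (u j) (end_overlap l r)"
    and bdd: "\<And>j. j < 3 \<Longrightarrow> bounded_on_ray l (u j)"
  shows "\<exists>c. (\<exists>j<3. c j \<noteq> 0) \<and> (\<forall>t\<in>end_overlap l r. (\<Sum>j<3. c j *s u j t) = 0)"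
proof -
  define a where "a = - sgn l"
  have a: "a \<noteq> 0" "\<bar>a\<bar> = 1" using l by (auto simp: a_def sgn_if)
  have ray: "end_ray l s = 0 + of_real s * of_real a" for s by (simp add: end_ray_def a_def)
  obtain T1 where T1: "\<And>j. j < 3 \<Longrightarrow> bounded ((\<lambda>s. u j (end_ray l s)) ` {T1 j..})"
    using bdd unfolding bounded_on_ray_def by metis
  define T0 where "T0 = Max ({T1 0, T1 1, T1 2} \<union> {1 - ln r / \<bar>l\<bar>})"
  have T0: "T1 j \<le> T0" if "j < 3" for j
  proof -
    have "j = 0 \<or> j = 1 \<or> j = 2" using that by auto
    then show ?thesis unfolding T0_def by (intro Max_ge) auto
  qed
  have T0': "1 - ln r / \<bar>l\<bar> \<le> T0" unfolding T0_def by (intro Max_ge) auto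
  have in_ov: "end_ray l s \<in> end_overlap l r" "end_ray l s \<in> end_strip l r" if "T0 \<le> s" for s
    using end_ray_in[OF l r, of s] that T0' by auto
  let ?A = "\<lambda>s. \<chi> i j. of_real a * A (end_ray l s) $ i $ j"
  let ?Alim = "\<chi> i j. of_real a * A0 $ i $ j"
  have Av: "?A s *v x = of_real a *s (A (end_ray l s) *v x)" for s x
    by (simp add: vec_eq_iff matrix_vector_mult_def sum_distrib_left mult.assoc)
  have "\<exists>c. (\<exists>j\<in>{..<3}. c j \<noteq> 0) \<and> (\<forall>s\<ge>T0. (\<Sum>j\<in>{..<3}. c j *s u j (end_ray l s)) = 0)"
  proof (rule dependent_bounded_solutions[where A = ?A and ?A0.0 = ?Alim and M = M and d = "\<lambda>i. a * d i" and u = "\<lambda>j s. u j (end_ray l s)"])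
    show "((\<lambda>s. ?A s $ i $ j) \<longlongrightarrow> ?Alim $ i $ j) at_top" for i j
      unfolding vec_lambda_beta by (intro tendsto_mult tendsto_const lim)
    show "norm (?A s *v x) \<le> M * norm x" if "T0 \<le> s" for s x
      using bound[OF in_ov(2)[OF that], of x] a(2) by (simp add: Av norm_smult_vec)
    show "a * d i \<noteq> 0" for i using hyp(1) a by simp
    show "card {i. a * d i < 0} < card {..<3::nat}"
      using hyp(2,3) l by (cases "0 < l") (auto simp: a_def)
    show "nearly_diagonalizable ?Alim (\<lambda>i. a * d i)" by (rule nearly_diagonalizable_scale[OF diag])
    show "((\<lambda>s. u j (end_ray l s)) has_vector_derivative ?A s *v u j (end_ray l s)) (at s)"
      if "j \<in> {..<3}" "T0 \<le> s" for j s
      using linear_ode_solution_vector_derivative[of A "u j" "end_overlap l r" 0 s "of_real a"] sol[of j] in_ov(1)[OF that(2)] that(1)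
      unfolding Av unfolding ray by simp
    show "bounded ((\<lambda>s. u j (end_ray l s)) ` {T0..})" if "j \<in> {..<3}" for j
      using T1[of j] T0[of j] that by (intro bounded_subset[OF T1[of j]] image_mono) auto
  qed simp
  then obtain c where c: "\<exists>j<3. c j \<noteq> 0" "\<And>s. T0 \<le> s \<Longrightarrow> (\<Sum>j<3. c j *s u j (end_ray l s)) = 0" by auto
  have "(\<Sum>j<3. c j *s u j t) = 0" if "t \<in> end_overlap l r" for t
  proof (rule solution_unique[of "\<lambda>t. \<Sum>j<3. c j *s u j t" "\<lambda>t. 0"])
    show "linear_ode_solution A (\<lambda>t. \<Sum>j<3. c j *s u j t) (end_overlap l r)"
      using sol by (intro linear_ode_solution_sum) auto
    show "linear_ode_solution A (\<lambda>t. 0) (end_overlap l r)"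
      by (simp add: linear_ode_solution_def)
    show "end_ray l T0 \<in> end_overlap l r" using in_ov by simp
    show "(\<Sum>j<3. c j *s u j (end_ray l T0)) = 0" using c(2) by simp
  qed (rule that)
  then show ?thesis using c(1) by blast
qed

lemma bounded_solution_in_span:
  assumes sol: "linear_ode_solution A u0 (end_overlap l r)" "linear_ode_solution A u1 (end_overlap l r)"
      "linear_ode_solution A w (end_overlap l r)"
    and bdd: "bounded_on_ray l u0" "bounded_on_ray l u1" "bounded_on_ray l w"
    and p: "p \<in> end_overlap l r"
    and indep: "\<And>a b. a *s u0 p + b *s u1 p = 0 \<Longrightarrow> a = 0 \<and> b = 0"
  obtains a b where "w p = a *s u0 p + b *s u1 p"
proof -
  define u where "u j = (if j = 0 then u0 else if j = 1 then u1 else w)" for j :: nat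
  have "\<exists>c. (\<exists>j<3. c j \<noteq> 0) \<and> (\<forall>t\<in>end_overlap l r. (\<Sum>j<3. c j *s u j t) = 0)"
    using sol bdd by (intro bounded_solutions_dependent) (auto simp: u_def)
  then obtain c where c: "\<exists>j<3. c j \<noteq> 0" "(\<Sum>j<3. c j *s u j p) = 0" using p by blast
  then have eq: "c 0 *s u0 p + c 1 *s u1 p + c 2 *s w p = 0"
    by (simp add: u_def eval_nat_numeral lessThan_Suc add_ac)
  have "c 2 \<noteq> 0"
  proof
    assume "c 2 = 0"
    then have "c 0 = 0 \<and> c 1 = 0" using indep[of "c 0" "c 1"] eq by simp
    then show False using c(1) \<open>c 2 = 0\<close> by (auto simp: eval_nat_numeral less_Suc_eq)
  qed
  have "w p = (- c 0 / c 2) *s u0 p + (- c 1 / c 2) *s u1 p"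
  proof (rule vec_eq_iff[THEN iffD2], rule allI)
    fix i
    have "c 0 * u0 p $ i + c 1 * u1 p $ i + c 2 * w p $ i = 0"
      using arg_cong[OF eq, of "\<lambda>x. x $ i"] by simp
    then have "c 2 * w p $ i = - (c 0 * u0 p $ i) - c 1 * u1 p $ i" by (simp add: eq_neg_iff_add_eq_0 algebra_simps)
    then show "w p $ i = ((- c 0 / c 2) *s u0 p + (- c 1 / c 2) *s u1 p) $ i"
      using \<open>c 2 \<noteq> 0\<close> by (simp add: field_simps)
  qed
  then show ?thesis using that by blast
qed

text \<open>The translation leads along a segment of fixed length, on which a solution grows by a bounded
  factor.\<close>

lemma bounded_on_ray_shift:
  assumes sol: "linear_ode_solution A u (end_strip l r)" and "bounded_on_ray l u"
  shows "bounded_on_ray l (\<lambda>t. u (t + end_period l))"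
proof -
  obtain T where T: "bounded ((\<lambda>s. u (end_ray l s)) ` {T..})" using assms(2) by (auto simp: bounded_on_ray_def)
  then obtain B where B: "\<And>s. T \<le> s \<Longrightarrow> norm (u (end_ray l s)) \<le> B" by (auto simp: bounded_iff)
  define T' where "T' = max T (1 - ln r / \<bar>l\<bar>)"
  have "norm (u (end_ray l s + end_period l)) \<le> exp (M * norm (end_period l)) * B" if "T' \<le> s" for s
  proof -
    have in_s: "end_ray l s \<in> end_overlap l r" using that by (intro end_ray_in[OF l r]) (auto simp: T'_def)
    have sub: "closed_segment (end_ray l s) (end_ray l s + end_period l) \<subseteq> end_strip l r"
      using in_s by (intro closed_segment_subset convex_end_strip) (auto simp: end_overlap_def)
    have "norm (u (end_ray l s + end_period l))
        \<le> exp (M * norm (end_ray l s + end_period l - end_ray l s)) * norm (u (end_ray l s))"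
      by (rule linear_ode_growth[OF sol sub bound]) (use sub in auto)
    also have "\<dots> \<le> exp (M * norm (end_ray l s + end_period l - end_ray l s)) * B"
      using B[of s] that by (intro mult_left_mono) (auto simp: T'_def)
    finally show ?thesis by simp
  qed
  then have "bounded ((\<lambda>s. u (end_ray l s + end_period l)) ` {T'..})"
    unfolding bounded_iff by (intro exI[of _ "exp (M * norm (end_period l)) * B"]) auto
  then show ?thesis by (auto simp: bounded_on_ray_def)
qed

end

text \<open>The rows \<open>0\<close> and \<open>1\<close> of \<open>V\<close> span the solutions that are bounded into the end. The translate of row \<open>1\<close> and
  the remainder of the translate of row \<open>2\<close> are such solutions, and the last row may be mapped
  anywhere. So the rows form a flag that is invariant under translation.\<close>

lemma triangular_monodromy:
  fixes A :: "complex \<Rightarrow> complex ^ 4 ^ 4" and V :: "complex \<Rightarrow> complex ^ 4 ^ 4"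
  assumes sys: "end_system A A0 l r M d"
    and sol: "\<And>i. linear_ode_solution A (\<lambda>t. V t $ i) (end_strip l r)"
    and det: "\<And>t. t \<in> end_strip l r \<Longrightarrow> det (V t) \<noteq> 0"
    and per: "\<And>t. t \<in> end_overlap l r \<Longrightarrow> V (t + end_period l) $ 0 = V t $ 0"
    and bdd: "bounded_on_ray l (\<lambda>t. V t $ 0)" "bounded_on_ray l (\<lambda>t. V t $ 1)"
    and grow: "bounded_on_ray l (\<lambda>t. V (t + end_period l) $ 2 - m *s V t $ 2)"
  shows "\<exists>C. (\<forall>i j. i < j \<longrightarrow> C $ i $ j = 0) \<and> (\<forall>i. C $ i $ i \<noteq> 0) \<and>
        (\<forall>t. t \<in> end_strip l r \<longrightarrow> t + end_period l \<in> end_strip l r \<longrightarrow> V (t + end_period l) = C ** V t)"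
proof -
  interpret end_system A A0 l r M d by (rule sys)
  let ?O = "end_overlap l r" and ?T = "end_period l"
  obtain p where p: "p \<in> ?O" using end_ray_in(1)[OF l r, of "1 - ln r / \<bar>l\<bar>"] by auto
  have pE: "p \<in> end_strip l r" "p + ?T \<in> end_strip l r" using p by (auto simp: end_overlap_def)
  have sol_O: "linear_ode_solution A (\<lambda>t. V t $ i) ?O" for i
    by (rule linear_ode_solution_subset[OF sol]) (auto simp: end_overlap_def)
  have sol_T: "linear_ode_solution A (\<lambda>t. V (t + ?T) $ i) ?O" for i
    by (rule linear_ode_solution_shift[OF sol]) (use period in \<open>auto simp: end_overlap_def\<close>)
  have Vinv: "invertible (V p)" using det[OF pE(1)] by (simp add: invertible_det_nz)
  define C where "C = V (p + ?T) ** matrix_inv (V p)"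
  have CV: "C ** V p = V (p + ?T)"
    unfolding C_def using invertible_matrix_inv(2)[OF Vinv] by (metis matrix_mul_assoc matrix_mul_rid)
  have row_mult: "(C ** W) $ i = (\<Sum>j\<in>UNIV. C $ i $ j *s W $ j)" for C W :: "complex ^ 4 ^ 4" and i
    by (simp add: vec_eq_iff matrix_matrix_mult_def)
  have shift: "V (t + ?T) = C ** V t" if t: "t \<in> ?O" for t
  proof (rule vec_eq_iff[THEN iffD2], rule allI)
    fix i
    show "V (t + ?T) $ i = (C ** V t) $ i"
      unfolding row_mult
    proof (rule solution_unique[OF sol_T _ p t])
      show "linear_ode_solution A (\<lambda>t. \<Sum>j\<in>UNIV. C $ i $ j *s V t $ j) ?O"
        by (intro linear_ode_solution_sum sol_O)
      show "V (p + ?T) $ i = (\<Sum>j\<in>UNIV. C $ i $ j *s V p $ j)" unfolding CV[symmetric] row_mult ..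
    qed
  qed
  have coeff: "C $ i = (\<chi> j. c j)" if "V (p + ?T) $ i = (\<Sum>j\<in>UNIV. c j *s V p $ j)" for i and c :: "4 \<Rightarrow> complex"
  proof -
    define D where "D = (\<chi> i'. if i' = i then (\<chi> j. c j) else C $ i')"
    have "(D ** V p) $ i' = (C ** V p) $ i'" for i'
      using that unfolding row_mult CV[symmetric] by (cases "i' = i") (auto simp: D_def row_mult CV)
    then have "D ** V p = C ** V p" by (simp add: vec_eq_iff)
    then have "D = C" by (metis invertible_matrix_inv(1)[OF Vinv] matrix_mul_assoc matrix_mul_rid)
    moreover have "D $ i = (\<chi> j. c j)" by (simp add: D_def)
    ultimately show ?thesis by simp
  qed
  have less4: "(0::4) < 1" "(1::4) < 2" "(2::4) < 3" "(0::4) < 2" "(0::4) < 3" "(1::4) < 3"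
    by (simp_all add: less_bit0_def bit0.Rep_numeral bit0.Rep_0 bit0.Rep_1)
  \<comment> \<open>in the type \<open>4\<close> the library enumerates the indices as 1, 2, 3, 4; in the order of the type, \<open>4 = 0\<close>
    comes first\<close>
  have four: "(4::4) = 0" by simp
  have all4: "(\<forall>i::4. P i) \<longleftrightarrow> P 0 \<and> P 1 \<and> P 2 \<and> P 3" for P
    unfolding forall_4 four by blast
  have sum4: "(\<Sum>j\<in>UNIV. f j) = f 0 + f 1 + f 2 + f 3" for f :: "4 \<Rightarrow> (complex, 4) vec"
    unfolding sum_4 four by (simp add: add_ac)
  have indep: "a = 0 \<and> b = 0" if "a *s V p $ 0 + b *s V p $ 1 = 0" for a b
  proof -
    define x where "x = (\<chi> j::4. if j = 0 then a else if j = 1 then b else 0)"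
    have "x v* V p = 0"
    proof -
      have "x v* V p = (\<Sum>j\<in>UNIV. x $ j *s V p $ j)"
        by (simp add: vec_eq_iff vector_matrix_mult_def mult.commute)
      also have "\<dots> = 0" using that by (simp add: sum4 x_def)
      finally show ?thesis .
    qed
    then have "transpose (V p) *v x = 0" by simp
    moreover have "invertible (transpose (V p))" using Vinv by (simp add: invertible_det_nz)
    ultimately have "x = 0" using inj_matrix_vector_mult by (metis injD matrix_vector_mult_0_right)
    then have "x $ 0 = 0" "x $ 1 = 0" by auto
    then show ?thesis by (simp add: x_def)
  qed
  have C0: "C $ 0 = (\<chi> j. if j = 0 then 1 else 0)"
    using per[OF p] by (intro coeff) (simp add: sum4)
  obtain a1 b1 where "V (p + ?T) $ 1 = a1 *s V p $ 0 + b1 *s V p $ 1"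
    using bounded_solution_in_span[OF sol_O sol_O sol_T bdd bounded_on_ray_shift[OF sol bdd(2)] p indep] .
  then have C1: "C $ 1 = (\<chi> j. if j = 0 then a1 else if j = 1 then b1 else 0)"
    by (intro coeff) (simp add: sum4)
  have sol_diff: "linear_ode_solution A (\<lambda>t. V (t + ?T) $ 2 - m *s V t $ 2) ?O"
  proof -
    have "linear_ode_solution A (\<lambda>t. \<Sum>j\<in>{()}. m *s V t $ 2) ?O" by (intro linear_ode_solution_sum sol_O)
    then show ?thesis by (intro linear_ode_solution_diff sol_T) simp
  qed
  obtain a2 b2 where "V (p + ?T) $ 2 - m *s V p $ 2 = a2 *s V p $ 0 + b2 *s V p $ 1"
    using bounded_solution_in_span[OF sol_O sol_O sol_diff bdd grow p indep] .
  then have "V (p + ?T) $ 2 = a2 *s V p $ 0 + b2 *s V p $ 1 + m *s V p $ 2" by (simp add: algebra_simps)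
  then have C2: "C $ 2 = (\<chi> j. if j = 0 then a2 else if j = 1 then b2 else if j = 2 then m else 0)"
    by (intro coeff) (simp add: sum4)
  have lower: "C $ i $ j = 0" if "i < j" for i j
  proof -
    have "\<forall>i j. i < j \<longrightarrow> C $ i $ j = 0"
      unfolding all4 using less4 by (auto simp: C0 C1 C2 not_less_iff_gr_or_eq dest: less_asym)
    then show ?thesis using that by blast
  qed
  have "det C * det (V p) = det (V (p + ?T))" by (simp flip: CV add: det_mul)
  then have "det C \<noteq> 0" using det pE by auto
  moreover have "det C = (\<Prod>i\<in>UNIV. C $ i $ i)" by (rule det_lowerdiagonal) (rule lower)
  ultimately have "C $ i $ i \<noteq> 0" for i by auto
  then show ?thesis using lower shift by (auto simp: end_overlap_def)
qed

text \<open>An identity between functions of the principal logarithm near \<open>z = 0\<close> holds in a narrower strip, and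
  then in the whole strip by the identity theorem.\<close>

lemma strip_identity:
  fixes f g :: "complex \<Rightarrow> complex"
  assumes l: "l \<noteq> 0" and r: "0 < r"
    and f: "f holomorphic_on end_strip l r" and g: "g holomorphic_on end_strip l r"
    and eq: "\<forall>\<^sub>F z in at 0. f (Ln z / of_real l) = g (Ln z / of_real l)" and t: "t \<in> end_strip l r"
  shows "f t = g t"
proof -
  obtain e where e: "0 < e" "\<And>z. z \<noteq> 0 \<Longrightarrow> norm z < e \<Longrightarrow> f (Ln z / of_real l) = g (Ln z / of_real l)"
    using eq unfolding eventually_at by (auto simp: dist_norm)
  define S where "S = end_strip l (min r e) \<inter> {t. \<bar>l * Im t\<bar> < pi}"
  have "open S" unfolding S_def by (intro open_Int open_end_strip open_Collect_less continuous_intros)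
  moreover have "end_ray l (1 - ln (min r e) / \<bar>l\<bar>) \<in> S"
    using end_ray_in(2)[OF l, of "min r e"] r e(1) by (simp add: S_def) (simp add: end_ray_def)
  then have "S \<noteq> {}" by blast
  moreover have "S \<subseteq> end_strip l r" by (auto simp: S_def end_strip_def)
  moreover have "f s = g s" if "s \<in> S" for s
  proof -
    have "Ln (exp (of_real l * s)) = of_real l * s"
      using that by (intro Ln_exp) (auto simp: S_def abs_less_iff)
    moreover have "norm (exp (of_real l * s)) < e" using that by (simp add: S_def end_strip_def)
    ultimately show ?thesis using e(2)[of "exp (of_real l * s)"] l by simp
  qed
  ultimately show ?thesis
    using analytic_continuation_open[of S "end_strip l r" f g t] open_end_strip[of l r]
      convex_connected[OF convex_end_strip[of l r]] f g t by blast
qed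

lemma vec_holomorphic_bounded:
  assumes b: "vec_holomorphic_on b U" and U: "cball 0 r \<subseteq> U"
  obtains B where "\<And>z. norm z \<le> r \<Longrightarrow> norm (b z) \<le> B"
proof -
  have "\<exists>B. \<forall>z. norm z \<le> r \<longrightarrow> norm (b z $ i) \<le> B" for i
  proof -
    have "continuous_on (cball 0 r) (\<lambda>z. b z $ i)"
      using b U by (auto simp: vec_holomorphic_on_def intro: holomorphic_on_imp_continuous_on holomorphic_on_subset)
    then have "bounded ((\<lambda>z. b z $ i) ` cball 0 r)"
      by (intro compact_imp_bounded compact_continuous_image) auto
    then obtain C where "\<forall>z\<in>cball 0 r. norm (b z $ i) \<le> C" by (auto simp: bounded_iff)
    then show ?thesis by (auto intro!: exI[of _ C])
  qed
  then obtain B where B: "\<And>i z. norm z \<le> r \<Longrightarrow> norm (b z $ i) \<le> B i" by metis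
  have "norm (b z) \<le> (\<Sum>i\<in>UNIV. B i)" if "norm z \<le> r" for z
    using norm_le_sum_components[of "b z"] sum_mono[of UNIV "\<lambda>i. norm (b z $ i)" B] B[OF that] by (auto intro: order_trans)
  then show ?thesis using that by blast
qed

text \<open>In the strip, the expansion has the form \<open>exp (k * t) *s a z + g t\<close> with \<open>g\<close> bounded: the exponents of
  the remaining terms have the sign of decay, and the logarithmic term is bounded because \<open>z * Ln z\<close> is.
  The first term is multiplied by a constant in a turn around the end, as \<open>a\<close> is a function of \<open>z\<close>; on
  the ray it grows, because \<open>a 0\<close> is not zero.\<close>

lemma end_expansion_shift_and_growth:
  fixes \<phi> :: "complex \<Rightarrow> complex ^ 'n"
  assumes l: "l \<noteq> 0" and U: "open U" "0 \<in> U" and ex: "end_expansion U l k m1 m2 \<phi>"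
    and sign: "k * l < 0" "0 < m1 * l" "0 < m2 * l"
    and r0: "0 < r0" and hol: "\<And>i. (\<lambda>t. \<phi> t $ i) holomorphic_on end_strip l r0"
  obtains r h B where "0 < r" "r \<le> r0"
    "\<And>t. t \<in> end_overlap l r \<Longrightarrow> \<phi> (t + end_period l) = exp (of_real k * end_period l) *s \<phi> t + h t"
    "\<And>t. t \<in> end_overlap l r \<Longrightarrow> norm (h t) \<le> B"
    "filterlim (\<lambda>s. norm (\<phi> (end_ray l s))) at_top at_top"
proof -
  let ?T = "end_period l"
  obtain a b1 b2 where hol_ab: "vec_holomorphic_on a U" "vec_holomorphic_on b1 U" "vec_holomorphic_on b2 U"
    and a0: "a 0 \<noteq> 0"
    and alt: "(\<forall>\<^sub>F z in at 0. \<phi> (Ln z / of_real l) =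
              (z powr of_real (k / l)) *s a z + (z powr of_real (m1 / l)) *s b1 z + (z powr of_real (m2 / l)) *s b2 z)
         \<or> (\<forall>\<^sub>F z in at 0. \<phi> (Ln z / of_real l) =
                 (z powr of_real (k / l)) *s a z + z *s b1 z + (z * Ln z) *s b2 z)"
    using ex unfolding end_expansion_def by blast
  obtain r1 where r1: "0 < r1" "cball 0 r1 \<subseteq> U" using U open_contains_cball by blast
  define r where "r = min (min r0 r1) 1"
  have r: "0 < r" "r \<le> r0" "r \<le> 1" "cball 0 r \<subseteq> U"
    using r0 r1 by (auto simp: r_def)
  let ?E = "end_strip l r"
  let ?z = "\<lambda>t. exp (of_real l * t) :: complex"
  have z_in: "norm (?z t) \<le> r" if "t \<in> ?E" for t using that by (simp add: end_strip_def)
  have hol_comp: "(\<lambda>t. b (?z t) $ i) holomorphic_on ?E" if "vec_holomorphic_on b U" for b :: "complex \<Rightarrow> complex ^ 'n" and i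
  proof -
    have "((\<lambda>z. b z $ i) \<circ> ?z) holomorphic_on ?E"
    proof (rule holomorphic_on_compose_gen)
      show "(\<lambda>z. b z $ i) holomorphic_on U" using that by (simp add: vec_holomorphic_on_def)
      show "?z ` ?E \<subseteq> U" using z_in r(4) by auto
    qed (intro holomorphic_intros)
    then show ?thesis by (simp add: o_def)
  qed
  have powr: "z powr of_real (m / l) = exp (of_real m * (Ln z / of_real l))" if "z \<noteq> 0" for z :: complex and m
    using that l by (simp add: powr_def field_simps)
  have neg: "l * Re t \<le> 0" if "t \<in> ?E" for t
  proof -
    have "l * Re t < ln r" using that end_strip_iff[OF r(1)] by blast
    also have "ln r \<le> 0" using r by simp
    finally show ?thesis by simp
  qed
  have exp_le: "norm (exp (of_real m * t)) \<le> 1" if "t \<in> ?E" "0 < m * l" for t m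
  proof -
    have "m * Re t = (m * l) * (l * Re t) / l\<^sup>2" using l by (simp add: power2_eq_square)
    also have "\<dots> \<le> 0"
      using neg[OF that(1)] that(2) mult_nonneg_nonpos[of "m * l" "l * Re t"] by (intro divide_nonpos_nonneg) auto
    finally show ?thesis by simp
  qed
  obtain B1 where B1: "\<And>z. norm z \<le> r \<Longrightarrow> norm (b1 z) \<le> B1" using vec_holomorphic_bounded[OF hol_ab(2) r(4)] by metis
  obtain B2 where B2: "\<And>z. norm z \<le> r \<Longrightarrow> norm (b2 z) \<le> B2" using vec_holomorphic_bounded[OF hol_ab(3) r(4)] by metis
  have Bpos: "0 \<le> B1" "0 \<le> B2" using B1[of 0] B2[of 0] r(1) norm_ge_zero order_trans by (metis less_imp_le norm_zero)+
  have "\<exists>g C. (\<forall>i. (\<lambda>t. g t $ i) holomorphic_on ?E) \<and> (\<forall>t\<in>?E. norm (g t) \<le> C) \<and>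
      (\<forall>\<^sub>F z in at 0. \<phi> (Ln z / of_real l) =
         exp (of_real k * (Ln z / of_real l)) *s a (?z (Ln z / of_real l)) + g (Ln z / of_real l))"
    using alt
  proof
    assume ev: "\<forall>\<^sub>F z in at 0. \<phi> (Ln z / of_real l) =
              (z powr of_real (k / l)) *s a z + (z powr of_real (m1 / l)) *s b1 z + (z powr of_real (m2 / l)) *s b2 z"
    define g where "g t = exp (of_real m1 * t) *s b1 (?z t) + exp (of_real m2 * t) *s b2 (?z t)" for t
    have "norm (g t) \<le> B1 + B2" if t: "t \<in> ?E" for t
    proof -
      have "norm (exp (of_real m1 * t) *s b1 (?z t)) \<le> 1 * B1" "norm (exp (of_real m2 * t) *s b2 (?z t)) \<le> 1 * B2"
        unfolding norm_smult_vec by (intro mult_mono exp_le B1 B2 z_in t sign; simp)+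
      then show ?thesis unfolding g_def by (intro norm_triangle_le) simp
    qed
    moreover have "(\<lambda>t. g t $ i) holomorphic_on ?E" for i
      unfolding g_def vector_add_component vector_smult_component
      by (intro holomorphic_intros hol_comp hol_ab)
    moreover have "\<forall>\<^sub>F z in at 0. \<phi> (Ln z / of_real l) =
         exp (of_real k * (Ln z / of_real l)) *s a (?z (Ln z / of_real l)) + g (Ln z / of_real l)"
      using ev eventually_neq_at_within[of 0 0 UNIV]
    proof eventually_elim
      case (elim z)
      have "?z (Ln z / of_real l) = z" "of_real l * (Ln z / of_real l) = Ln z" using l elim(2) by simp_all
      then show ?case using elim(1) unfolding powr[OF elim(2)] g_def by (simp only: add.assoc)
    qed
    ultimately show ?thesis by blast
  next
    assume ev: "\<forall>\<^sub>F z in at 0. \<phi> (Ln z / of_real l) = (z powr of_real (k / l)) *s a z + z *s b1 z + (z * Ln z) *s b2 z"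
    define g where "g t = ?z t *s b1 (?z t) + (?z t * (of_real l * t)) *s b2 (?z t)" for t
    have "norm (g t) \<le> B1 + (1 + 4 * pi) * B2" if t: "t \<in> ?E" for t
    proof -
      have z1: "norm (?z t) \<le> 1" using neg[OF t] by simp
      have "norm (?z t * (of_real l * t)) \<le> 1 + 4 * pi"
      proof -
        define x where "x = l * Re t"
        have x: "x \<le> 0" using neg[OF t] by (simp add: x_def)
        have "norm (of_real l * t) \<le> \<bar>l * Re t\<bar> + \<bar>l * Im t\<bar>"
          using cmod_le[of "of_real l * t"] by simp
        also have "\<dots> \<le> - x + 4 * pi" using t x by (simp add: x_def end_strip_def)
        finally have n: "norm (of_real l * t) \<le> - x + 4 * pi" .
        have "norm (?z t * (of_real l * t)) = exp x * norm (of_real l * t)" by (simp add: norm_mult x_def)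
        also have "\<dots> \<le> exp x * (- x + 4 * pi)" by (intro mult_left_mono n) auto
        also have "\<dots> = exp x * (- x) + exp x * (4 * pi)" by (simp only: distrib_left)
        also have "exp x * (- x) \<le> exp x * exp (- x)"
          using exp_ge_add_one_self[of "- x"] by (intro mult_left_mono) auto
        also have "exp x * exp (- x) = 1" by (simp add: mult_exp_exp)
        also have "exp x * (4 * pi) \<le> 1 * (4 * pi)" using x by (intro mult_right_mono) auto
        finally show ?thesis by simp
      qed
      then have "norm (?z t *s b1 (?z t)) \<le> 1 * B1" "norm ((?z t * (of_real l * t)) *s b2 (?z t)) \<le> (1 + 4 * pi) * B2"
        unfolding norm_smult_vec using z1 pi_gt_zero
        by (intro mult_mono B1 B2 z_in t; simp)+
      then show ?thesis unfolding g_def by (intro norm_triangle_le) simp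
    qed
    moreover have "(\<lambda>t. g t $ i) holomorphic_on ?E" for i
      unfolding g_def vector_add_component vector_smult_component
      by (intro holomorphic_intros hol_comp hol_ab)
    moreover have "\<forall>\<^sub>F z in at 0. \<phi> (Ln z / of_real l) =
         exp (of_real k * (Ln z / of_real l)) *s a (?z (Ln z / of_real l)) + g (Ln z / of_real l)"
      using ev eventually_neq_at_within[of 0 0 UNIV]
    proof eventually_elim
      case (elim z)
      have "?z (Ln z / of_real l) = z" "of_real l * (Ln z / of_real l) = Ln z" using l elim(2) by simp_all
      then show ?case using elim(1) unfolding powr[OF elim(2)] g_def by (simp only: add.assoc)
    qed
    ultimately show ?thesis by blast
  qed
  then obtain g C where g_hol: "\<And>i. (\<lambda>t. g t $ i) holomorphic_on ?E" and gC: "\<And>t. t \<in> ?E \<Longrightarrow> norm (g t) \<le> C"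
    and ev: "\<forall>\<^sub>F z in at 0. \<phi> (Ln z / of_real l) =
         exp (of_real k * (Ln z / of_real l)) *s a (?z (Ln z / of_real l)) + g (Ln z / of_real l)" by blast
  have phi: "\<phi> t = exp (of_real k * t) *s a (?z t) + g t" if t: "t \<in> ?E" for t
  proof (rule vec_eq_iff[THEN iffD2], rule allI)
    fix i
    show "\<phi> t $ i = (exp (of_real k * t) *s a (?z t) + g t) $ i"
    proof (rule strip_identity[OF l r(1) _ _ _ t])
      show "(\<lambda>t. \<phi> t $ i) holomorphic_on ?E"
        using r(2) by (intro holomorphic_on_subset[OF hol[of i]]) (auto simp: end_strip_def)
      show "(\<lambda>t. (exp (of_real k * t) *s a (?z t) + g t) $ i) holomorphic_on ?E"
        unfolding vector_add_component vector_smult_component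
        by (intro holomorphic_intros hol_comp hol_ab g_hol)
      show "\<forall>\<^sub>F z in at 0. \<phi> (Ln z / of_real l) $ i =
          (exp (of_real k * (Ln z / of_real l)) *s a (?z (Ln z / of_real l)) + g (Ln z / of_real l)) $ i"
        using ev by eventually_elim (simp only:)
    qed
  qed
  define h where "h t = g (t + ?T) - exp (of_real k * ?T) *s g t" for t
  show ?thesis
  proof (rule that[OF r(1,2)])
    fix t assume t: "t \<in> end_overlap l r"
    then have tE: "t \<in> ?E" "t + ?T \<in> ?E" by (auto simp: end_overlap_def)
    have "exp (of_real k * (t + ?T)) = exp (of_real k * ?T) * exp (of_real k * t)"
      by (simp only: distrib_left exp_add mult.commute)
    then show "\<phi> (t + ?T) = exp (of_real k * ?T) *s \<phi> t + h t"
      unfolding phi[OF tE(1)] phi[OF tE(2)] h_def exp_end_period[OF l]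
      by (simp add: vec_eq_iff algebra_simps)
    show "norm (h t) \<le> C + norm (exp (of_real k * ?T)) * C"
      unfolding h_def
      by (intro order_trans[OF norm_triangle_ineq4] add_mono gC tE) (auto simp: norm_smult_vec intro!: mult_left_mono gC tE)
  next
    obtain i where i: "a 0 $ i \<noteq> 0" using a0 by (auto simp: vec_eq_iff)
    define q where "q = \<bar>k\<bar>"
    have q: "0 < q" using sign(1) by (auto simp: q_def)
    have kq: "k * (- sgn l) = q"
      using sign(1) l by (auto simp: q_def sgn_if mult_less_0_iff)
    have z_ray: "?z (end_ray l s) = of_real (exp (- \<bar>l\<bar> * s))" for s
    proof -
      have "of_real l * end_ray l s = of_real (- \<bar>l\<bar> * s)"
        by (simp add: end_ray_def abs_sgn mult_ac)
      then show ?thesis by (simp only: exp_of_real)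
    qed
    have norm_k: "norm (exp (of_real k * end_ray l s)) = exp (q * s)" for s
    proof -
      have "of_real k * end_ray l s = of_real (k * (- sgn l) * s)" by (simp add: end_ray_def)
      then show ?thesis unfolding kq by simp
    qed
    have "((\<lambda>s. a (?z (end_ray l s)) $ i) \<longlongrightarrow> a 0 $ i) at_top"
    proof -
      have "isCont (\<lambda>z. a z $ i) 0"
        using hol_ab(1) U(2) continuous_on_eq_continuous_at[OF U(1)] holomorphic_on_imp_continuous_on
        by (metis vec_holomorphic_on_def)
      moreover have "((\<lambda>s. ?z (end_ray l s)) \<longlongrightarrow> of_real 0) at_top"
        unfolding z_ray using l
        by (intro tendsto_of_real filterlim_compose[OF exp_at_bot] filterlim_tendsto_neg_mult_at_bot[OF tendsto_const] filterlim_ident) auto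
      ultimately show ?thesis by (intro isCont_tendsto_compose[where g = "\<lambda>z. a z $ i"]) auto
    qed
    then have "((\<lambda>s. norm (a (?z (end_ray l s)) $ i)) \<longlongrightarrow> norm (a 0 $ i)) at_top" by (rule tendsto_norm)
    moreover have "filterlim (\<lambda>s. exp (q * s)) at_top at_top"
      using q by (intro filterlim_compose[OF exp_at_top] filterlim_tendsto_pos_mult_at_top[OF tendsto_const] filterlim_ident)
    ultimately have "filterlim (\<lambda>s. norm (a (?z (end_ray l s)) $ i) * exp (q * s)) at_top at_top"
      using i by (intro filterlim_tendsto_pos_mult_at_top) auto
    then have lim: "filterlim (\<lambda>s. - C + norm (a (?z (end_ray l s)) $ i) * exp (q * s)) at_top at_top"
      by (rule filterlim_tendsto_add_at_top[OF tendsto_const])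
    have "\<forall>\<^sub>F s in at_top. - C + norm (a (?z (end_ray l s)) $ i) * exp (q * s) \<le> norm (\<phi> (end_ray l s))"
      using eventually_gt_at_top[of "- ln r / \<bar>l\<bar>"]
    proof eventually_elim
      case (elim s)
      let ?t = "end_ray l s"
      have tE: "?t \<in> ?E" using end_ray_in(2)[OF l r(1) elim] .
      have "norm (a (?z ?t) $ i) * exp (q * s) = norm ((\<phi> ?t - g ?t) $ i)"
        unfolding phi[OF tE] by (simp add: norm_mult norm_k del: norm_exp_eq_Re)
      also have "\<dots> \<le> norm (\<phi> ?t - g ?t)" by (rule Finite_Cartesian_Product.norm_nth_le)
      also have "\<dots> \<le> norm (\<phi> ?t) + norm (g ?t)" by (rule norm_triangle_ineq4)
      also have "\<dots> \<le> norm (\<phi> ?t) + C" using gC[OF tE] by simp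
      finally show ?case by simp
    qed
    then show "filterlim (\<lambda>s. norm (\<phi> (end_ray l s))) at_top at_top"
      by (rule filterlim_at_top_mono[OF lim])
  qed
qed

section \<open>The variational equation along the complexified orbit\<close>

text \<open>A star-shaped neighborhood of the real line on which solutions can be constructed. It widens
  towards the ends, so that it eventually contains strips of any fixed height, and thus full turns
  around the ends.\<close>

definition wedge :: "real \<Rightarrow> complex set" where
  "wedge w = {t. \<bar>Im t\<bar> < w * (1 + \<bar>Re t\<bar>)}"

lemma open_wedge: "open (wedge w)"
  unfolding wedge_def by (intro open_Collect_less continuous_intros)

lemma real_in_wedge: "0 < w \<Longrightarrow> of_real s \<in> wedge w"
  by (simp add: wedge_def)

lemma wedge_star:
  assumes "0 < w" "t \<in> wedge w"
  shows "closed_segment 0 t \<subseteq> wedge w"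
proof
  fix x assume "x \<in> closed_segment 0 t"
  then obtain s where s: "0 \<le> s" "s \<le> 1" "x = s *\<^sub>R t" by (auto simp: in_segment)
  have "\<bar>Im x\<bar> = s * \<bar>Im t\<bar>" using s by (simp add: abs_mult)
  also have "\<dots> \<le> s * (w * \<bar>Re t\<bar>) + s * (\<bar>Im t\<bar> - w * \<bar>Re t\<bar>)" by (simp add: algebra_simps)
  also have "\<dots> < s * (w * \<bar>Re t\<bar>) + w"
  proof -
    have "\<bar>Im t\<bar> - w * \<bar>Re t\<bar> < w" using assms(2) by (simp add: wedge_def algebra_simps)
    then have "s * (\<bar>Im t\<bar> - w * \<bar>Re t\<bar>) < w"
      using s assms(1) mult_left_le_one_le[of "\<bar>Im t\<bar> - w * \<bar>Re t\<bar>" s]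
      by (cases "0 \<le> \<bar>Im t\<bar> - w * \<bar>Re t\<bar>") (auto intro: le_less_trans[OF mult_nonneg_nonpos])
    then show ?thesis by simp
  qed
  also have "\<dots> = w * (1 + \<bar>Re x\<bar>)" using s by (simp add: abs_mult algebra_simps)
  finally show "x \<in> wedge w" by (simp add: wedge_def)
qed

lemma end_strip_subset_wedge:
  assumes "l \<noteq> 0" "0 < w" "0 < r" "r \<le> exp (- (4 * pi / w))"
  shows "end_strip l r \<subseteq> wedge w"
proof
  fix t assume "t \<in> end_strip l r"
  then have t: "l * Re t < ln r" "\<bar>l * Im t\<bar> < 4 * pi" using end_strip_iff[OF assms(3)] by blast+
  have "ln r \<le> - (4 * pi / w)" using assms(3,4) by (metis ln_exp ln_le_cancel_iff exp_gt_zero)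
  then have "4 * pi / w < \<bar>l\<bar> * \<bar>Re t\<bar>" using t(1) by (simp flip: abs_mult)
  then have "4 * pi < w * (\<bar>l\<bar> * \<bar>Re t\<bar>)" using assms(2) by (simp add: field_simps)
  then have "\<bar>l\<bar> * \<bar>Im t\<bar> < \<bar>l\<bar> * (w * \<bar>Re t\<bar>)" using t(2) by (simp add: abs_mult mult_ac)
  then have "\<bar>Im t\<bar> < w * \<bar>Re t\<bar>" using assms(1) by simp
  then show "t \<in> wedge w" using assms(2) by (simp add: wedge_def distrib_left)
qed

lemma wedge_in_neighborhood:
  assumes Om: "open \<Omega>" "range complex_of_real \<subseteq> \<Omega>" and T: "0 \<le> T"
  obtains w where "0 < w" "{t. \<bar>Re t\<bar> \<le> T \<and> \<bar>Im t\<bar> \<le> w * (1 + T)} \<subseteq> \<Omega>"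
proof -
  have "compact (complex_of_real ` {- T..T})"
    by (intro compact_continuous_image continuous_intros) auto
  moreover have "complex_of_real ` {- T..T} \<subseteq> \<Omega>" using Om(2) by auto
  ultimately obtain e where e: "0 < e" "(\<Union>x\<in>complex_of_real ` {- T..T}. cball x e) \<subseteq> \<Omega>"
    using compact_subset_open_imp_cball_epsilon_subset[OF _ Om(1)] by blast
  have "t \<in> \<Omega>" if "\<bar>Re t\<bar> \<le> T" "\<bar>Im t\<bar> \<le> e / (1 + T) * (1 + T)" for t
  proof -
    have "t - of_real (Re t) = \<i> * of_real (Im t)" by (simp add: complex_eq_iff)
    then have "dist (of_real (Re t)) t = \<bar>Im t\<bar>" by (simp add: dist_norm norm_minus_commute norm_mult)
    then have "t \<in> cball (of_real (Re t)) e" using that T by simp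
    moreover have "Re t \<in> {- T..T}" using that by (simp add: abs_le_iff)
    ultimately show ?thesis using e(2) by blast
  qed
  then show ?thesis using that[of "e / (1 + T)"] e(1) T by auto
qed

text \<open>At an end the orbit is a function of \<open>z\<close>, with the equilibrium as its value at \<open>0\<close>; this gives
  the periodicity and the bound on the Jacobian.\<close>

lemma orbit_end:
  fixes F :: "complex ^ 'n \<Rightarrow> complex ^ 'n" and X h :: "complex \<Rightarrow> complex ^ 'n"
  assumes W: "open W" "0 \<in> W" and F: "\<And>x. x \<in> W \<Longrightarrow> \<exists>J. (F has_derivative (\<lambda>h. J *v h)) (at x)"
    and l: "l \<noteq> 0" and U: "open U" "0 \<in> U" and h: "vec_holomorphic_on h U"
    and X: "\<And>t. l * Re t < 0 \<Longrightarrow> exp (of_real l * t) \<in> U \<Longrightarrow> t \<in> \<Omega> \<and> X t = h (exp (of_real l * t))"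
    and lim: "((\<lambda>s. X (end_ray l s)) \<longlongrightarrow> 0) at_top"
  obtains r m where "0 < r" "r \<le> 1"
    "\<And>t. norm (exp (of_real l * t)) < r \<Longrightarrow> t \<in> \<Omega>"
    "\<And>t i j. norm (exp (of_real l * t)) < r \<Longrightarrow> norm (jacobian F (at (X t)) $ i $ j) \<le> m"
    "\<And>t. norm (exp (of_real l * t)) < r \<Longrightarrow> X (t + end_period l) = X t"
    "\<And>z. z \<noteq> 0 \<Longrightarrow> norm z < r \<Longrightarrow> X (Ln z / of_real l) = h z"
proof -
  have cont_h: "isCont h 0"
  proof -
    have "isCont (\<lambda>z. h z $ i) 0" for i
      using h U(2) continuous_on_eq_continuous_at[OF U(1)] holomorphic_on_imp_continuous_on
      by (metis vec_holomorphic_on_def)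
    then show ?thesis unfolding isCont_def by (rule vec_tendstoI)
  qed
  obtain r1 where r1: "0 < r1" "ball 0 r1 \<subseteq> U" using U open_contains_ball by blast
  define r2 where "r2 = min r1 1"
  have r2: "0 < r2" "r2 \<le> 1" using r1 by (auto simp: r2_def)
  have X2: "t \<in> \<Omega> \<and> X t = h (exp (of_real l * t))" if "norm (exp (of_real l * t)) < r2" for t
  proof (rule X)
    have "norm (exp (of_real l * t)) < 1" using that r2(2) by (rule less_le_trans)
    then show "l * Re t < 0" by simp
    show "exp (of_real l * t) \<in> U" using that r1(2) by (auto simp: r2_def subset_iff simp del: norm_exp_eq_Re)
  qed
  have "h 0 = 0"
  proof -
    have ev: "\<forall>\<^sub>F s in at_top. X (end_ray l s) = h (exp (of_real l * end_ray l s))"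
      using eventually_gt_at_top[of "- ln r2 / \<bar>l\<bar>"]
      by eventually_elim (use end_ray_in(2)[OF l r2(1)] X2 in \<open>auto simp: end_strip_def simp del: norm_exp_eq_Re\<close>)
    have "of_real l * end_ray l s = of_real (- \<bar>l\<bar> * s)" for s
      by (simp add: end_ray_def abs_sgn mult_ac)
    then have "exp (of_real l * end_ray l s) = of_real (exp (- \<bar>l\<bar> * s))" for s
      by (simp only: exp_of_real)
    then have "((\<lambda>s. exp (of_real l * end_ray l s)) \<longlongrightarrow> of_real 0) at_top"
      using l by (simp only:)
        (intro tendsto_of_real filterlim_compose[OF exp_at_bot] filterlim_tendsto_neg_mult_at_bot[OF tendsto_const] filterlim_ident; simp)
    then have "((\<lambda>s. h (exp (of_real l * end_ray l s))) \<longlongrightarrow> h 0) at_top"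
      using isCont_tendsto_compose[OF cont_h] by simp
    then have "((\<lambda>s. X (end_ray l s)) \<longlongrightarrow> h 0) at_top"
      using ev by (simp add: tendsto_cong)
    then show ?thesis using lim tendsto_unique trivial_limit_at_top_linorder by blast
  qed
  have "isCont (\<lambda>z. jacobian F (at (h z)) $ i $ j) 0" for i j
  proof -
    have "isCont (\<lambda>x. jacobian F (at x) $ i $ j) (h 0)"
      using jacobian_continuous_on[OF W(1) F] W \<open>h 0 = 0\<close> by (simp add: continuous_on_eq_continuous_at)
    then show ?thesis using isCont_o2[OF cont_h, of "\<lambda>x. jacobian F (at x) $ i $ j"] by simp
  qed
  then have "((\<lambda>z. norm (jacobian F (at (h z)) $ i $ j)) \<longlongrightarrow> norm (jacobian F (at (h 0)) $ i $ j)) (at 0)" for i j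
    unfolding isCont_def by (rule tendsto_norm)
  then have "\<forall>\<^sub>F z in at 0. norm (jacobian F (at (h z)) $ i $ j) < norm (jacobian F (at (h 0)) $ i $ j) + 1" for i j
    by (rule order_tendstoD(2)) simp
  then have "\<forall>\<^sub>F z in nhds 0. norm (jacobian F (at (h z)) $ i $ j) < norm (jacobian F (at (h 0)) $ i $ j) + 1" for i j
    by (simp add: eventually_nhds_conv_at)
  then have "\<forall>\<^sub>F z in nhds 0. \<forall>i j. norm (jacobian F (at (h z)) $ i $ j) < norm (jacobian F (at (h 0)) $ i $ j) + 1"
    by (intro eventually_all_finite)
  then obtain r3 where r3: "0 < r3" "\<And>z i j. norm z < r3 \<Longrightarrow> norm (jacobian F (at (h z)) $ i $ j) < norm (jacobian F (at (h 0)) $ i $ j) + 1"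
    unfolding eventually_nhds_metric by (auto simp: dist_norm)
  define m where "m = (\<Sum>i\<in>UNIV. \<Sum>j\<in>UNIV. norm (jacobian F (at (h 0)) $ i $ j)) + 1"
  have m: "norm (jacobian F (at (h 0)) $ i $ j) + 1 \<le> m" for i j
  proof -
    have "norm (jacobian F (at (h 0)) $ i $ j) \<le> (\<Sum>j\<in>UNIV. norm (jacobian F (at (h 0)) $ i $ j))"
      by (rule member_le_sum) auto
    also have "\<dots> \<le> (\<Sum>i\<in>UNIV. \<Sum>j\<in>UNIV. norm (jacobian F (at (h 0)) $ i $ j))"
      by (rule member_le_sum[of i UNIV "\<lambda>i. \<Sum>j\<in>UNIV. norm (jacobian F (at (h 0)) $ i $ j)"]) (auto intro: sum_nonneg)
    finally show ?thesis by (simp add: m_def)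
  qed
  define r where "r = min r2 r3"
  show ?thesis
  proof (rule that[of r m])
    show "0 < r" "r \<le> 1" using r2 r3 by (auto simp: r_def)
    fix t :: complex assume t: "norm (exp (of_real l * t)) < r"
    then have t2: "norm (exp (of_real l * t)) < r2" and t3: "norm (exp (of_real l * t)) < r3" by (simp_all add: r_def)
    show "t \<in> \<Omega>" using X2[OF t2] by blast
    show "norm (jacobian F (at (X t)) $ i $ j) \<le> m" for i j
      using X2[OF t2] r3(2)[OF t3, of i j] m[of i j] by simp
    show "X (t + end_period l) = X t"
      using X2[OF t2] X2[of "t + end_period l"] t2 unfolding exp_end_period[OF l] by simp
  next
    fix z :: complex assume z: "z \<noteq> 0" "norm z < r"
    then have "exp (of_real l * (Ln z / of_real l)) = z" using l by simp
    then show "X (Ln z / of_real l) = h z" using X2[of "Ln z / of_real l"] z by (simp add: r_def)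
  qed
qed

text \<open>The order of the rows is the one required for the flag in the type \<open>4\<close>.\<close>

lemma complete_to_basis:
  fixes u0 u1 u2 :: "complex ^ 4"
  assumes indep: "\<And>a b c. a *s u0 + b *s u1 + c *s u2 = 0 \<Longrightarrow> a = 0 \<and> b = 0 \<and> c = 0"
  obtains x where "det (\<chi> i :: 4. if i = 0 then u0 else if i = 1 then u1 else if i = 2 then u2 else x) \<noteq> 0"
proof -
  let ?R = "\<lambda>x. \<chi> i :: 4. if i = 0 then u0 else if i = 1 then u1 else if i = 2 then u2 else x"
  have four: "(4 :: 4) = 0" by simp
  have sum4: "(\<Sum>j\<in>UNIV. f j) = f 0 + f 1 + f 2 + f 3" for f :: "4 \<Rightarrow> complex ^ 4"
    unfolding sum_4 four by (simp add: add_ac)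
  have row_R: "row i (?R x) = ?R x $ i" for i x by (simp add: row_def vec_eq_iff)
  have ex: "\<exists>x. \<forall>a b c. x \<noteq> a *s u0 + b *s u1 + c *s u2"
  proof (rule ccontr)
    assume "\<not> ?thesis"
    then have all: "\<forall>x. \<exists>a b c. x = a *s u0 + b *s u1 + c *s u2" by blast
    have "surj ((*v) (transpose (?R 0)))"
      unfolding surj_def
    proof
      fix x
      obtain a b c where x: "x = a *s u0 + b *s u1 + c *s u2" using all by blast
      have "transpose (?R 0) *v y = (\<Sum>i\<in>UNIV. y $ i *s ?R 0 $ i)" for y
        by (simp add: vec_eq_iff matrix_vector_mult_def transpose_def mult.commute)
      then have "x = transpose (?R 0) *v (\<chi> i. if i = 0 then a else if i = 1 then b else if i = 2 then c else 0)"
        by (simp add: sum4 x)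
      then show "\<exists>y. x = transpose (?R 0) *v y" by blast
    qed
    then have "invertible (transpose (?R 0))"
      using matrix_right_invertible_surjective[of "transpose (?R 0)"] by (simp add: invertible_right_inverse)
    moreover have "row 3 (?R 0) = 0" by (simp add: row_R)
    then have "det (?R 0) = 0" by (rule det_zero_row(2))
    ultimately show False by (simp add: invertible_det_nz)
  qed
  then obtain x where x: "\<And>a b c. x \<noteq> a *s u0 + b *s u1 + c *s u2" by blast
  have indep_R: "\<forall>i. c i = 0" if c: "(\<Sum>i\<in>UNIV. c i *s row i (?R x)) = 0" for c
  proof -
    have eq: "c 0 *s u0 + c 1 *s u1 + c 2 *s u2 + c 3 *s x = 0" using c unfolding row_R sum4 by simp
    have "c 3 = 0"
    proof (rule ccontr)
      assume c3: "c 3 \<noteq> 0"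
      have "x = (- c 0 / c 3) *s u0 + (- c 1 / c 3) *s u1 + (- c 2 / c 3) *s u2"
      proof (rule vec_eq_iff[THEN iffD2], rule allI)
        fix i
        have "c 0 * u0 $ i + c 1 * u1 $ i + c 2 * u2 $ i + c 3 * x $ i = 0"
          using arg_cong[OF eq, of "\<lambda>v. v $ i"] by simp
        then have "c 3 * x $ i = - (c 0 * u0 $ i) - c 1 * u1 $ i - c 2 * u2 $ i"
          by (simp add: eq_neg_iff_add_eq_0 algebra_simps)
        then have "x $ i = (- (c 0 * u0 $ i) - c 1 * u1 $ i - c 2 * u2 $ i) / c 3"
          by (simp add: nonzero_eq_divide_eq c3 mult.commute[of "x $ i"])
        then show "x $ i = ((- c 0 / c 3) *s u0 + (- c 1 / c 3) *s u1 + (- c 2 / c 3) *s u2) $ i"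
          by (simp add: diff_divide_distrib)
      qed
      then show False using x by blast
    qed
    then have "c 0 = 0 \<and> c 1 = 0 \<and> c 2 = 0" using eq by (intro indep) simp
    then show ?thesis using \<open>c 3 = 0\<close> unfolding forall_4 four by simp
  qed
  have "\<exists>B. ?R x ** B = mat 1"
    unfolding matrix_right_invertible_independent_rows by (intro allI impI indep_R[rule_format])
  then have "invertible (?R x)" unfolding invertible_right_inverse .
  then have "det (?R x) \<noteq> 0" unfolding invertible_det_nz .
  then show ?thesis by (rule that)
qed

lemma tendsto_cvec: "(x \<longlongrightarrow> 0) F \<Longrightarrow> ((\<lambda>s. cvec (x s)) \<longlongrightarrow> 0) F"
  by (intro vec_tendstoI) (use tendsto_of_real[OF tendsto_vec_nth, of x 0 F] in \<open>simp add: cvec_def\<close>)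

theorem theorem1p1:
  fixes f :: "(real ^ 4) \<times> real \<Rightarrow> real ^ 4"
    and F :: "complex ^ 4 \<Rightarrow> complex ^ 4" and W :: "(complex ^ 4) set"
    and xh :: "real \<Rightarrow> real ^ 4"
    and X :: "complex \<Rightarrow> complex ^ 4" and \<Omega> :: "complex set"
    and l1 l2 l3 l4 lp lm lp' lm' :: real
    and U :: "complex set"
    and hp hm \<phi> :: "complex \<Rightarrow> complex ^ 4"
    and \<eta> :: "real \<Rightarrow> complex ^ 4"
  assumes analytic: "real_analytic_on f UNIV"
    and F: "complexification (\<lambda>x. f (x, 0)) F W"
    and X: "complexified_orbit xh X \<Omega>" "X ` \<Omega> \<subseteq> W"
    and B1_equilibrium: "f (0, 0) = 0"
    and B1_homoclinic: "homoclinic_orbit_to_0 (\<lambda>x. f (x, 0)) xh"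
    and B1_eigenvalues:
      "\<forall>s. det (mat s - jacobian (\<lambda>x. f (x, 0)) (at 0)) = (s - l1) * (s - l2) * (s - l3) * (s - l4)"
      "l1 \<le> l2" "l2 < 0" "0 < l3" "l3 \<le> l4"
    and B2_nbhd: "open U" "0 \<in> U"
    and B2_rates: "lp \<in> {l3, l4}" "lm \<in> {l1, l2}"
    and B2_analytic: "vec_holomorphic_on hp U" "vec_holomorphic_on hm U"
    and B2_deriv: "vec_deriv hp 0 \<noteq> 0" "vec_deriv hm 0 \<noteq> 0"
    and B2_pos: "\<forall>t. 0 < Re t \<and> exp (of_real lm * t) \<in> U \<longrightarrow>
                   t \<in> \<Omega> \<and> X t = hp (exp (of_real lm * t))"
    and B2_neg: "\<forall>t. Re t < 0 \<and> exp (of_real lp * t) \<in> U \<longrightarrow>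
                   t \<in> \<Omega> \<and> X t = hm (exp (of_real lp * t))"
    and B3_exponents: "lp' \<in> {l3, l4}" "lm' \<in> {l1, l2}"
    and B3_solution: "ve_solution_on F X \<phi> \<Omega>"
    and B3_pos: "end_expansion U lm lp' l1 l2 \<phi>"
    and B3_neg: "end_expansion U lp lm' l3 l4 \<phi>"
    and C_solution: "ve_solution_real (\<lambda>x. f (x, 0)) xh \<eta>"
    and C_bounded: "bounded (range \<eta>)"
    and C_independent:
      "\<forall>a b :: complex. (\<forall>t. a *s cvec (vector_derivative xh (at t)) + b *s \<eta> t = 0) \<longrightarrow>
          a = 0 \<and> b = 0"
  shows "\<exists>\<epsilon>>0. \<forall>\<Sigma>. gamma_loc lm lp \<epsilon> \<Sigma> \<longrightarrow>
           galois_triangularizable_over_mero TYPE('l::field) lm lp \<Sigma> F (gamma_param hm X hp)"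
proof -
  define g where "g x = f (x, 0)" for x
  have F: "complexification g F W" using F by (simp add: g_def[abs_def])
  then have W: "open W" "range cvec \<subseteq> W" and Fdiff: "\<And>x. x \<in> W \<Longrightarrow> \<exists>J. (F has_derivative (\<lambda>h. J *v h)) (at x)"
    by (auto simp: complexification_def)
  have cvec_0: "cvec 0 = (0 :: complex ^ 4)" by (simp add: cvec_def vec_eq_iff)
  then have W0: "0 \<in> W" using W(2) by (metis rangeI subsetD)
  have Om: "open \<Omega>" "range complex_of_real \<subseteq> \<Omega>" and Xhol: "vec_holomorphic_on X \<Omega>"
    and Xreal: "\<And>t. X (of_real t) = cvec (xh t)"
    using X by (auto simp: complexified_orbit_def)
  have dxh: "\<And>t. (xh has_vector_derivative g (xh t)) (at t)" and xh_top: "(xh \<longlongrightarrow> 0) at_top" and xh_bot: "(xh \<longlongrightarrow> 0) at_bot"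
    using B1_homoclinic by (auto simp: homoclinic_orbit_to_0_def g_def)
  have g0: "g 0 = 0" using B1_equilibrium by (simp add: g_def zero_prod_def)
  define A where "A t = jacobian F (at (X t))" for t
  have A_hol: "(\<lambda>t. A t $ i $ j) holomorphic_on \<Omega>" for i j
    unfolding A_def by (rule jacobian_along_holomorphic[OF W(1) Fdiff Om(1) Xhol X(2)])
  have A_real: "A (of_real t) = map_matrix complex_of_real (jacobian g (at (xh t)))" for t
    unfolding A_def Xreal by (rule complexification_jacobian(2)[OF F])
  have signs: "lm < 0" "0 < lp" "lp' * lm < 0" "0 < l1 * lm" "0 < l2 * lm" "lm' * lp < 0" "0 < l3 * lp" "0 < l4 * lp"
    using B1_eigenvalues B2_rates B3_exponents by (auto intro: mult_pos_neg mult_neg_pos mult_neg_neg)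
  have l: "lm \<noteq> 0" "lp \<noteq> 0" using signs by auto
  have ray_pos: "end_ray lm s = of_real s" and ray_neg: "end_ray lp s = of_real (- s)" for s
    using signs by (simp_all add: end_ray_def)
  have xh_neg: "((\<lambda>s. xh (- s)) \<longlongrightarrow> 0) at_top"
    using xh_bot by (simp add: filterlim_at_bot_mirror)
  have X_lim: "((\<lambda>s. X (end_ray lm s)) \<longlongrightarrow> 0) at_top" "((\<lambda>s. X (end_ray lp s)) \<longlongrightarrow> 0) at_top"
    unfolding ray_pos ray_neg Xreal using tendsto_cvec[OF xh_top] tendsto_cvec[OF xh_neg] by simp_all
  have "t \<in> \<Omega> \<and> X t = hp (exp (of_real lm * t))" if "lm * Re t < 0" "exp (of_real lm * t) \<in> U" for t
    using B2_pos that signs by (simp add: mult_less_0_iff)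
  from orbit_end[OF W(1) W0 Fdiff l(1) B2_nbhd B2_analytic(1) this X_lim(1)]
  obtain rp mp where rp: "0 < rp" "rp \<le> 1" and rp_Om: "\<And>t. norm (exp (of_real lm * t)) < rp \<Longrightarrow> t \<in> \<Omega>"
    and rp_bd: "\<And>t i j. norm (exp (of_real lm * t)) < rp \<Longrightarrow> norm (A t $ i $ j) \<le> mp"
    and rp_per: "\<And>t. norm (exp (of_real lm * t)) < rp \<Longrightarrow> X (t + end_period lm) = X t"
    and rp_h: "\<And>z. z \<noteq> 0 \<Longrightarrow> norm z < rp \<Longrightarrow> X (Ln z / of_real lm) = hp z"
    unfolding A_def by blast
  have "t \<in> \<Omega> \<and> X t = hm (exp (of_real lp * t))" if "lp * Re t < 0" "exp (of_real lp * t) \<in> U" for t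
    using B2_neg that signs by (simp add: mult_less_0_iff)
  from orbit_end[OF W(1) W0 Fdiff l(2) B2_nbhd B2_analytic(2) this X_lim(2)]
  obtain rm mm where rm: "0 < rm" "rm \<le> 1" and rm_Om: "\<And>t. norm (exp (of_real lp * t)) < rm \<Longrightarrow> t \<in> \<Omega>"
    and rm_bd: "\<And>t i j. norm (exp (of_real lp * t)) < rm \<Longrightarrow> norm (A t $ i $ j) \<le> mm"
    and rm_per: "\<And>t. norm (exp (of_real lp * t)) < rm \<Longrightarrow> X (t + end_period lp) = X t"
    and rm_h: "\<And>z. z \<noteq> 0 \<Longrightarrow> norm z < rm \<Longrightarrow> X (Ln z / of_real lp) = hm z"
    unfolding A_def by blast
  \<comment> \<open>beyond \<open>T\<close> the orbit is a function of the coordinate of an end; on the compact rest, the width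
    \<open>w\<close> of the wedge is limited by the domain of the orbit\<close>
  define T where "T = max 0 (max (ln rp / lm) (- ln rm / lp))"
  have far: "norm (exp (of_real lm * t)) < rp \<or> norm (exp (of_real lp * t)) < rm" if "T < \<bar>Re t\<bar>" for t
  proof (cases "0 < Re t")
    case True
    then have "ln rp / lm < Re t" using that by (simp add: T_def)
    then have "lm * Re t < ln rp" using signs(1) by (simp add: field_simps)
    then have "exp (lm * Re t) < exp (ln rp)" by (simp only: exp_less_cancel_iff)
    then show ?thesis using rp(1) by simp
  next
    case False
    then have "- ln rm / lp < - Re t" using that by (simp add: T_def)
    then have "lp * Re t < ln rm" using signs(2) by (simp add: field_simps)
    then have "exp (lp * Re t) < exp (ln rm)" by (simp only: exp_less_cancel_iff)
    then show ?thesis using rm(1) by simp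
  qed
  obtain w where w: "0 < w" "{t. \<bar>Re t\<bar> \<le> T \<and> \<bar>Im t\<bar> \<le> w * (1 + T)} \<subseteq> \<Omega>"
    using wedge_in_neighborhood[OF Om, of T] by (auto simp: T_def)
  let ?B = "{t. \<bar>Re t\<bar> \<le> T \<and> \<bar>Im t\<bar> \<le> w * (1 + T)}"
  define D where "D = wedge w"
  have D_cases: "t \<in> ?B \<or> T < \<bar>Re t\<bar>" if "t \<in> D" for t
  proof (cases "\<bar>Re t\<bar> \<le> T")
    case True
    then have "w * (1 + \<bar>Re t\<bar>) \<le> w * (1 + T)" using w(1) by simp
    then show ?thesis using that True by (simp add: D_def wedge_def)
  qed simp
  have D_Om: "D \<subseteq> \<Omega>" using D_cases w(2) far rp_Om rm_Om by blast
  have D_open: "open D" and D0: "0 \<in> D" and D_real: "range complex_of_real \<subseteq> D"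
    and D_star: "\<And>t. t \<in> D \<Longrightarrow> closed_segment 0 t \<subseteq> D"
    using open_wedge real_in_wedge[OF w(1)] real_in_wedge[OF w(1), of 0] wedge_star[OF w(1)] by (auto simp: D_def)
  have D_conn: "connected D"
    using D_star D0 by (intro starlike_imp_connected) (auto simp: starlike_def)
  obtain m where m: "\<And>t i j. t \<in> D \<Longrightarrow> norm (A t $ i $ j) \<le> m"
  proof -
    have "?B = cbox (Complex (- T) (- (w * (1 + T)))) (Complex T (w * (1 + T)))"
      by (auto simp: in_cbox_complex_iff abs_le_iff)
    then have "compact ?B" by (simp add: compact_cbox)
    have "\<exists>c. \<forall>t\<in>?B. norm (A t $ i $ j) \<le> c" for i j
    proof -
      have "continuous_on ?B (\<lambda>t. A t $ i $ j)"
        using A_hol w(2) holomorphic_on_imp_continuous_on continuous_on_subset by blast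
      then have "bounded ((\<lambda>t. A t $ i $ j) ` ?B)"
        using \<open>compact ?B\<close> by (intro compact_imp_bounded compact_continuous_image)
      then show ?thesis unfolding bounded_iff by blast
    qed
    then obtain c where c: "\<And>t i j. t \<in> ?B \<Longrightarrow> norm (A t $ i $ j) \<le> c i j" by metis
    define m where "m = Max (insert mp (insert mm (range (\<lambda>(i, j). c i j))))"
    have c_range: "c i j \<in> range (\<lambda>(i, j). c i j)" for i j by (rule image_eqI[of _ _ "(i, j)"]) auto
    have m_ge: "mp \<le> m" "mm \<le> m"
      unfolding m_def by (rule Max_ge; simp)+
    have m_ge_c: "c i j \<le> m" for i j
      unfolding m_def by (rule Max_ge, simp) (use c_range[of i j] in blast)
    have "norm (A t $ i $ j) \<le> m" if "t \<in> D" for t i j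
      using D_cases[OF that] far[of t] c[of t i j] rp_bd[of t i j] rm_bd[of t i j] m_ge m_ge_c[of i j]
      by linarith
    then show ?thesis using that by blast
  qed
  \<comment> \<open>a matrix of this size has 16 entries\<close>
  define M where "M = 16 * m"
  have M: "norm (A t *v x) \<le> M * norm x" if "t \<in> D" for t x
  proof -
    have "(\<Sum>i\<in>UNIV. \<Sum>j\<in>UNIV. norm (A t $ i $ j)) \<le> (\<Sum>i\<in>(UNIV :: 4 set). \<Sum>j\<in>(UNIV :: 4 set). m)"
      by (intro sum_mono m that)
    then have "(\<Sum>i\<in>UNIV. \<Sum>j\<in>UNIV. norm (A t $ i $ j)) \<le> M" by (simp add: M_def)
    then show ?thesis
      by (intro order_trans[OF norm_matrix_vector_mult_le] mult_right_mono) auto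
  qed
  have exists_sol: "\<exists>\<xi>. linear_ode_solution A \<xi> D \<and> \<xi> 0 = x0" for x0
    using linear_ode_existence[OF D_open D0 D_star, of A m x0] m holomorphic_on_subset[OF A_hol D_Om] by metis
  have zero_sol: "\<xi> t = 0" if "linear_ode_solution A \<xi> D" "\<xi> 0 = 0" "t \<in> D" for \<xi> t
    using linear_ode_growth[OF that(1) D_star[OF that(3)], of M] M D_star[OF that(3)] that(2) by auto

  have A_jac: "A (of_real t) *v cvec v = cvec (jacobian g (at (xh t)) *v v)" for t v
    by (simp add: A_real vec_eq_iff cvec_def matrix_vector_mult_def)
  obtain \<xi>0 where \<xi>0: "linear_ode_solution A \<xi>0 D" "\<xi>0 0 = cvec (g (xh 0))" using exists_sol by blast
  have \<xi>0_real: "\<xi>0 (of_real t) = cvec (g (xh t))" for t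
  proof (rule real_solution_extends[OF \<xi>0(1) D_real M])
    fix t
    have "(xh has_derivative (\<lambda>s. s *\<^sub>R g (xh t))) (at t)" using dxh by (simp add: has_vector_derivative_def)
    from diff_chain_at[OF this complexification_jacobian(1)[OF F]]
    have "((\<lambda>t. g (xh t)) has_vector_derivative jacobian g (at (xh t)) *v g (xh t)) (at t)"
      by (simp add: has_vector_derivative_def o_def matrix_vector_mult_scaleR)
    then have "((\<lambda>t. complex_of_real (g (xh t) $ i)) has_vector_derivative
        of_real ((jacobian g (at (xh t)) *v g (xh t)) $ i)) (at t)" for i
      unfolding has_vector_derivative_vec_iff by (intro has_vector_derivative_of_real) (simp add: has_real_derivative_iff_has_vector_derivative)
    then show "((\<lambda>t. cvec (g (xh t))) has_vector_derivative A (of_real t) *v cvec (g (xh t))) (at t)"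
      unfolding A_jac has_vector_derivative_vec_iff by (simp add: cvec_def)
  qed (use \<xi>0(2) in auto)
  have Xi: "(\<lambda>s. X s $ i) holomorphic_on \<Omega>" for i using Xhol by (simp add: vec_holomorphic_on_def)
  \<comment> \<open>both sides are holomorphic and agree on the real line; the right hand side shows that \<open>\<xi>0\<close> has
    the period of the orbit\<close>
  have \<xi>0_deriv: "\<xi>0 t $ i = deriv (\<lambda>s. X s $ i) t" if "t \<in> D" for t i
  proof -
    have "\<xi>0 t $ i - deriv (\<lambda>s. X s $ i) t = 0"
    proof (rule analytic_continuation[of "\<lambda>t. \<xi>0 t $ i - deriv (\<lambda>s. X s $ i) t" D "range complex_of_real" 0])
      show "(\<lambda>t. \<xi>0 t $ i - deriv (\<lambda>s. X s $ i) t) holomorphic_on D"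
        using linear_ode_solution_holomorphic[OF \<xi>0(1)] holomorphic_deriv[OF Xi Om(1)] D_Om
        by (intro holomorphic_on_diff) (auto intro: holomorphic_on_subset)
      show "(0::complex) islimpt range complex_of_real"
      proof (rule islimptI)
        fix S :: "complex set" assume "0 \<in> S" "open S"
        then obtain e where "0 < e" "ball 0 e \<subseteq> S" using open_contains_ball by blast
        then show "\<exists>y\<in>range complex_of_real. y \<in> S \<and> y \<noteq> 0"
          by (intro bexI[of _ "of_real (e / 2)"] rangeI) (auto simp: subset_iff)
      qed
      fix z assume "z \<in> range complex_of_real"
      then obtain s where s: "z = of_real s" by blast
      have "((\<lambda>w. X w $ i) has_field_derivative deriv (\<lambda>w. X w $ i) z) (at z)"
        using holomorphic_derivI[OF Xi Om(1)] Om(2) s by blast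
      then have "((\<lambda>r. X (of_real r) $ i) has_vector_derivative deriv (\<lambda>w. X w $ i) z) (at s)"
        using field_vector_diff_chain_at[of complex_of_real 1 s "\<lambda>w. X w $ i"] s
        by (simp add: o_def has_vector_derivative_of_real[of "\<lambda>x. x" 1, simplified])
      moreover have "((\<lambda>r. X (of_real r) $ i) has_vector_derivative of_real (g (xh s) $ i)) (at s)"
      proof -
        have "((\<lambda>s. xh s $ i) has_real_derivative g (xh s) $ i) (at s)"
          using dxh[of s] unfolding has_vector_derivative_vec_iff by (simp add: has_real_derivative_iff_has_vector_derivative)
        then show ?thesis unfolding Xreal by (simp add: cvec_def has_vector_derivative_of_real)
      qed
      ultimately have "deriv (\<lambda>w. X w $ i) z = of_real (g (xh s) $ i)" by (rule vector_derivative_unique_at)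
      then show "\<xi>0 z $ i - deriv (\<lambda>w. X w $ i) z = 0" using \<xi>0_real[of s] s by (simp add: cvec_def)
    qed (use D_open D_conn D_real D0 that in auto)
    then show ?thesis by simp
  qed
  obtain \<xi>1 where \<xi>1: "linear_ode_solution A \<xi>1 D" "\<xi>1 0 = \<eta> 0" using exists_sol by blast
  have \<xi>1_real: "\<xi>1 (of_real t) = \<eta> t" for t
  proof (rule real_solution_extends[OF \<xi>1(1) D_real M])
    show "(\<eta> has_vector_derivative A (of_real t) *v \<eta> t) (at t)" for t
      using C_solution unfolding A_real ve_solution_real_def g_def[abs_def] by blast
  qed (use \<xi>1(2) in auto)
  have phi_sol: "linear_ode_solution A \<phi> \<Omega>"
    using B3_solution by (simp add: ve_solution_on_def linear_ode_solution_def A_def)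

  have g_cont: "isCont g 0"
    using has_derivative_continuous[OF complexification_jacobian(1)[OF F]] by blast
  have bounded_tail: "\<exists>T. bounded ((\<lambda>s. cvec (g (x s))) ` {T..})" if "(x \<longlongrightarrow> 0) at_top" for x :: "real \<Rightarrow> real ^ 4"
  proof -
    have "((\<lambda>s. g (x s)) \<longlongrightarrow> 0) at_top" using isCont_tendsto_compose[OF g_cont that] g0 by simp
    then have "((\<lambda>s. norm (cvec (g (x s)))) \<longlongrightarrow> 0) at_top" using tendsto_norm[OF tendsto_cvec] by fastforce
    then have "\<forall>\<^sub>F s in at_top. norm (cvec (g (x s))) < 1" by (rule order_tendstoD(2)) simp
    then obtain T where "\<And>s. T \<le> s \<Longrightarrow> norm (cvec (g (x s))) < 1" by (auto simp: eventually_at_top_linorder)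
    then have "bounded ((\<lambda>s. cvec (g (x s))) ` {T..})" by (auto simp: bounded_iff intro!: exI[of _ 1] less_imp_le)
    then show ?thesis by blast
  qed

  \<comment> \<open>up to this radius the strips at both ends lie in the wedge, where the orbit is a function of \<open>z\<close>\<close>
  define rE where "rE = min (min rp rm) (exp (- (4 * pi / w)))"
  have rE: "0 < rE" "rE \<le> rp" "rE \<le> rm" "rE \<le> exp (- (4 * pi / w))" using rp rm by (auto simp: rE_def)
  have strip_D: "end_strip lm r \<subseteq> D" "end_strip lp r \<subseteq> D" if "0 < r" "r \<le> rE" for r
    unfolding D_def using that rE(4) end_strip_subset_wedge[OF l(1) w(1)] end_strip_subset_wedge[OF l(2) w(1)] by auto
  have phi_hol: "(\<lambda>t. \<phi> t $ i) holomorphic_on end_strip lm rE" "(\<lambda>t. \<phi> t $ i) holomorphic_on end_strip lp rE" for i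
    using linear_ode_solution_holomorphic[OF phi_sol] strip_D[OF rE(1)] D_Om
    by (meson holomorphic_on_subset order_refl order_trans)+
  obtain r1 h1 C1 where r1: "0 < r1" "r1 \<le> rE"
    and h1: "\<And>t. t \<in> end_overlap lm r1 \<Longrightarrow> \<phi> (t + end_period lm) = exp (of_real lp' * end_period lm) *s \<phi> t + h1 t"
      "\<And>t. t \<in> end_overlap lm r1 \<Longrightarrow> norm (h1 t) \<le> C1"
    and phi_grows: "filterlim (\<lambda>s. norm (\<phi> (end_ray lm s))) at_top at_top"
    using end_expansion_shift_and_growth[OF l(1) B2_nbhd B3_pos signs(3-5) rE(1) phi_hol(1)] by metis
  obtain r2 h2 C2 where r2: "0 < r2" "r2 \<le> rE"
    and h2: "\<And>t. t \<in> end_overlap lp r2 \<Longrightarrow> \<phi> (t + end_period lp) = exp (of_real lm' * end_period lp) *s \<phi> t + h2 t"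
      "\<And>t. t \<in> end_overlap lp r2 \<Longrightarrow> norm (h2 t) \<le> C2"
    using end_expansion_shift_and_growth[OF l(2) B2_nbhd B3_neg signs(6-8) rE(1) phi_hol(2)] by metis

  have \<phi>_D: "linear_ode_solution A \<phi> D" using phi_sol D_Om by (rule linear_ode_solution_subset)
  \<comment> \<open>the unboundedness of \<open>\<phi>\<close> gives \<open>c = 0\<close>\<close>
  have indep: "a = 0 \<and> b = 0 \<and> c = 0" if zero: "a *s \<xi>0 0 + b *s \<xi>1 0 + c *s \<phi> 0 = 0" for a b c
  proof -
    let ?v = "\<lambda>j t. if j = (0::nat) then \<xi>0 t else if j = 1 then \<xi>1 t else \<phi> t"
    let ?c = "\<lambda>j. if j = (0::nat) then a else if j = 1 then b else c"
    have sum3: "(\<Sum>j<3. ?c j *s ?v j t) = a *s \<xi>0 t + b *s \<xi>1 t + c *s \<phi> t" for t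
      by (simp add: eval_nat_numeral lessThan_Suc add_ac)
    have "linear_ode_solution A (\<lambda>t. \<Sum>j<3. ?c j *s ?v j t) D"
    proof (rule linear_ode_solution_sum)
      show "linear_ode_solution A (?v j) D" for j
        using \<xi>0(1) \<xi>1(1) \<phi>_D by (cases "j = 0"; cases "j = 1") simp_all
    qed
    then have vanish: "a *s \<xi>0 t + b *s \<xi>1 t + c *s \<phi> t = 0" if "t \<in> D" for t
      using zero_sol[of "\<lambda>t. \<Sum>j<3. ?c j *s ?v j t" t] zero that unfolding sum3 by blast
    have real: "a *s cvec (g (xh s)) + b *s \<eta> s + c *s \<phi> (of_real s) = 0" for s
      using vanish[of "of_real s"] D_real \<xi>0_real[of s] \<xi>1_real[of s] by (auto simp: image_subset_iff)
    have "c = 0"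
    proof (rule ccontr)
      assume c: "c \<noteq> 0"
      obtain T where "bounded ((\<lambda>s. cvec (g (xh s))) ` {T..})" using bounded_tail[OF xh_top] by blast
      then obtain K where K: "\<And>s. T \<le> s \<Longrightarrow> norm (cvec (g (xh s))) \<le> K" by (auto simp: bounded_iff)
      obtain K' where K': "\<And>s. norm (\<eta> s) \<le> K'" using C_bounded by (auto simp: bounded_iff)
      have "norm (\<phi> (of_real s)) \<le> (norm a * K + norm b * K') / norm c" if "T \<le> s" for s
      proof -
        have "c *s \<phi> (of_real s) = - (a *s cvec (g (xh s)) + b *s \<eta> s)"
          using real[of s] by (subst eq_neg_iff_add_eq_0) (simp only: add_ac)
        then have "norm c * norm (\<phi> (of_real s)) = norm (a *s cvec (g (xh s)) + b *s \<eta> s)"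
          by (metis norm_minus_cancel norm_smult_vec)
        also have "\<dots> \<le> norm a * K + norm b * K'"
          by (intro order_trans[OF norm_triangle_ineq] add_mono) (auto simp: norm_smult_vec intro!: mult_left_mono K[OF that] K')
        finally show ?thesis using c by (simp add: field_simps)
      qed
      moreover have "\<forall>\<^sub>F s in at_top. (norm a * K + norm b * K') / norm c < norm (\<phi> (end_ray lm s))"
        using phi_grows by (simp add: filterlim_at_top_dense)
      then have "\<forall>\<^sub>F s in at_top. (norm a * K + norm b * K') / norm c < norm (\<phi> (of_real s))"
        by (simp add: ray_pos)
      then obtain S where "\<And>s. S \<le> s \<Longrightarrow> (norm a * K + norm b * K') / norm c < norm (\<phi> (of_real s))"
        by (auto simp: eventually_at_top_linorder)
      from this[of "max S T"] \<open>\<And>s. T \<le> s \<Longrightarrow> norm (\<phi> (of_real s)) \<le> (norm a * K + norm b * K') / norm c\<close>[of "max S T"]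
      show False by simp
    qed
    moreover have "vector_derivative xh (at t) = g (xh t)" for t using dxh by (rule vector_derivative_at)
    then have "a = 0 \<and> b = 0"
      using real \<open>c = 0\<close> by (intro C_independent[rule_format]) simp
    ultimately show ?thesis by blast
  qed
  obtain x3 where x3: "det (\<chi> i :: 4. if i = 0 then \<xi>0 0 else if i = 1 then \<xi>1 0 else if i = 2 then \<phi> 0 else x3) \<noteq> 0"
    using complete_to_basis[OF indep] by blast
  obtain \<xi>3 where \<xi>3: "linear_ode_solution A \<xi>3 D" "\<xi>3 0 = x3" using exists_sol by blast
  \<comment> \<open>the rows form the flag, in the order \<open>0 < 1 < 2 < 3\<close> of the type \<open>4\<close>\<close>
  define V where "V t = (\<chi> i :: 4. if i = 0 then \<xi>0 t else if i = 1 then \<xi>1 t else if i = 2 then \<phi> t else \<xi>3 t)" for t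
  have V_nth: "V t $ 0 = \<xi>0 t" "V t $ 1 = \<xi>1 t" "V t $ 2 = \<phi> t" for t by (simp_all add: V_def)
  have V_sol: "linear_ode_solution A (\<lambda>t. V t $ i) D" for i
    using \<xi>0(1) \<xi>1(1) \<phi>_D \<xi>3(1) unfolding V_def
    by (cases "i = 0"; cases "i = 1"; cases "i = 2") simp_all
  have V_det0: "det (V 0) \<noteq> 0" unfolding V_def \<xi>3(2) by (rule x3)
  have V_det: "det (V t) \<noteq> 0" if "t \<in> D" for t
    by (rule fundamental_det_nonzero[OF V_sol _ M V_det0])
       (use D_star[OF that] in \<open>auto simp: closed_segment_commute\<close>)
  have V_growth: "moderate_growth D (\<lambda>t. V t $ i $ j)" for i j
  proof -
    have "norm (V t $ i $ j) \<le> norm (V 0 $ i) * exp (\<bar>M\<bar> * norm t)" if t: "t \<in> D" for t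
    proof -
      have "norm (V t $ i) \<le> exp (\<bar>M\<bar> * norm (t - 0)) * norm (V 0 $ i)"
      proof (rule linear_ode_growth[OF V_sol D_star[OF t]])
        fix u x assume "u \<in> closed_segment 0 t"
        then have "norm (A u *v x) \<le> M * norm x" using D_star[OF t] by (intro M) auto
        also have "\<dots> \<le> \<bar>M\<bar> * norm x" by (intro mult_right_mono) auto
        finally show "norm (A u *v x) \<le> \<bar>M\<bar> * norm x" .
      qed
      then show ?thesis
        using Finite_Cartesian_Product.norm_nth_le[of "V t $ i" j] by (simp add: mult.commute)
    qed
    then show ?thesis unfolding moderate_growth_def
      by (intro exI[of _ "norm (V 0 $ i)"] conjI exI[of _ "\<bar>M\<bar>"]) auto
  qed

  \<comment> \<open>the bounds by \<open>pi\<close> keep the middle part so narrow that the principal logarithm inverts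
    \<open>exp (l * t)\<close> there\<close>
  define e where "e = Min {r1, r2, w, 1, pi / \<bar>lm\<bar>, pi / \<bar>lp\<bar>}"
  have "e \<le> x" if "x \<in> {r1, r2, w, 1, pi / \<bar>lm\<bar>, pi / \<bar>lp\<bar>}" for x
    unfolding e_def using that by (intro Min_le) simp_all
  then have e_le: "e \<le> r1" "e \<le> r2" "e \<le> w" "e \<le> 1" "e \<le> pi / \<bar>lm\<bar>" "e \<le> pi / \<bar>lp\<bar>"
    by blast+
  have e_pos: "0 < e" unfolding e_def using r1(1) r2(1) w(1) l pi_gt_zero by (subst Min_gr_iff) auto
  have e_pi: "e * \<bar>lm\<bar> \<le> pi" "e * \<bar>lp\<bar> \<le> pi" using e_le(5,6) l by (simp_all add: field_simps)
  have e_rE: "e \<le> rE" using e_le(1) r1(2) by simp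
  have D_mid: "{t. \<bar>Im t\<bar> < e} \<subseteq> D"
  proof
    fix t assume "t \<in> {t. \<bar>Im t\<bar> < e}"
    then have "\<bar>Im t\<bar> < w" using e_le(3) by simp
    also have "w \<le> w * (1 + \<bar>Re t\<bar>)" using w(1) by simp
    finally show "t \<in> D" by (simp add: D_def wedge_def)
  qed
  obtain d where d: "nearly_diagonalizable (map_matrix complex_of_real (jacobian g (at 0))) d" "\<And>i. d i \<noteq> 0"
    "card {i. d i < 0} \<le> 2" "card {i. 0 < d i} \<le> 2"
  proof (rule hyperbolic_nearly_diagonalizable[of "jacobian g (at 0)" l1 l2 l3 l4])
    show "det (mat s - jacobian g (at 0)) = (s - l1) * (s - l2) * (s - l3) * (s - l4)" for s
      using B1_eigenvalues(1) by (simp add: g_def[abs_def])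
  qed (use B1_eigenvalues in auto)
  have A_lim: "((\<lambda>s. A (of_real (x s)) $ i $ j) \<longlongrightarrow> map_matrix complex_of_real (jacobian g (at 0)) $ i $ j) at_top"
    if "((\<lambda>s. xh (x s)) \<longlongrightarrow> 0) at_top" for x i j
  proof -
    have "isCont (\<lambda>y. jacobian F (at y) $ i $ j) 0"
      using jacobian_continuous_on[OF W(1) Fdiff] W(1) W0 by (simp add: continuous_on_eq_continuous_at)
    from isCont_tendsto_compose[OF this tendsto_cvec[OF that]]
    have "((\<lambda>s. jacobian F (at (cvec (xh (x s)))) $ i $ j) \<longlongrightarrow> jacobian F (at (cvec 0)) $ i $ j) at_top"
      by (simp add: cvec_0)
    then show ?thesis
      unfolding A_def Xreal complexification_jacobian(2)[OF F, of 0] .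
  qed
  have sys: "end_system A (map_matrix complex_of_real (jacobian g (at 0))) lm e M d"
    "end_system A (map_matrix complex_of_real (jacobian g (at 0))) lp e M d"
  proof -
    have "A (t + end_period lm) = A t" if "t \<in> end_overlap lm e" for t
      using that rp_per[of t] e_rE rE(2) by (simp add: A_def end_overlap_def end_strip_def)
    moreover have "A (t + end_period lp) = A t" if "t \<in> end_overlap lp e" for t
      using that rm_per[of t] e_rE rE(3) by (simp add: A_def end_overlap_def end_strip_def)
    moreover have "((\<lambda>s. A (end_ray lm s) $ i $ j) \<longlongrightarrow> map_matrix complex_of_real (jacobian g (at 0)) $ i $ j) at_top"
      "((\<lambda>s. A (end_ray lp s) $ i $ j) \<longlongrightarrow> map_matrix complex_of_real (jacobian g (at 0)) $ i $ j) at_top" for i j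
      unfolding ray_pos ray_neg using A_lim[of "\<lambda>s. s"] A_lim[of uminus] xh_top xh_neg by blast+
    moreover note strip_D[OF e_pos e_rE]
    ultimately show "end_system A (map_matrix complex_of_real (jacobian g (at 0))) lm e M d"
      "end_system A (map_matrix complex_of_real (jacobian g (at 0))) lp e M d"
      using l e_pos M d by (unfold_locales; blast)+
  qed
  \<comment> \<open>the flag is invariant under a turn around either end\<close>
  have mono: "\<exists>C. (\<forall>i j. i < j \<longrightarrow> C $ i $ j = 0) \<and> (\<forall>i. C $ i $ i \<noteq> 0) \<and>
        (\<forall>t. t \<in> end_strip l e \<longrightarrow> t + end_period l \<in> end_strip l e \<longrightarrow> V (t + end_period l) = C ** V t)"
    if ll: "l \<in> {lm, lp}" for l
  proof -
    have sub: "end_strip l e \<subseteq> D" using ll strip_D[OF e_pos e_rE] by blast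
    obtain c h K where h: "\<And>t. t \<in> end_overlap l e \<Longrightarrow> \<phi> (t + end_period l) = c *s \<phi> t + h t"
      "\<And>t. t \<in> end_overlap l e \<Longrightarrow> norm (h t) \<le> K"
    proof (cases "l = lm")
      case True
      have "t \<in> end_overlap lm r1" if "t \<in> end_overlap lm e" for t
        using that e_le(1) by (auto simp: end_overlap_def end_strip_def)
      then show ?thesis using h1 that True by blast
    next
      case False
      then have "l = lp" using ll by simp
      have "t \<in> end_overlap lp r2" if "t \<in> end_overlap lp e" for t
        using that e_le(2) by (auto simp: end_overlap_def end_strip_def)
      then show ?thesis using h2 that \<open>l = lp\<close> by blast
    qed
    have l0: "l \<noteq> 0" using ll l by auto
    show ?thesis
    proof (rule triangular_monodromy[where m = c])
      show "end_system A (map_matrix complex_of_real (jacobian g (at 0))) l e M d" using sys ll by blast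
      show "linear_ode_solution A (\<lambda>t. V t $ i) (end_strip l e)" for i
        using V_sol sub by (rule linear_ode_solution_subset)
      show "det (V t) \<noteq> 0" if "t \<in> end_strip l e" for t using V_det sub that by blast
      show "V (t + end_period l) $ 0 = V t $ 0" if t: "t \<in> end_overlap l e" for t
      proof -
        have tD: "t \<in> D" "t + end_period l \<in> D" using t sub by (auto simp: end_overlap_def)
        have X_per: "X (s + end_period l) = X s" if "s \<in> end_strip l e" for s
          using that ll rp_per[of s] rm_per[of s] e_rE rE(2,3) by (auto simp: end_strip_def)
        have "deriv (\<lambda>s. X s $ i) (t + end_period l) = deriv (\<lambda>s. X s $ i) t" for i
        proof -
          have "((\<lambda>s. X s $ i) has_field_derivative deriv (\<lambda>s. X s $ i) (t + end_period l)) (at (t + end_period l))"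
            using holomorphic_derivI[OF Xi Om(1)] tD(2) D_Om by blast
          then have "((\<lambda>s. X (s + end_period l) $ i) has_field_derivative deriv (\<lambda>s. X s $ i) (t + end_period l)) (at t)"
            by (simp add: DERIV_shift)
          then have "((\<lambda>s. X s $ i) has_field_derivative deriv (\<lambda>s. X s $ i) (t + end_period l)) (at t)"
            by (rule has_field_derivative_transform_within_open[OF _ open_end_strip[of l e]])
               (use t X_per in \<open>auto simp: end_overlap_def\<close>)
          then show ?thesis by (simp add: DERIV_imp_deriv)
        qed
        then show ?thesis unfolding V_nth using \<xi>0_deriv tD by (simp add: vec_eq_iff)
      qed
      have "\<exists>T. bounded ((\<lambda>s. \<xi>0 (end_ray l s)) ` {T..})"
      proof (cases "l = lm")
        case True
        then show ?thesis using bounded_tail[OF xh_top] by (simp add: ray_pos \<xi>0_real)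
      next
        case False
        then have "l = lp" using ll by simp
        then show ?thesis
          using bounded_tail[OF xh_neg] by (simp only: ray_neg \<xi>0_real)
      qed
      then show "bounded_on_ray l (\<lambda>t. V t $ 0)" unfolding bounded_on_ray_def V_nth .
      have "bounded ((\<lambda>s. \<xi>1 (end_ray l s)) ` {0..})"
        by (rule bounded_subset[OF C_bounded]) (auto simp: end_ray_def \<xi>1_real simp del: of_real_mult of_real_minus)
      then show "bounded_on_ray l (\<lambda>t. V t $ 1)" unfolding bounded_on_ray_def V_nth by blast
      have "bounded ((\<lambda>s. \<phi> (end_ray l s + end_period l) - c *s \<phi> (end_ray l s)) ` {1 - ln e / \<bar>l\<bar>..})"
        unfolding bounded_iff
      proof (intro exI[of _ K] ballI)
        fix y assume "y \<in> (\<lambda>s. \<phi> (end_ray l s + end_period l) - c *s \<phi> (end_ray l s)) ` {1 - ln e / \<bar>l\<bar>..}"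
        then obtain s where s: "1 - ln e / \<bar>l\<bar> \<le> s" "y = \<phi> (end_ray l s + end_period l) - c *s \<phi> (end_ray l s)" by auto
        have "end_ray l s \<in> end_overlap l e" using s(1) by (intro end_ray_in(1)[OF l0 e_pos]) simp
        then show "norm y \<le> K" using h s(2) by simp
      qed
      then show "bounded_on_ray l (\<lambda>t. V (t + end_period l) $ 2 - c *s V t $ 2)"
        unfolding bounded_on_ray_def V_nth by blast
    qed
  qed
  show ?thesis
  proof (intro exI[of _ e] conjI allI impI)
    show "0 < e" by (rule e_pos)
    fix \<Sigma> assume loc: "gamma_loc lm lp e \<Sigma>"
    \<comment> \<open>the coefficients as functions on the surface; at the ends they agree with those in the time
      coordinate except for the value at the added point\<close>
    define a where "a i j = (\<lambda>c z. jacobian F (at (gamma_param hm X hp c z)) $ i $ j)" for i j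
    have a_M: "a i j \<in> mero_functions lm lp \<Sigma>" for i j
    proof (rule mero_functions_cong_ends[OF loc])
      have end_mero: "(\<lambda>z. A (Ln z / of_real l) $ i $ j) meromorphic_on ball 0 e" if ll: "l \<in> {lm, lp}" for l
      proof -
        have sub: "end_strip l e \<subseteq> D" using ll strip_D[OF e_pos e_rE] by blast
        have "(\<lambda>z. exp (- (0 * (Ln z / of_real l))) * A (Ln z / of_real l) $ i $ j) meromorphic_on ball 0 e"
        proof (rule semi_invariant_meromorphic[OF _ e_pos e_le(4)])
          show "l \<noteq> 0" using ll l by auto
          show "(\<lambda>t. A t $ i $ j) holomorphic_on end_strip l e"
            using A_hol by (rule holomorphic_on_subset) (use sub D_Om in blast)
          show "A (t + end_period l) $ i $ j = exp (0 * end_period l) * A t $ i $ j"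
            if "t \<in> end_strip l e" "t + end_period l \<in> end_strip l e" for t
            using that ll end_system.period[OF sys(1), of t] end_system.period[OF sys(2), of t]
            by (auto simp: end_overlap_def)
          show "moderate_growth (end_strip l e) (\<lambda>t. A t $ i $ j)"
            unfolding moderate_growth_def
            by (intro exI[of _ "\<bar>m\<bar>"] conjI exI[of _ 0]) (use m sub in \<open>force intro: order_trans[OF _ abs_ge_self]\<close>)+
        qed
        then show ?thesis by simp
      qed
      show "surface_function lm lp (\<lambda>t. A t $ i $ j) \<in> mero_functions lm lp \<Sigma>"
      proof (rule surface_function_in_mero[OF loc l e_pi])
        have "(\<lambda>t. A t $ i $ j) analytic_on \<Omega>" using A_hol Om(1) by (simp add: analytic_on_open)
        then show "(\<lambda>t. A t $ i $ j) meromorphic_on {t. \<bar>Im t\<bar> < e}"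
          using D_mid D_Om analytic_on_imp_meromorphic_on meromorphic_on_subset by blast
      qed (use end_mero in auto)
      show "a i j Mid z = surface_function lm lp (\<lambda>t. A t $ i $ j) Mid z" for z
        by (simp add: a_def gamma_param_def surface_function_def A_def)
      fix z :: complex assume z: "z \<noteq> 0" "norm z < e"
      show "a i j Pos z = surface_function lm lp (\<lambda>t. A t $ i $ j) Pos z"
        using rp_h[of z] z e_rE rE(2) by (simp add: a_def gamma_param_def surface_function_def A_def)
      show "a i j Neg z = surface_function lm lp (\<lambda>t. A t $ i $ j) Neg z"
        using rm_h[of z] z e_rE rE(3) by (simp add: a_def gamma_param_def surface_function_def A_def)
    qed
    have a_Mid: "a i j Mid t = A t $ i $ j" for i j t by (simp add: a_def gamma_param_def A_def)
    show "galois_triangularizable_over_mero TYPE('l) lm lp \<Sigma> F (gamma_param hm X hp)"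
      unfolding galois_triangularizable_over_mero_def
    proof (intro allI impI)
      fix \<delta> :: "'l \<Rightarrow> 'l" and \<iota> K L Y
      assume emb: "mero_embedding lm lp \<Sigma> \<delta> \<iota>" and K: "K = \<iota> ` mero_functions lm lp \<Sigma>"
        and pv: "picard_vessiot \<delta> K (ve_matrix \<iota> F (gamma_param hm X hp)) L Y"
      have "ve_matrix \<iota> F (gamma_param hm X hp) = (\<chi> i j. \<iota> (a i j))" by (simp add: ve_matrix_def a_def)
      then show "triangularizable (constants \<delta> K) (galois_matrices \<delta> K L Y)"
        using pv unfolding K
        by (intro triangularizable_if_triangular_monodromy[OF signs(1,2) loc e_pos e_le(4) e_pi D_open D_mid
              strip_D[OF e_pos e_rE] V_sol V_growth V_det0 mono emb a_M a_Mid]) auto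
    qed
  qed
qed

end
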